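(* Consider a solution $(\tilde u_h^n,u_h^n,P_h^n)$ of the EMAC-BE-PROJ algorithm (written out in the context), and assume that the data and the solution vanish on a strip along the boundary: $f$, $\tilde u_h^n$, $u_h^n$, $P_h^n$ all vanish on $\Omega_s$, the part of $\Omega$ covered by the strip of mesh elements along $\partial\Omega$. Let $\psi_i$ be the $i$-th standard basis vector of $\mathbb R^d$ (a constant field), and set $M_i^n=(u_h^n,\psi_i)$ and $\tilde M_i^n=(\tilde u_h^n,\psi_i)$. Then the method has the momentum balance in which the nonlinear term does not contribute: for every $i=1,\dots,d$ and $n=0,1,\dots,M-1$, $$\tilde M_i^{n+1}-\tilde M_i^n=\Delta t\,(f(t^{n+1}),\psi_i)\qquad\text{and}\qquad M_i^{n+1}-M_i^n=\Delta t\,(f(t^{n+1}),\psi_i).$$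
   Context: Domain and spaces. $\Omega\subseteq\mathbb R^d$ ($d=2,3$) is convex polygonal (or has smooth boundary); $(\cdot,\cdot)$ is the $L^2(\Omega)$ inner product (also used for the duality pairing with $f$). Velocity-type functions are $\mathbb R^d$-valued. $X=\{v\in H^1(\Omega): v|_{\partial\Omega}=0\}$, $Q=\{q\in L^2(\Omega):\int_\Omega q\,dx=0\}$, $Y=\{v\in L^2(\Omega):\nabla\cdot v\in L^2(\Omega),\ v\cdot\hat n|_{\partial\Omega}=0\}$. Discretization. $\tau_h$ is a regular conforming triangulation of $\Omega$; $P_k(\tau_h)$ denotes piecewise polynomials of degree $k$. $X_h=X\cap P_k(\tau_h)$, $Q_h=Q\cap P_{k-1}(\tau_h)\cap C^0(\Omega)$, $Y_h=Y\cap P_k(\tau_h)\supset X_h$, $V_h=\{v_h\in X_h:(\nabla\cdot v_h,q_h)=0\ \forall q_h\in Q_h\}$. It is assumed that there is $\beta>0$ independent of $h$ with $\beta\|\nabla q\|\le\sup_{0\ne v\in X_h}\frac{(\nabla q,v)}{\|v\|}$ for all $q\in Q_h$. Since $f$ vanishes on $\Omega_s$, the pairing of $f(t^{n+1})$ with the constant field $\psi_i$ is well defined and equals its pairing with any $\psi_{i,h}\in X_h$ that equals $\psi_i$ on $\Omega\setminus\Omega_s$. Nonlinear form. With $D(u)=\frac12(\nabla u+\nabla u^T)$, $c(u,v,w)=(2D(u)v,w)+((\nabla\cdot u)v,w)$. EMAC-BE-PROJ algorithm. Given viscosity $\nu>0$, $f\in L^\infty(0,T;H^{-1}(\Omega))$,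 a solenoidal initial condition $u^0\in L^2(\Omega)$ satisfying no-slip boundary conditions, $u_h^0=\tilde u_h^0$ the $L^2$ projection of $u^0$ into $V_h$, end time $T$ and number of time steps $M$, set $\Delta t=T/M$, $t^n=n\Delta t$. For $n=0,1,\dots,M-1$: Step 1: find $\tilde u_h^{n+1}\in X_h$ with $$\frac1{\Delta t}(\tilde u_h^{n+1}-u_h^n,\chi_h)+c(\tilde u_h^{n+1},\tilde u_h^{n+1},\chi_h)+\nu(\nabla\tilde u_h^{n+1},\nabla\chi_h)=(f(t^{n+1}),\chi_h)\quad\forall\chi_h\in X_h.$$ Step 2: find $(u_h^{n+1},P_h^{n+1})\in Y_h\times Q_h$ with $$\frac1{\Delta t}(u_h^{n+1},w_h)-(P_h^{n+1},\nabla\cdot w_h)=\frac1{\Delta t}(\tilde u_h^{n+1},w_h),\qquad(\nabla\cdot u_h^{n+1},q_h)=0\quad\forall(w_h,q_h)\in Y_h\times Q_h.$$ *)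

theory Defs
  imports "HOL-Analysis.Analysis"
begin

section \<open>Lebesgue and Sobolev spaces on an open set\<close>

text \<open>
  Elements of the function spaces are represented by functions on the whole of \<open>real ^ 'd\<close>, of
  which only the values almost everywhere on \<open>\<Omega>\<close> matter.
\<close>

definition L2 :: "(real ^ 'd) set \<Rightarrow> (real ^ 'd \<Rightarrow> 'b::euclidean_space) set" where
  "L2 \<Omega> = {v \<in> borel_measurable (lebesgue_on \<Omega>). integrable (lebesgue_on \<Omega>) (\<lambda>x. (norm (v x))\<^sup>2)}"

definition L2_inner ::
  "(real ^ 'd) set \<Rightarrow> (real ^ 'd \<Rightarrow> 'b::euclidean_space) \<Rightarrow> (real ^ 'd \<Rightarrow> 'b) \<Rightarrow> real" where
  "L2_inner \<Omega> u v = (LINT x|lebesgue_on \<Omega>. u x \<bullet> v x)"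

definition L2_norm :: "(real ^ 'd) set \<Rightarrow> (real ^ 'd \<Rightarrow> 'b::euclidean_space) \<Rightarrow> real" where
  "L2_norm \<Omega> v = sqrt (L2_inner \<Omega> v v)"

definition partial_deriv :: "'d \<Rightarrow> (real ^ 'd \<Rightarrow> real) \<Rightarrow> real ^ 'd \<Rightarrow> real" where
  "partial_deriv j \<phi> x = frechet_derivative \<phi> (at x) (axis j 1)"

text \<open>\<open>C\<^sup>\<infinity>\<close>: iterated partial derivatives of every order exist and are differentiable.\<close>

coinductive smooth :: "(real ^ 'd \<Rightarrow> real) \<Rightarrow> bool" where
  "\<lbrakk>\<forall>x. \<phi> differentiable (at x); \<forall>j. smooth (partial_deriv j \<phi>)\<rbrakk> \<Longrightarrow> smooth \<phi>"

definition test_functions :: "(real ^ 'd) set \<Rightarrow> (real ^ 'd \<Rightarrow> real) set" where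
  "test_functions \<Omega> =
     {\<phi>. smooth \<phi> \<and> compact (closure {x. \<phi> x \<noteq> 0}) \<and> closure {x. \<phi> x \<noteq> 0} \<subseteq> \<Omega>}"

definition has_weak_partial ::
  "(real ^ 'd) set \<Rightarrow> 'd \<Rightarrow> (real ^ 'd \<Rightarrow> real) \<Rightarrow> (real ^ 'd \<Rightarrow> real) \<Rightarrow> bool" where
  "has_weak_partial \<Omega> j u g \<longleftrightarrow>
     (\<forall>\<phi>\<in>test_functions \<Omega>. L2_inner \<Omega> u (partial_deriv j \<phi>) = - L2_inner \<Omega> g \<phi>)"

definition H1 :: "(real ^ 'd) set \<Rightarrow> (real ^ 'd \<Rightarrow> real) set" where
  "H1 \<Omega> = {u \<in> L2 \<Omega>. \<forall>j. \<exists>g\<in>L2 \<Omega>. has_weak_partial \<Omega> j u g}"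

text \<open>The weak derivatives below are unique only up to null sets; the choice operator fixes a
  representative.\<close>

definition weak_partial :: "(real ^ 'd) set \<Rightarrow> 'd \<Rightarrow> (real ^ 'd \<Rightarrow> real) \<Rightarrow> real ^ 'd \<Rightarrow> real" where
  "weak_partial \<Omega> j u = (SOME g. g \<in> L2 \<Omega> \<and> has_weak_partial \<Omega> j u g)"

definition weak_grad :: "(real ^ 'd) set \<Rightarrow> (real ^ 'd \<Rightarrow> real) \<Rightarrow> real ^ 'd \<Rightarrow> real ^ 'd" where
  "weak_grad \<Omega> q x = (\<chi> j. weak_partial \<Omega> j q x)"

definition weak_jacobian ::
  "(real ^ 'd) set \<Rightarrow> (real ^ 'd \<Rightarrow> real ^ 'd) \<Rightarrow> real ^ 'd \<Rightarrow> real ^ 'd ^ 'd" where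
  "weak_jacobian \<Omega> v x = (\<chi> i j. weak_partial \<Omega> j (\<lambda>y. v y $ i) x)"

definition has_weak_div ::
  "(real ^ 'd) set \<Rightarrow> (real ^ 'd \<Rightarrow> real ^ 'd) \<Rightarrow> (real ^ 'd \<Rightarrow> real) \<Rightarrow> bool" where
  "has_weak_div \<Omega> v g \<longleftrightarrow>
     (\<forall>\<phi>\<in>test_functions \<Omega>. L2_inner \<Omega> v (\<lambda>x. \<chi> j. partial_deriv j \<phi> x) = - L2_inner \<Omega> g \<phi>)"

definition weak_div :: "(real ^ 'd) set \<Rightarrow> (real ^ 'd \<Rightarrow> real ^ 'd) \<Rightarrow> real ^ 'd \<Rightarrow> real" where
  "weak_div \<Omega> v = (SOME g. g \<in> L2 \<Omega> \<and> has_weak_div \<Omega> v g)"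

text \<open>\<open>u = 0\<close> on the boundary is understood in the usual Sobolev sense:
  \<open>u\<close> lies in the \<open>H\<^sup>1\<close>-closure of the test functions.\<close>

definition H1_0 :: "(real ^ 'd) set \<Rightarrow> (real ^ 'd \<Rightarrow> real) set" where
  "H1_0 \<Omega> = {u \<in> H1 \<Omega>. \<forall>\<epsilon>>0. \<exists>\<phi>\<in>test_functions \<Omega>.
     L2_norm \<Omega> (\<lambda>x. u x - \<phi> x) < \<epsilon> \<and>
     (\<forall>j. L2_norm \<Omega> (\<lambda>x. weak_partial \<Omega> j u x - partial_deriv j \<phi> x) < \<epsilon>)}"

definition X_space :: "(real ^ 'd) set \<Rightarrow> (real ^ 'd \<Rightarrow> real ^ 'd) set" where
  "X_space \<Omega> = {v. \<forall>i. (\<lambda>x. v x $ i) \<in> H1_0 \<Omega>}"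

definition Q_space :: "(real ^ 'd) set \<Rightarrow> (real ^ 'd \<Rightarrow> real) set" where
  "Q_space \<Omega> = {q \<in> L2 \<Omega>. (LINT x|lebesgue_on \<Omega>. q x) = 0}"

text \<open>For \<open>v\<close> and its divergence in \<open>L\<^sup>2\<close>, the normal trace is the functional
  \<open>\<phi> \<mapsto> (v, \<nabla>\<phi>) + (\<nabla>\<cdot>v, \<phi>)\<close> on \<open>H\<^sup>1\<close> (Green's formula); \<open>v \<cdot> n = 0\<close> says that it is zero.\<close>

definition Y_space :: "(real ^ 'd) set \<Rightarrow> (real ^ 'd \<Rightarrow> real ^ 'd) set" where
  "Y_space \<Omega> = {v \<in> L2 \<Omega>. (\<exists>g\<in>L2 \<Omega>. has_weak_div \<Omega> v g) \<and>
     (\<forall>\<phi>\<in>H1 \<Omega>. L2_inner \<Omega> v (weak_grad \<Omega> \<phi>) + L2_inner \<Omega> (weak_div \<Omega> v) \<phi> = 0)}"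

definition H1_norm :: "(real ^ 'd) set \<Rightarrow> (real ^ 'd \<Rightarrow> real ^ 'd) \<Rightarrow> real" where
  "H1_norm \<Omega> v = sqrt ((L2_norm \<Omega> v)\<^sup>2 + (L2_norm \<Omega> (weak_jacobian \<Omega> v))\<^sup>2)"

text \<open>\<open>H\<^sup>-\<^sup>1\<close> is the dual of \<open>X\<close>; \<open>F v\<close> is the duality pairing \<open>(F, v)\<close>.\<close>

definition Hm1 :: "(real ^ 'd) set \<Rightarrow> ((real ^ 'd \<Rightarrow> real ^ 'd) \<Rightarrow> real) set" where
  "Hm1 \<Omega> = {F.
     (\<forall>u\<in>X_space \<Omega>. \<forall>v\<in>X_space \<Omega>. \<forall>a b. F (\<lambda>x. a *\<^sub>R u x + b *\<^sub>R v x) = a * F u + b * F v) \<and>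
     (\<exists>C. \<forall>v\<in>X_space \<Omega>. \<bar>F v\<bar> \<le> C * H1_norm \<Omega> v)}"

text \<open>\<open>f\<close> is a representative with values in \<open>H\<^sup>-\<^sup>1\<close> at every time, since the scheme evaluates it
  at the discrete times (including \<open>T\<close>). As \<open>H\<^sup>-\<^sup>1\<close> is separable, weak and strong measurability
  agree.\<close>

definition Linf_Hm1 ::
  "(real ^ 'd) set \<Rightarrow> real \<Rightarrow> (real \<Rightarrow> (real ^ 'd \<Rightarrow> real ^ 'd) \<Rightarrow> real) set" where
  "Linf_Hm1 \<Omega> T = {f. (\<forall>t\<in>{0<..T}. f t \<in> Hm1 \<Omega>) \<and>
     (\<forall>v\<in>X_space \<Omega>. (\<lambda>t. f t v) \<in> borel_measurable (lebesgue_on {0<..<T})) \<and>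
     (\<exists>C. AE t in lebesgue_on {0<..<T}. \<forall>v\<in>X_space \<Omega>. \<bar>f t v\<bar> \<le> C * H1_norm \<Omega> v)}"

definition functional_vanishes_on ::
  "(real ^ 'd) set \<Rightarrow> (real ^ 'd) set \<Rightarrow> ((real ^ 'd \<Rightarrow> real ^ 'd) \<Rightarrow> real) \<Rightarrow> bool" where
  "functional_vanishes_on \<Omega> S F \<longleftrightarrow>
     (\<forall>v\<in>X_space \<Omega>. (AE x in lebesgue_on (\<Omega> - S). v x = 0) \<longrightarrow> F v = 0)"

text \<open>The pairing \<open>(F, w)\<close> for a functional \<open>F\<close> vanishing on \<open>S\<close> and a field \<open>w\<close> that need not
  vanish on the boundary: the common value of \<open>F\<close> on all elements of \<open>X\<close> that agree with \<open>w\<close>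
  off \<open>S\<close>.\<close>

definition ext_pairing ::
  "(real ^ 'd) set \<Rightarrow> (real ^ 'd) set \<Rightarrow> ((real ^ 'd \<Rightarrow> real ^ 'd) \<Rightarrow> real) \<Rightarrow>
   (real ^ 'd \<Rightarrow> real ^ 'd) \<Rightarrow> real" where
  "ext_pairing \<Omega> S F w =
     (THE r. \<exists>v\<in>X_space \<Omega>. (AE x in lebesgue_on (\<Omega> - S). v x = w x) \<and> r = F v)"


section \<open>Meshes and finite element spaces\<close>

text \<open>Conformity is the condition on intersections in \<^const>\<open>triangulation\<close>; \<open>\<sigma>\<close> is the shape
  regularity constant.\<close>

definition regular_triangulation_of ::
  "real \<Rightarrow> (real ^ 'd) set set \<Rightarrow> (real ^ 'd) set \<Rightarrow> bool" where
  "regular_triangulation_of \<sigma> \<tau> \<Omega> \<longleftrightarrow>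
     triangulation \<tau> \<and> (\<forall>T\<in>\<tau>. int CARD('d) simplex T) \<and>
     \<Omega> = interior (\<Union>\<tau>) \<and> closure \<Omega> = \<Union>\<tau> \<and>
     (\<forall>T\<in>\<tau>. \<exists>x. ball x (diameter T / \<sigma>) \<subseteq> T)"

definition smooth_boundary :: "(real ^ 'd) set \<Rightarrow> bool" where
  "smooth_boundary D \<longleftrightarrow>
     (\<forall>x\<in>frontier D. \<exists>U g. open U \<and> x \<in> U \<and> smooth g \<and> (\<exists>j. partial_deriv j g x \<noteq> 0) \<and>
        D \<inter> U = {y\<in>U. g y < 0})"

text \<open>Straight simplices cannot fill a domain \<open>D\<close> with smooth boundary. In that case \<open>\<Omega>\<close> is, as
  usual, the polyhedral domain covered by the mesh, whose boundary vertices lie on the boundary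
  of \<open>D\<close>.\<close>

definition admissible_domain :: "(real ^ 'd) set set \<Rightarrow> (real ^ 'd) set \<Rightarrow> bool" where
  "admissible_domain \<tau> \<Omega> \<longleftrightarrow> \<Omega> \<noteq> {} \<and>
     (convex \<Omega> \<and> polytope (closure \<Omega>) \<or>
      (\<exists>D. open D \<and> bounded D \<and> smooth_boundary D \<and>
         (\<forall>T\<in>\<tau>. \<forall>x\<in>frontier \<Omega>. x extreme_point_of T \<longrightarrow> x \<in> frontier D)))"

text \<open>Strip of mesh elements along the boundary: all elements that touch it, be it in a single
  vertex. (An element of \<open>X\<^sub>h\<close> equal to a nonzero constant on an element cannot vanish at a vertex
  of it.)\<close>

definition boundary_strip :: "(real ^ 'd) set set \<Rightarrow> (real ^ 'd) set \<Rightarrow> (real ^ 'd) set" where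
  "boundary_strip \<tau> \<Omega> = \<Omega> \<inter> \<Union>{T\<in>\<tau>. T \<inter> frontier \<Omega> \<noteq> {}}"

definition polynomial_of_degree_le :: "nat \<Rightarrow> (real ^ 'd \<Rightarrow> real) \<Rightarrow> bool" where
  "polynomial_of_degree_le k p \<longleftrightarrow>
     (\<exists>c. \<forall>x. p x = (\<Sum>\<alpha> | (\<Sum>j\<in>UNIV. \<alpha> j) \<le> k. c \<alpha> * (\<Prod>j\<in>UNIV. x $ j ^ \<alpha> j)))"

definition piecewise_poly :: "nat \<Rightarrow> (real ^ 'd) set set \<Rightarrow> (real ^ 'd \<Rightarrow> real) set" where
  "piecewise_poly k \<tau> =
     {v. \<forall>T\<in>\<tau>. \<exists>p. polynomial_of_degree_le k p \<and> (AE x in lebesgue_on T. v x = p x)}"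

definition piecewise_poly_field ::
  "nat \<Rightarrow> (real ^ 'd) set set \<Rightarrow> (real ^ 'd \<Rightarrow> real ^ 'd) set" where
  "piecewise_poly_field k \<tau> = {v. \<forall>i. (\<lambda>x. v x $ i) \<in> piecewise_poly k \<tau>}"

definition Xh :: "(real ^ 'd) set \<Rightarrow> (real ^ 'd) set set \<Rightarrow> nat \<Rightarrow> (real ^ 'd \<Rightarrow> real ^ 'd) set" where
  "Xh \<Omega> \<tau> k = X_space \<Omega> \<inter> piecewise_poly_field k \<tau>"

definition Qh :: "(real ^ 'd) set \<Rightarrow> (real ^ 'd) set set \<Rightarrow> nat \<Rightarrow> (real ^ 'd \<Rightarrow> real) set" where
  "Qh \<Omega> \<tau> k = Q_space \<Omega> \<inter> piecewise_poly (k - 1) \<tau> \<inter> {q. continuous_on \<Omega> q}"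

definition Yh :: "(real ^ 'd) set \<Rightarrow> (real ^ 'd) set set \<Rightarrow> nat \<Rightarrow> (real ^ 'd \<Rightarrow> real ^ 'd) set" where
  "Yh \<Omega> \<tau> k = Y_space \<Omega> \<inter> piecewise_poly_field k \<tau>"

definition Vh :: "(real ^ 'd) set \<Rightarrow> (real ^ 'd) set set \<Rightarrow> nat \<Rightarrow> (real ^ 'd \<Rightarrow> real ^ 'd) set" where
  "Vh \<Omega> \<tau> k = {v \<in> Xh \<Omega> \<tau> k. \<forall>q\<in>Qh \<Omega> \<tau> k. L2_inner \<Omega> (weak_div \<Omega> v) q = 0}"

definition inf_sup :: "real \<Rightarrow> (real ^ 'd) set \<Rightarrow> (real ^ 'd) set set \<Rightarrow> nat \<Rightarrow> bool" where
  "inf_sup \<beta> \<Omega> \<tau> k \<longleftrightarrow>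
     (\<forall>q\<in>Qh \<Omega> \<tau> k. \<beta> * L2_norm \<Omega> (weak_grad \<Omega> q) \<le>
        (SUP v\<in>{v \<in> Xh \<Omega> \<tau> k. L2_norm \<Omega> v \<noteq> 0}. L2_inner \<Omega> (weak_grad \<Omega> q) v / L2_norm \<Omega> v))"


section \<open>The EMAC-BE-PROJ scheme\<close>

definition sym_grad ::
  "(real ^ 'd) set \<Rightarrow> (real ^ 'd \<Rightarrow> real ^ 'd) \<Rightarrow> real ^ 'd \<Rightarrow> real ^ 'd ^ 'd" where
  "sym_grad \<Omega> u x = (1/2) *\<^sub>R (weak_jacobian \<Omega> u x + transpose (weak_jacobian \<Omega> u x))"

definition emac_form ::
  "(real ^ 'd) set \<Rightarrow> (real ^ 'd \<Rightarrow> real ^ 'd) \<Rightarrow> (real ^ 'd \<Rightarrow> real ^ 'd) \<Rightarrow>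
   (real ^ 'd \<Rightarrow> real ^ 'd) \<Rightarrow> real" where
  "emac_form \<Omega> u v w =
     L2_inner \<Omega> (\<lambda>x. (2 *\<^sub>R sym_grad \<Omega> u x) *v v x) w +
     L2_inner \<Omega> (\<lambda>x. weak_div \<Omega> u x *\<^sub>R v x) w"

definition is_L2_projection ::
  "(real ^ 'd) set \<Rightarrow> (real ^ 'd \<Rightarrow> real ^ 'd) set \<Rightarrow> (real ^ 'd \<Rightarrow> real ^ 'd) \<Rightarrow>
   (real ^ 'd \<Rightarrow> real ^ 'd) \<Rightarrow> bool" where
  "is_L2_projection \<Omega> V u p \<longleftrightarrow> p \<in> V \<and> (\<forall>v\<in>V. L2_inner \<Omega> (\<lambda>x. p x - u x) v = 0)"

text \<open>For a field that is merely in \<open>L\<^sup>2\<close> and solenoidal, the normal component is the part of the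
  no-slip condition that has a meaning.\<close>

definition admissible_initial :: "(real ^ 'd) set \<Rightarrow> (real ^ 'd \<Rightarrow> real ^ 'd) \<Rightarrow> bool" where
  "admissible_initial \<Omega> u0 \<longleftrightarrow>
     u0 \<in> Y_space \<Omega> \<and> (AE x in lebesgue_on \<Omega>. weak_div \<Omega> u0 x = 0)"

definition emac_be_proj_solution ::
  "(real ^ 'd) set \<Rightarrow> (real ^ 'd) set set \<Rightarrow> nat \<Rightarrow> real \<Rightarrow>
   (real \<Rightarrow> (real ^ 'd \<Rightarrow> real ^ 'd) \<Rightarrow> real) \<Rightarrow> (real ^ 'd \<Rightarrow> real ^ 'd) \<Rightarrow> real \<Rightarrow> nat \<Rightarrow>
   (nat \<Rightarrow> real ^ 'd \<Rightarrow> real ^ 'd) \<Rightarrow> (nat \<Rightarrow> real ^ 'd \<Rightarrow> real ^ 'd) \<Rightarrow>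
   (nat \<Rightarrow> real ^ 'd \<Rightarrow> real) \<Rightarrow> bool" where
  "emac_be_proj_solution \<Omega> \<tau> k \<nu> f u0 T M ut u P \<longleftrightarrow>
     (let dt = T / real M in
      is_L2_projection \<Omega> (Vh \<Omega> \<tau> k) u0 (u 0) \<and>
      (AE x in lebesgue_on \<Omega>. ut 0 x = u 0 x) \<and>
      (\<forall>n<M.
         ut (Suc n) \<in> Xh \<Omega> \<tau> k \<and>
         (\<forall>v\<in>Xh \<Omega> \<tau> k.
            1 / dt * L2_inner \<Omega> (\<lambda>x. ut (Suc n) x - u n x) v
            + emac_form \<Omega> (ut (Suc n)) (ut (Suc n)) v
            + \<nu> * L2_inner \<Omega> (weak_jacobian \<Omega> (ut (Suc n))) (weak_jacobian \<Omega> v)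
            = f (real (Suc n) * dt) v) \<and>
         u (Suc n) \<in> Yh \<Omega> \<tau> k \<and> P (Suc n) \<in> Qh \<Omega> \<tau> k \<and>
         (\<forall>w\<in>Yh \<Omega> \<tau> k.
            1 / dt * L2_inner \<Omega> (u (Suc n)) w - L2_inner \<Omega> (P (Suc n)) (weak_div \<Omega> w)
            = 1 / dt * L2_inner \<Omega> (ut (Suc n)) w) \<and>
         (\<forall>q\<in>Qh \<Omega> \<tau> k. L2_inner \<Omega> (weak_div \<Omega> (u (Suc n))) q = 0)))"

definition momentum :: "(real ^ 'd) set \<Rightarrow> 'd \<Rightarrow> (real ^ 'd \<Rightarrow> real ^ 'd) \<Rightarrow> real" where
  "momentum \<Omega> i v = L2_inner \<Omega> v (\<lambda>x. axis i 1)"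

end

theory Submission
  imports Defs
begin

text \<open>
  Testing both steps of the scheme with the basis vector \<open>e\<^sub>i\<close> would give the balance at once, but \<open>e\<^sub>i\<close>
  does not vanish on the boundary. It is replaced by \<open>\<psi> = \<phi> e\<^sub>i\<close>, where \<open>\<phi>\<close> is the continuous piecewise
  affine function that is \<open>1\<close> at the mesh vertices inside \<open>\<Omega>\<close> and \<open>0\<close> at those on the boundary. Then \<open>\<psi>\<close> is a
  discrete velocity and equals \<open>e\<^sub>i\<close> off the strip (\<open>exists_strip_test_field\<close>). Since the solution vanishes
  on the strip, no term of the scheme distinguishes \<open>\<psi>\<close> from \<open>e\<^sub>i\<close>, and the pairing of \<open>f\<close> with \<open>e\<^sub>i\<close> is by
  definition the pairing with \<open>\<psi>\<close> (\<open>ext_pairing_eq\<close>).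

  In the first step the viscous term pairs the gradient of the velocity, which is zero on the strip, with
  that of \<open>\<psi>\<close>, which is zero off the strip. The nonlinear term is the integral of
  \<open>\<Sum>\<^sub>j \<partial>\<^sub>j (v\<^sub>i v\<^sub>j) + \<partial>\<^sub>i (v \<bullet> v) / 2\<close> and is zero because \<open>v\<close> has zero boundary values
  (\<open>emac_terms_cancel\<close>). In the second step the pressure is zero on the strip and the divergence of \<open>\<psi>\<close> off
  the strip, so the projection preserves the momentum. Hence the momenta of the two velocities agree at all times.

  Two analytic facts carry the argument. First, weak derivatives are unique and local
  (\<open>weak_eq_imp_AE_eq\<close>, from the \<open>fundamental_lemma\<close>); this gives control of the derivatives that the
  definitions select by choice. Second, \<open>\<phi>\<close> lies in \<open>H1_0\<close>, that is, it is a limit of test functions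
  (\<open>lipschitz_H1_0\<close>). Both are obtained by mollification (\<open>test_function_approx\<close>). That \<open>\<phi>\<close> vanishes on the
  whole boundary, and not only at the boundary vertices, is a consequence of the conformity of the mesh
  (\<open>open_segment_from_interior\<close>).
\<close>

section \<open>Smooth functions and a smooth bump\<close>

lemma linear_eq_inner:
  fixes f :: "real ^ 'd \<Rightarrow> real"
  assumes "linear f"
  shows "f v = (\<chi> j. f (axis j 1)) \<bullet> v"
proof -
  have "f v = f (\<Sum>j\<in>UNIV. (v $ j) *\<^sub>R axis j 1)"
    using basis_expansion[of v] by (simp add: scalar_mult_eq_scaleR)
  also have "\<dots> = (\<Sum>j\<in>UNIV. v $ j * f (axis j 1))"
    by (simp add: linear_sum[OF assms] linear_scale[OF assms])
  finally show ?thesis by (simp add: inner_vec_def mult.commute)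
qed

definition grad :: "(real ^ 'd \<Rightarrow> real) \<Rightarrow> real ^ 'd \<Rightarrow> real ^ 'd" where
  "grad \<phi> x = (\<chi> j. partial_deriv j \<phi> x)"

lemma partial_deriv_eqI:
  "(\<phi> has_derivative D) (at x) \<Longrightarrow> partial_deriv j \<phi> x = D (axis j 1)"
  unfolding partial_deriv_def by (metis frechet_derivative_at)

lemma has_derivative_grad:
  fixes \<phi> :: "real ^ 'd \<Rightarrow> real"
  assumes "\<phi> differentiable (at x)"
  shows "(\<phi> has_derivative (\<lambda>v. grad \<phi> x \<bullet> v)) (at x)"
proof -
  let ?D = "frechet_derivative \<phi> (at x)"
  have D: "(\<phi> has_derivative ?D) (at x)"
    using assms frechet_derivative_works by blast
  then have lin: "linear ?D" by (rule has_derivative_linear)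
  have "?D v = grad \<phi> x \<bullet> v" for v
    unfolding grad_def partial_deriv_def by (rule linear_eq_inner[OF lin])
  then have "?D = (\<lambda>v. grad \<phi> x \<bullet> v)" by (rule ext)
  then show ?thesis using D by simp
qed

lemma smooth_differentiable: "smooth \<phi> \<Longrightarrow> \<phi> differentiable (at x)"
  by (erule smooth.cases) simp

lemma smooth_partial_deriv: "smooth \<phi> \<Longrightarrow> smooth (partial_deriv j \<phi>)"
  by (erule smooth.cases) simp

lemma smooth_continuous_on: "smooth \<phi> \<Longrightarrow> continuous_on S \<phi>"
  by (meson differentiable_imp_continuous_on differentiable_on_def differentiable_at_withinI smooth_differentiable)

lemma continuous_on_grad:
  fixes \<phi> :: "real ^ 'd \<Rightarrow> real"
  assumes "smooth \<phi>" shows "continuous_on S (grad \<phi>)"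
  unfolding grad_def
  by (intro continuous_on_vec_lambda smooth_continuous_on smooth_partial_deriv assms)

text \<open>The functions \<open>exp (- 1 / t) / t ^ m\<close>, extended by zero to \<open>t \<le> 0\<close>: up to linear combination this
  family is closed under differentiation.\<close>

definition flat_exp :: "nat \<Rightarrow> real \<Rightarrow> real" where
  "flat_exp m t = (if t > 0 then exp (- 1 / t) / t ^ m else 0)"

lemma flat_exp_tendsto_0: "(flat_exp m \<longlongrightarrow> 0) (at 0)"
proof -
  have "((\<lambda>t. (inverse t) ^ m / exp (inverse t)) \<longlongrightarrow> (0::real)) (at_right 0)"
    by (rule filterlim_compose[OF tendsto_power_div_exp_0 filterlim_inverse_at_top_right])
  moreover have "\<forall>\<^sub>F t in at_right 0. (inverse t) ^ m / exp (inverse t) = flat_exp m t"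
    using eventually_at_right_less[of "0::real"]
    by eventually_elim (simp add: flat_exp_def exp_minus field_simps)
  ultimately have "(flat_exp m \<longlongrightarrow> 0) (at_right 0)"
    by (rule Lim_transform_eventually)
  moreover have "(flat_exp m \<longlongrightarrow> 0) (at_left 0)"
  proof (rule Lim_transform_eventually[OF tendsto_const])
    show "\<forall>\<^sub>F t in at_left 0. 0 = flat_exp m t"
      using eventually_at_left_real[of "-1::real" 0]
      by (auto simp: flat_exp_def elim!: eventually_mono)
  qed
  ultimately show ?thesis by (simp add: filterlim_split_at)
qed

text \<open>Only \<open>t = 0\<close> needs an argument. There the difference quotient of \<open>flat_exp m\<close> is \<open>flat_exp (m + 1)\<close>,
  which tends to \<open>0\<close>, because the exponential beats every power.\<close>

lemma flat_exp_has_derivative: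
  "(flat_exp m has_real_derivative flat_exp (m + 2) t - real m * flat_exp (m + 1) t) (at t)"
proof (cases t "0::real" rule: linorder_cases)
  case less
  then have "\<forall>\<^sub>F s in nhds t. flat_exp m s = 0"
    using eventually_nhds_in_open[of "{..<0::real}" t] by (auto elim!: eventually_mono simp: flat_exp_def)
  moreover have "flat_exp (m + 2) t = 0" "flat_exp (m + 1) t = 0" using less by (auto simp: flat_exp_def)
  ultimately show ?thesis by (subst DERIV_cong_ev[OF refl _ refl]) auto
next
  case equal
  have "((\<lambda>s. (flat_exp m s - flat_exp m 0) / (s - 0)) \<longlongrightarrow> 0) (at 0)"
  proof (rule Lim_transform_eventually[OF flat_exp_tendsto_0[of "m+1"]])
    show "\<forall>\<^sub>F s in at 0. flat_exp (m + 1) s = (flat_exp m s - flat_exp m 0) / (s - 0)"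
      by (auto simp: flat_exp_def eventually_at_filter)
  qed
  then show ?thesis using equal by (simp add: has_field_derivative_iff flat_exp_def)
next
  case greater
  then have ev: "\<forall>\<^sub>F s in nhds t. flat_exp m s = exp (- 1 / s) / s ^ m"
    using eventually_nhds_in_open[of "{0<..}" t] by (auto elim!: eventually_mono simp: flat_exp_def)
  have "((\<lambda>s. exp (- 1 / s) / s ^ m) has_real_derivative
      ((1 / t^2) * exp (- 1 / t) * t ^ m - exp (- 1 / t) * (real m * t ^ (m - 1))) / (t ^ m * t ^ m)) (at t)"
    using greater by (auto intro!: derivative_eq_intros simp: power2_eq_square)
  moreover have "((1 / t^2) * exp (- 1 / t) * t ^ m - exp (- 1 / t) * (real m * t ^ (m - 1))) / (t ^ m * t ^ m)
     = flat_exp (m + 2) t - real m * flat_exp (m + 1) t"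
    using greater by (cases m) (auto simp: flat_exp_def field_simps power2_eq_square)
  ultimately show ?thesis by (subst DERIV_cong_ev[OF refl ev refl]) simp
qed

text \<open>Smoothness is coinductive, so it suffices to exhibit a class of differentiable functions that contains
  the bump \<open>flat_exp 0 (\<delta>\<^sup>2 - x \<bullet> x)\<close> and is closed under partial derivatives. The algebra generated
  by the coordinates and all \<open>flat_exp m (c - x \<bullet> x)\<close> is such a class, by the product and chain rules.\<close>

inductive bump_algebra :: "real \<Rightarrow> (real ^ 'd \<Rightarrow> real) \<Rightarrow> bool" for c where
  const: "bump_algebra c (\<lambda>x. r)"
| coord: "bump_algebra c (\<lambda>x. x $ i)"
| flat: "bump_algebra c (\<lambda>x. flat_exp m (c - x \<bullet> x))"
| add: "bump_algebra c p \<Longrightarrow> bump_algebra c q \<Longrightarrow> bump_algebra c (\<lambda>x. p x + q x)"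
| mult: "bump_algebra c p \<Longrightarrow> bump_algebra c q \<Longrightarrow> bump_algebra c (\<lambda>x. p x * q x)"

lemma bump_algebra_partial_deriv:
  fixes p :: "real ^ 'd \<Rightarrow> real"
  assumes "bump_algebra c p"
  shows "(\<forall>x. p differentiable (at x)) \<and> (\<forall>j. bump_algebra c (partial_deriv j p))"
  using assms
proof induction
  case (const r)
  have "partial_deriv j (\<lambda>x::real^'d. r) = (\<lambda>x. 0)" for j
    by (rule ext, rule trans, rule partial_deriv_eqI, rule has_derivative_const) simp
  then show ?case using bump_algebra.const by auto
next
  case (coord i)
  have D: "((\<lambda>x::real^'d. x $ i) has_derivative (\<lambda>x. x $ i)) (at x)" for x
    by (rule bounded_linear_imp_has_derivative) (rule bounded_linear_vec_nth)
  then have "partial_deriv j (\<lambda>x::real^'d. x $ i) = (\<lambda>x. axis j 1 $ i)" for j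
    by (rule_tac ext) (rule partial_deriv_eqI)
  then show ?case using bump_algebra.const D unfolding differentiable_def by fastforce
next
  case (flat m)
  let ?d = "\<lambda>x::real^'d. flat_exp (m + 2) (c - x \<bullet> x) + (- real m) * flat_exp (m + 1) (c - x \<bullet> x)"
  have D: "((\<lambda>x::real^'d. flat_exp m (c - x \<bullet> x)) has_derivative (\<lambda>v. ?d x * (- 2 * (x \<bullet> v)))) (at x)" for x
  proof -
    have "((\<lambda>x. c - x \<bullet> x) has_derivative (\<lambda>v. - 2 * (x \<bullet> v))) (at x)"
      by (auto intro!: derivative_eq_intros simp: inner_commute)
    then have "((\<lambda>x. flat_exp m (c - x \<bullet> x)) has_derivative (\<lambda>v. - 2 * (x \<bullet> v) * 
        (flat_exp (m + 2) (c - x \<bullet> x) - real m * flat_exp (m + 1) (c - x \<bullet> x)))) (at x)"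
      using DERIV_compose_FDERIV[OF flat_exp_has_derivative] by blast
    then show ?thesis by (simp add: mult.commute)
  qed
  then have "partial_deriv j (\<lambda>x::real^'d. flat_exp m (c - x \<bullet> x)) = (\<lambda>x. ?d x * (- 2 * (x $ j)))" for j
    by (rule_tac ext, subst partial_deriv_eqI[OF D]) (simp add: inner_axis)
  moreover have "bump_algebra c (\<lambda>x::real^'d. ?d x * (- 2 * (x $ j)))" for j
    by (intro bump_algebra.intros)
  ultimately show ?case using D unfolding differentiable_def by auto
next
  case (add p q)
  have "partial_deriv j (\<lambda>x. p x + q x) = (\<lambda>x. partial_deriv j p x + partial_deriv j q x)" for j
    unfolding partial_deriv_def
    by (rule ext, subst frechet_derivative_at[symmetric, OF has_derivative_add])
       (use add in \<open>auto simp: frechet_derivative_works[symmetric]\<close>)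
  then show ?case using add by (auto intro!: bump_algebra.add)
next
  case (mult p q)
  have "partial_deriv j (\<lambda>x. p x * q x) = (\<lambda>x. p x * partial_deriv j q x + partial_deriv j p x * q x)" for j
    unfolding partial_deriv_def
    by (rule ext, subst frechet_derivative_at[symmetric, OF has_derivative_mult])
       (use mult in \<open>auto simp: frechet_derivative_works[symmetric]\<close>)
  then show ?case using mult by (auto intro!: bump_algebra.add bump_algebra.mult)
qed

lemma bump_algebra_smooth: "bump_algebra c p \<Longrightarrow> smooth p"
proof (coinduction arbitrary: p)
  case smooth
  then show ?case using bump_algebra_partial_deriv[of c p] by blast
qed

definition mollifier :: "real \<Rightarrow> (real ^ 'd \<Rightarrow> real) \<Rightarrow> bool" where
  "mollifier \<delta> \<eta> \<longleftrightarrow> smooth \<eta> \<and> (\<forall>x. \<eta> x \<ge> 0) \<and> (\<forall>x. norm x \<ge> \<delta> \<longrightarrow> \<eta> x = 0) \<and>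
     integrable lborel \<eta> \<and> integral\<^sup>L lborel \<eta> = 1"

lemma exists_mollifier:
  assumes "\<delta> > 0"
  obtains \<eta> :: "real ^ 'd \<Rightarrow> real" where "mollifier \<delta> \<eta>"
proof -
  define b where "b = (\<lambda>x::real^'d. flat_exp 0 (\<delta>\<^sup>2 - x \<bullet> x))"
  have pos: "b x > 0 \<longleftrightarrow> norm x < \<delta>" for x
  proof -
    have "x \<bullet> x < \<delta>\<^sup>2 \<longleftrightarrow> norm x < \<delta>"
      using assms by (metis abs_norm_cancel abs_of_pos dot_square_norm norm_lt_square power2_norm_eq_inner)
    then show ?thesis by (auto simp: b_def flat_exp_def)
  qed
  have nonneg: "b x \<ge> 0" for x by (auto simp: b_def flat_exp_def)
  have zero: "b x = 0" if "norm x \<ge> \<delta>" for x using pos[of x] nonneg[of x] that by auto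
  have sm: "smooth (\<lambda>x. r * b x)" for r
    unfolding b_def by (rule bump_algebra_smooth[of "\<delta>\<^sup>2"]) (intro bump_algebra.intros)
  have cont: "continuous_on S b" for S using smooth_continuous_on[OF sm[of 1]] by simp
  have "integrable lborel (\<lambda>x. indicator (cball 0 \<delta>) x *\<^sub>R b x)"
    by (rule borel_integrable_compact) (auto intro: cont)
  moreover have "(\<lambda>x. indicator (cball 0 \<delta>) x *\<^sub>R b x) = b"
    using zero by (auto simp: fun_eq_iff indicator_def)
  ultimately have int: "integrable lborel b" by simp
  define I where "I = integral\<^sup>L lborel b"
  have "I \<noteq> 0"
  proof
    assume "I = 0"
    then have "AE x in lborel. b x = 0"
      using integral_nonneg_eq_0_iff_AE[OF int] nonneg by (simp add: I_def)
    then have "AE x in lborel. x \<notin> ball (0::real^'d) \<delta>"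
      by (rule AE_mp) (use pos in \<open>auto intro!: AE_I2 simp: less_le\<close>)
    then have "ball 0 \<delta> \<in> null_sets (lborel :: (real^'d) measure)"
      by (subst AE_iff_null_sets) auto
    then have "negligible (ball (0::real^'d) \<delta>)"
      using negligible_iff_null_sets null_sets_completionI by blast
    then show False using open_not_negligible[of "ball (0::real^'d) \<delta>"] assms by simp
  qed
  moreover have "I \<ge> 0" unfolding I_def using nonneg by simp
  ultimately have I: "I > 0" by simp
  show ?thesis
  proof (rule that[of "\<lambda>x. (1/I) * b x"])
    have "integral\<^sup>L lborel (\<lambda>x. (1/I) * b x) = 1" using I by (simp add: I_def[symmetric])
    then show "mollifier \<delta> (\<lambda>x. (1/I) * b x)"
      unfolding mollifier_def using I sm[of "1/I"] nonneg zero int by auto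
  qed
qed

section \<open>Mollification of Lipschitz functions\<close>

definition mollify :: "(real ^ 'd \<Rightarrow> real) \<Rightarrow> (real ^ 'd \<Rightarrow> real) \<Rightarrow> real ^ 'd \<Rightarrow> real" where
  "mollify \<eta> \<psi> x = (\<integral>y. \<psi> y * \<eta> (x - y) \<partial>lborel)"

lemma mollify_eq_integral_cbox:
  fixes \<eta> \<psi> :: "real ^ 'd \<Rightarrow> real"
  assumes \<psi>: "continuous_on UNIV \<psi>" "\<And>y. y \<notin> cbox a b \<Longrightarrow> \<psi> y = 0"
    and \<eta>: "continuous_on UNIV \<eta>"
  shows "mollify \<eta> \<psi> x = integral (cbox a b) (\<lambda>y. \<psi> y * \<eta> (x - y))"
proof -
  have "continuous_on (cbox a b) (\<lambda>y. \<psi> y * \<eta> (x - y))"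
    by (intro continuous_intros continuous_on_subset[OF \<psi>(1)] continuous_on_compose2[OF \<eta>]) auto
  then have "set_integrable lborel (cbox a b) (\<lambda>y. \<psi> y * \<eta> (x - y))"
    unfolding set_integrable_def by (intro borel_integrable_compact) auto
  then have "(LINT y:cbox a b|lborel. \<psi> y * \<eta> (x - y)) = integral (cbox a b) (\<lambda>y. \<psi> y * \<eta> (x - y))"
    by (rule set_borel_integral_eq_integral)
  moreover have "(\<lambda>y. indicator (cbox a b) y *\<^sub>R (\<psi> y * \<eta> (x - y))) = (\<lambda>y. \<psi> y * \<eta> (x - y))"
    using \<psi>(2) by (auto simp: fun_eq_iff indicator_def)
  ultimately show ?thesis by (simp add: mollify_def set_lebesgue_integral_def)
qed

text \<open>Differentiation under the integral sign puts all derivatives on the kernel \<open>\<eta>\<close>.\<close>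

lemma mollify_partial_deriv:
  fixes \<eta> \<psi> :: "real ^ 'd \<Rightarrow> real"
  assumes \<psi>: "continuous_on UNIV \<psi>" "\<And>y. y \<notin> cbox a b \<Longrightarrow> \<psi> y = 0"
    and \<eta>: "smooth \<eta>"
  shows "mollify \<eta> \<psi> differentiable (at x)"
    and "partial_deriv j (mollify \<eta> \<psi>) x = mollify (partial_deriv j \<eta>) \<psi> x"
proof -
  let ?f = "\<lambda>x t. \<psi> t * \<eta> (x - t)"
  let ?fx = "\<lambda>x t. blinfun_inner_right (\<psi> t *\<^sub>R grad \<eta> (x - t))"
  have c\<eta>: "continuous_on S \<eta>" for S using \<eta> by (rule smooth_continuous_on)
  have cfx: "continuous_on (UNIV \<times> cbox a b) (\<lambda>(x, t). ?fx x t)"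
    unfolding split_beta
    by (intro bounded_linear.continuous_on[OF bounded_linear_blinfun_inner_right] continuous_on_scaleR
        continuous_on_compose2[OF \<psi>(1)] continuous_on_compose2[OF continuous_on_grad[OF \<eta>, of UNIV]]
        continuous_intros) auto
  have D: "((\<lambda>x. integral (cbox a b) (?f x)) has_derivative integral (cbox a b) (?fx x)) (at x)"
  proof (rule leibniz_rule[where U=UNIV])
    fix x t
    have "((\<lambda>x. \<eta> (x - t)) has_derivative (\<lambda>v. grad \<eta> (x - t) \<bullet> v)) (at x)"
      by (rule has_derivative_compose[where f="\<lambda>x. x - t" and g=\<eta>, 
            OF _ has_derivative_grad[OF smooth_differentiable[OF \<eta>]]])
         (auto intro!: derivative_eq_intros)
    moreover have "blinfun_apply (?fx x t) = (\<lambda>v. \<psi> t * (grad \<eta> (x - t) \<bullet> v))"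
      by (rule ext) simp
    ultimately show "((\<lambda>x. ?f x t) has_derivative blinfun_apply (?fx x t)) (at x)"
      by (simp only: has_derivative_mult_right)
  next
    fix x show "?f x integrable_on cbox a b"
      by (intro integrable_continuous continuous_intros continuous_on_subset[OF \<psi>(1)] 
          continuous_on_compose2[OF c\<eta>[of UNIV]]) auto
  qed (use cfx in auto)
  have eq: "mollify \<eta> \<psi> = (\<lambda>x. integral (cbox a b) (?f x))"
    by (rule ext) (rule mollify_eq_integral_cbox[OF \<psi> c\<eta>])
  show "mollify \<eta> \<psi> differentiable (at x)" unfolding eq differentiable_def using D by blast
  have "?fx x integrable_on cbox a b"
    by (intro integrable_continuous bounded_linear.continuous_on[OF bounded_linear_blinfun_inner_right] continuous_on_scaleR
        continuous_on_subset[OF \<psi>(1)] continuous_on_compose2[OF continuous_on_grad[OF \<eta>, of UNIV]]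
        continuous_intros) auto
  then have "blinfun_apply (integral (cbox a b) (?fx x)) (axis j 1)
      = integral (cbox a b) (\<lambda>t. blinfun_apply (?fx x t) (axis j 1))"
    by (rule blinfun_apply_integral)
  also have "\<dots> = integral (cbox a b) (\<lambda>t. \<psi> t * partial_deriv j \<eta> (x - t))"
    by (simp add: inner_axis grad_def)
  also have "\<dots> = mollify (partial_deriv j \<eta>) \<psi> x"
    by (rule mollify_eq_integral_cbox[OF \<psi>, symmetric])
       (auto intro: smooth_continuous_on smooth_partial_deriv \<eta>)
  finally show "partial_deriv j (mollify \<eta> \<psi>) x = mollify (partial_deriv j \<eta>) \<psi> x"
    using partial_deriv_eqI[OF D] unfolding eq by simp
qed

text \<open>By the preceding lemma the functions \<open>mollify \<eta> \<psi>\<close> with smooth \<open>\<eta>\<close> are closed under partial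
  derivatives; hence smoothness follows by coinduction although \<open>\<psi>\<close> is merely continuous.\<close>

lemma smooth_mollify:
  fixes \<eta> \<psi> :: "real ^ 'd \<Rightarrow> real"
  assumes \<psi>: "continuous_on UNIV \<psi>" "\<And>y. y \<notin> cbox a b \<Longrightarrow> \<psi> y = 0"
  shows "smooth \<eta> \<Longrightarrow> smooth (mollify \<eta> \<psi>)"
proof (coinduction arbitrary: \<eta>)
  case smooth
  have "partial_deriv j (mollify \<eta> \<psi>) = mollify (partial_deriv j \<eta>) \<psi>" for j
    by (rule ext) (rule mollify_partial_deriv[OF \<psi> smooth])
  moreover have "mollify \<eta> \<psi> differentiable (at x)" for x
    by (rule mollify_partial_deriv[OF \<psi> smooth])
  ultimately show ?case using smooth_partial_deriv[OF smooth] by metis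
qed

lemma lborel_integral_reflect:
  fixes f :: "'a::euclidean_space \<Rightarrow> real"
  assumes [measurable]: "f \<in> borel_measurable borel"
  shows "(\<integral>y. f (x - y) \<partial>lborel) = (\<integral>y. f y \<partial>lborel)"
proof -
  have "lborel = distr lborel borel (\<lambda>y. x - y)"
    using lborel_affine[of "-1" x] by (simp add: density_1)
  then have "(\<integral>y. f y \<partial>lborel) = (\<integral>y. f y \<partial>(distr lborel borel (\<lambda>y. x - y)))" by simp
  also have "\<dots> = (\<integral>y. f (x - y) \<partial>lborel)" by (rule integral_distr) auto
  finally show ?thesis by simp
qed

lemma integrable_mult_mollifier:
  fixes \<eta> g :: "real ^ 'd \<Rightarrow> real"
  assumes "mollifier \<delta> \<eta>" "continuous_on UNIV g"
  shows "integrable lborel (\<lambda>z. g z * \<eta> z)"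
proof -
  have "continuous_on S (\<lambda>z. g z * \<eta> z)" for S
    by (rule continuous_on_mult[OF continuous_on_subset[OF assms(2)] smooth_continuous_on])
      (use assms(1) in \<open>auto simp: mollifier_def\<close>)
  then have "integrable lborel (\<lambda>z. indicator (cball 0 \<delta>) z *\<^sub>R (g z * \<eta> z))"
    by (intro borel_integrable_compact) auto
  moreover have "(\<lambda>z. indicator (cball 0 \<delta>) z *\<^sub>R (g z * \<eta> z)) = (\<lambda>z. g z * \<eta> z)"
    using assms by (auto simp: fun_eq_iff indicator_def mollifier_def)
  ultimately show ?thesis by simp
qed

text \<open>This form, in which the kernel carries no shift, shows that \<open>mollify \<eta> \<psi> x\<close> is an average of the
  values of \<open>\<psi>\<close> near \<open>x\<close>. All estimates below are read off from it.\<close>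

lemma mollify_swap:
  fixes \<eta> \<psi> :: "real ^ 'd \<Rightarrow> real"
  assumes "continuous_on UNIV \<psi>" "continuous_on UNIV \<eta>"
  shows "mollify \<eta> \<psi> x = (\<integral>z. \<psi> (x - z) * \<eta> z \<partial>lborel)"
proof -
  have "continuous_on UNIV (\<lambda>z. \<psi> (x - z) * \<eta> z)"
    using assms by (auto intro!: continuous_intros continuous_on_compose2[OF assms(1)])
  then have "(\<lambda>z. \<psi> (x - z) * \<eta> z) \<in> borel_measurable borel"
    by (rule borel_measurable_continuous_onI)
  from lborel_integral_reflect[OF this, of x] show ?thesis by (simp add: mollify_def)
qed

lemma mollify_close:
  fixes \<eta> \<psi> :: "real ^ 'd \<Rightarrow> real"
  assumes \<eta>: "mollifier \<delta> \<eta>" and \<psi>: "continuous_on UNIV \<psi>"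
    and B: "\<And>z. norm z < \<delta> \<Longrightarrow> \<bar>\<psi> (x - z) - c\<bar> \<le> B" and "B \<ge> 0"
  shows "\<bar>mollify \<eta> \<psi> x - c\<bar> \<le> B"
proof -
  have c\<eta>: "continuous_on UNIV \<eta>" using \<eta> by (auto simp: mollifier_def smooth_continuous_on)
  have c1: "continuous_on UNIV (\<lambda>z. \<psi> (x - z))"
    by (intro continuous_on_compose2[OF \<psi>] continuous_intros) auto
  have "(\<integral>z. c * \<eta> z \<partial>lborel) = c" using \<eta> by (simp add: mollifier_def)
  then have "mollify \<eta> \<psi> x - c = (\<integral>z. \<psi> (x - z) * \<eta> z - c * \<eta> z \<partial>lborel)"
    using integrable_mult_mollifier[OF \<eta> c1] integrable_mult_mollifier[OF \<eta>, of "\<lambda>z. c"]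
    by (simp add: mollify_swap[OF \<psi> c\<eta>])
  also have "\<bar>\<dots>\<bar> \<le> (\<integral>z. B * \<eta> z \<partial>lborel)"
    unfolding real_norm_def[symmetric]
  proof (rule Bochner_Integration.integral_norm_bound_integral)
    show "integrable lborel (\<lambda>z. \<psi> (x - z) * \<eta> z - c * \<eta> z)"
      using integrable_mult_mollifier[OF \<eta> c1] integrable_mult_mollifier[OF \<eta>, of "\<lambda>z. c"] by auto
    show "integrable lborel (\<lambda>z. B * \<eta> z)" using \<eta> by (simp add: mollifier_def)
    fix z
    show "norm (\<psi> (x - z) * \<eta> z - c * \<eta> z) \<le> B * \<eta> z"
    proof (cases "norm z < \<delta>")
      case True
      have "norm (\<psi> (x - z) * \<eta> z - c * \<eta> z) = \<bar>\<psi> (x - z) - c\<bar> * \<bar>\<eta> z\<bar>"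
        by (metis abs_mult left_diff_distrib real_norm_def)
      also have "\<dots> \<le> B * \<bar>\<eta> z\<bar>" using B[OF True] by (rule mult_right_mono) simp
      also have "\<bar>\<eta> z\<bar> = \<eta> z" using \<eta> by (simp add: mollifier_def)
      finally show ?thesis .
    next
      case False
      then show ?thesis using \<eta> by (simp add: mollifier_def)
    qed
  qed
  also have "\<dots> = B" using \<eta> by (simp add: mollifier_def)
  finally show ?thesis .
qed

text \<open>Where \<open>\<psi>\<close> is affine on a ball larger than the support of the kernel, averaging only shifts it by a
  constant, so the gradient is reproduced exactly.\<close>

lemma mollify_affine:
  fixes \<eta> \<psi> :: "real ^ 'd \<Rightarrow> real"
  assumes \<eta>: "mollifier \<delta> \<eta>" and \<psi>: "continuous_on UNIV \<psi>"
    and aff: "\<And>y. y \<in> ball x r \<Longrightarrow> \<psi> y = c + g \<bullet> (y - x)" and "\<delta> < r"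
  shows "partial_deriv j (mollify \<eta> \<psi>) x = g $ j"
proof -
  have c\<eta>: "continuous_on UNIV \<eta>" using \<eta> by (auto simp: mollifier_def smooth_continuous_on)
  have int: "integrable lborel (\<lambda>z. (g \<bullet> z) * \<eta> z)" "integrable lborel \<eta>"
    using \<eta> by (auto intro!: integrable_mult_mollifier[OF \<eta>] continuous_intros simp: mollifier_def)
  define C where "C = c - (\<integral>z. (g \<bullet> z) * \<eta> z \<partial>lborel)"
  have "mollify \<eta> \<psi> y = C + g \<bullet> (y - x)" if y: "y \<in> ball x (r - \<delta>)" for y
  proof -
    have "\<psi> (y - z) * \<eta> z = (c + g \<bullet> (y - x)) * \<eta> z - (g \<bullet> z) * \<eta> z" for z
    proof (cases "norm z < \<delta>")
      case True
      have "dist x (y - z) \<le> dist x y + norm z"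
        by (metis dist_norm dist_triangle add_diff_cancel_left' diff_add_cancel)
      then have "y - z \<in> ball x r" using True y by simp
      then show ?thesis by (simp add: aff inner_diff_right algebra_simps)
    next
      case False
      then show ?thesis using \<eta> by (simp add: mollifier_def)
    qed
    then have "mollify \<eta> \<psi> y = (\<integral>z. (c + g \<bullet> (y - x)) * \<eta> z - (g \<bullet> z) * \<eta> z \<partial>lborel)"
      by (simp add: mollify_swap[OF \<psi> c\<eta>])
    also have "\<dots> = C + g \<bullet> (y - x)"
      using int \<eta> by (simp add: C_def mollifier_def)
    finally show ?thesis .
  qed
  moreover have "((\<lambda>y. C + g \<bullet> (y - x)) has_derivative (\<lambda>v. g \<bullet> v)) (at x)"
    by (auto intro!: derivative_eq_intros)
  moreover have "open (ball x (r - \<delta>))" "x \<in> ball x (r - \<delta>)" using \<open>\<delta> < r\<close> by auto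
  ultimately have "(mollify \<eta> \<psi> has_derivative (\<lambda>v. g \<bullet> v)) (at x)"
    by (metis (no_types, lifting) has_derivative_transform_within_open)
  from partial_deriv_eqI[OF this] show ?thesis by (simp add: inner_axis)
qed

lemma difference_quotient_tendsto:
  fixes \<phi> :: "real ^ 'd \<Rightarrow> real"
  assumes "(\<phi> has_derivative D) (at x)"
  shows "((\<lambda>t. (\<phi> (x + t *\<^sub>R v) - \<phi> x) / t) \<longlongrightarrow> D v) (at 0)"
proof -
  have "((\<lambda>t. x + t *\<^sub>R v) has_derivative (\<lambda>t. t *\<^sub>R v)) (at 0)"
    by (auto intro!: derivative_eq_intros)
  then have "((\<lambda>t. \<phi> (x + t *\<^sub>R v)) has_derivative (\<lambda>t. D (t *\<^sub>R v))) (at 0)"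
    using has_derivative_compose[where f="\<lambda>t. x + t *\<^sub>R v" and g=\<phi> and x=0 and s=UNIV] assms by simp
  moreover have "D (t *\<^sub>R v) = D v * t" for t
    using linear_scale[OF has_derivative_linear[OF assms]] by simp
  ultimately have "((\<lambda>t. \<phi> (x + t *\<^sub>R v)) has_real_derivative D v) (at 0)"
    by (simp add: has_field_derivative_def)
  then show ?thesis by (simp add: has_field_derivative_iff)
qed

lemma partial_deriv_bound:
  fixes \<phi> :: "real ^ 'd \<Rightarrow> real"
  assumes "L-lipschitz_on UNIV \<phi>" "\<phi> differentiable (at x)"
  shows "\<bar>partial_deriv j \<phi> x\<bar> \<le> L"
proof -
  have "((\<lambda>t. (\<phi> (x + t *\<^sub>R axis j 1) - \<phi> x) / t) \<longlongrightarrow> partial_deriv j \<phi> x) (at 0)"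
    using assms(2) difference_quotient_tendsto frechet_derivative_works unfolding partial_deriv_def by blast
  then have "((\<lambda>t. \<bar>(\<phi> (x + t *\<^sub>R axis j 1) - \<phi> x) / t\<bar>) \<longlongrightarrow> \<bar>partial_deriv j \<phi> x\<bar>) (at 0)"
    by (rule tendsto_rabs)
  moreover have "\<bar>(\<phi> (x + t *\<^sub>R axis j 1) - \<phi> x) / t\<bar> \<le> L" if "t \<noteq> 0" for t
    using lipschitz_onD[OF assms(1), of "x + t *\<^sub>R axis j 1" x] that
    by (simp add: dist_norm divide_le_eq norm_axis_1)
  ultimately show ?thesis
    by (intro tendsto_upperbound[where F="at (0::real)"]) (auto simp: eventually_at_filter)
qed

text \<open>The approximation by test functions on which everything else rests. The last clause is what makes the
  gradients converge: around almost every point the functions of interest are affine, and there a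
  sufficiently fine mollification has the right gradient.\<close>

lemma test_function_approx:
  fixes \<psi> :: "real ^ 'd \<Rightarrow> real"
  assumes "open \<Omega>" and lip: "L-lipschitz_on UNIV \<psi>" and "compact K" "K \<subseteq> \<Omega>"
    and supp: "\<And>x. x \<notin> K \<Longrightarrow> \<psi> x = 0" and "\<epsilon> > 0"
  obtains \<phi> where "\<phi> \<in> test_functions \<Omega>" "\<And>x. \<bar>\<phi> x - \<psi> x\<bar> \<le> \<epsilon>"
    "\<And>x j. \<bar>partial_deriv j \<phi> x\<bar> \<le> L"
    "\<And>x c g r j. r > \<epsilon> \<Longrightarrow> (\<And>y. y \<in> ball x r \<Longrightarrow> \<psi> y = c + g \<bullet> (y - x)) \<Longrightarrow> partial_deriv j \<phi> x = g $ j"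
proof -
  have L: "L \<ge> 0" using lip by (rule lipschitz_on_nonneg)
  have \<psi>: "continuous_on UNIV \<psi>" using lip by (rule lipschitz_on_continuous_on)
  obtain e where e: "e > 0" "(\<Union>x\<in>K. cball x e) \<subseteq> \<Omega>"
    using compact_subset_open_imp_cball_epsilon_subset[OF \<open>compact K\<close> \<open>open \<Omega>\<close> \<open>K \<subseteq> \<Omega>\<close>] by metis
  \<comment> \<open>The margin \<open>e\<close> keeps the support inside \<open>\<Omega>\<close>; the second bound gives both \<open>L * \<delta> \<le> \<epsilon>\<close>, the uniform
    error of mollification, and \<open>\<delta> \<le> \<epsilon>\<close>, so that balls of radius above \<open>\<epsilon>\<close> see the whole kernel.\<close>
  define \<delta> where "\<delta> = min e (\<epsilon> / (L + 1))"
  have \<delta>: "\<delta> > 0" "\<delta> \<le> e" "L * \<delta> \<le> \<epsilon>" "\<delta> \<le> \<epsilon>"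
  proof -
    show "\<delta> > 0" "\<delta> \<le> e" using e L \<open>\<epsilon> > 0\<close> by (auto simp: \<delta>_def)
    have "\<delta> \<le> \<epsilon> / (L + 1)" by (simp add: \<delta>_def)
    then have "(L + 1) * \<delta> \<le> \<epsilon>" using L by (simp add: field_simps)
    moreover have "(L + 1) * \<delta> = L * \<delta> + \<delta>" by (simp add: algebra_simps)
    moreover have "L * \<delta> \<ge> 0" using L \<open>\<delta> > 0\<close> by simp
    ultimately show "L * \<delta> \<le> \<epsilon>" "\<delta> \<le> \<epsilon>" using \<open>\<delta> > 0\<close> by linarith+
  qed
  obtain \<eta> :: "real ^ 'd \<Rightarrow> real" where \<eta>: "mollifier \<delta> \<eta>"
    using exists_mollifier[OF \<delta>(1)] .
  then have s\<eta>: "smooth \<eta>" and c\<eta>: "continuous_on UNIV \<eta>" by (auto simp: mollifier_def smooth_continuous_on)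
  obtain a b where ab: "K \<subseteq> cbox a b"
    using bounded_subset_cbox_symmetric[OF compact_imp_bounded[OF \<open>compact K\<close>]] by blast
  then have \<psi>0: "\<And>y. y \<notin> cbox a b \<Longrightarrow> \<psi> y = 0" using supp by blast
  define \<phi> where "\<phi> = mollify \<eta> \<psi>"
  have sm: "smooth \<phi>" unfolding \<phi>_def by (rule smooth_mollify[OF \<psi> \<psi>0 s\<eta>])
  have lip\<psi>: "\<bar>\<psi> x - \<psi> y\<bar> \<le> L * norm (x - y)" for x y
    using lipschitz_onD[OF lip, of x y] by (simp add: dist_norm)
  have "\<bar>\<phi> x - \<psi> x\<bar> \<le> \<epsilon>" for x
    unfolding \<phi>_def
  proof (rule mollify_close[OF \<eta> \<psi>])
    fix z :: "real^'d" assume "norm z < \<delta>"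
    then have "L * norm z \<le> L * \<delta>" using L by (intro mult_left_mono) auto
    then show "\<bar>\<psi> (x - z) - \<psi> x\<bar> \<le> \<epsilon>" using lip\<psi>[of "x - z" x] \<delta> by simp
  qed (use \<open>\<epsilon> > 0\<close> in auto)
  moreover have "L-lipschitz_on UNIV \<phi>"
  proof (rule lipschitz_onI[OF _ L])
    fix x y
    have c1: "continuous_on UNIV (\<lambda>z. \<psi> (z + (x - y)) - \<psi> z)"
      by (intro continuous_intros continuous_on_compose2[OF \<psi>]) auto
    have c2: "continuous_on UNIV (\<lambda>z. \<psi> (x - z))" for x
      by (intro continuous_intros continuous_on_compose2[OF \<psi>]) auto
    have "\<phi> x - \<phi> y = mollify \<eta> (\<lambda>z. \<psi> (z + (x - y)) - \<psi> z) y"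
      using integrable_mult_mollifier[OF \<eta> c2[of x]] integrable_mult_mollifier[OF \<eta> c2[of y]]
      by (simp add: \<phi>_def mollify_swap[OF \<psi> c\<eta>] mollify_swap[OF c1 c\<eta>] left_diff_distrib)
    then show "dist (\<phi> x) (\<phi> y) \<le> L * dist x y"
      using mollify_close[OF \<eta> c1, of y 0 "L * norm (x - y)"] lip\<psi>[of "y - z + (x - y)" "y - z" for z] L
      by (simp add: dist_norm)
  qed
  then have "\<bar>partial_deriv j \<phi> x\<bar> \<le> L" for x j
    by (rule partial_deriv_bound) (rule smooth_differentiable[OF sm])
  moreover have "partial_deriv j \<phi> x = g $ j" 
    if "r > \<epsilon>" "\<And>y. y \<in> ball x r \<Longrightarrow> \<psi> y = c + g \<bullet> (y - x)" for x c g r j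
    unfolding \<phi>_def by (rule mollify_affine[OF \<eta> \<psi> that(2)]) (use that \<delta> in auto)
  moreover have "\<phi> \<in> test_functions \<Omega>"
  proof -
    let ?S = "\<Union>x\<in>K. \<Union>y\<in>cball 0 \<delta>. {x + y}"
    have S: "compact ?S" using \<open>compact K\<close> by (intro compact_sums') auto
    have "?S \<subseteq> \<Omega>" using e \<delta>(2) by (fastforce simp: dist_norm)
    moreover have "{x. \<phi> x \<noteq> 0} \<subseteq> ?S"
    proof clarsimp
      fix x assume "\<phi> x \<noteq> 0"
      have "\<exists>z. norm z < \<delta> \<and> x - z \<in> K"
      proof (rule ccontr)
        assume "\<nexists>z. norm z < \<delta> \<and> x - z \<in> K"
        then have "\<bar>\<phi> x - 0\<bar> \<le> 0" unfolding \<phi>_def by (intro mollify_close[OF \<eta> \<psi>]) (auto simp: supp)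
        then show False using \<open>\<phi> x \<noteq> 0\<close> by simp
      qed
      then obtain z where "norm z < \<delta>" "x - z \<in> K" by blast
      then show "\<exists>k\<in>K. \<exists>y\<in>cball 0 \<delta>. x = k + y"
        by (intro bexI[of _ "x - z"] bexI[of _ z]) auto
    qed
    then have "closure {x. \<phi> x \<noteq> 0} \<subseteq> ?S"
      using S by (intro closure_minimal compact_imp_closed)
    moreover from this have "compact (closure {x. \<phi> x \<noteq> 0})"
      using S by (metis bounded_closure compact_imp_bounded bounded_subset closed_closure compact_eq_bounded_closed)
    ultimately show ?thesis
      using sm by (auto simp: test_functions_def)
  qed
  ultimately show ?thesis using that by blast
qed

section \<open>The fundamental lemma of the calculus of variations\<close>

lemma test_functions_mono: "U \<subseteq> V \<Longrightarrow> test_functions U \<subseteq> test_functions V"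
  by (auto simp: test_functions_def)

lemma test_function_zero: "\<phi> \<in> test_functions \<Omega> \<Longrightarrow> x \<notin> \<Omega> \<Longrightarrow> \<phi> x = 0"
  unfolding test_functions_def using closure_subset[of "{x. \<phi> x \<noteq> 0}"] by blast

lemma continuous_borel_measurable_lebesgue_on:
  fixes f :: "real ^ 'd \<Rightarrow> 'b::euclidean_space"
  assumes "continuous_on UNIV f"
  shows "f \<in> borel_measurable (lebesgue_on S)"
proof -
  have "f \<in> borel_measurable borel" using assms by (rule borel_measurable_continuous_onI)
  then have "f \<in> borel_measurable lborel" by simp
  then show ?thesis by (intro measurable_restrict_space1 measurable_completion)
qed

text \<open>Mollify the cut-offs \<open>min 1 (max 0 (n * dist (x, - V) - 1))\<close>. They vanish within distance \<open>1 / n\<close> of the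
  complement of \<open>V\<close> and increase to the indicator.\<close>

lemma open_indicator_limit_of_test_functions:
  fixes V :: "(real ^ 'd) set"
  assumes "open V" "bounded V"
  obtains \<phi> where "\<And>n. \<phi> n \<in> test_functions V" "\<And>n x. \<bar>\<phi> n x\<bar> \<le> 2"
    "\<And>x. (\<lambda>n. \<phi> n x) \<longlonglongrightarrow> indicator V x"
proof -
  have nonempty: "- V \<noteq> {}"
    using \<open>bounded V\<close> not_bounded_UNIV[where 'a="real^'d"] by (metis Compl_empty_eq double_compl)
  have closed: "closed (- V)" using \<open>open V\<close> by (simp add: closed_def)
  define \<psi> where "\<psi> = (\<lambda>n x. min 1 (max 0 (real n * infdist x (- V) - 1)))"
  define K where "K = (\<lambda>n. {x. real n * infdist x (- V) \<ge> 1})"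
  have K: "K n \<subseteq> V" for n
  proof
    fix x assume "x \<in> K n"
    then have "infdist x (- V) \<noteq> 0" by (auto simp: K_def)
    then show "x \<in> V" using infdist_zero[of x "- V"] by blast
  qed
  have "\<exists>\<phi>\<in>test_functions V. \<forall>x. \<bar>\<phi> x - \<psi> n x\<bar> \<le> 1 / real (Suc n)" for n
  proof -
    have "closed (K n)" unfolding K_def by (intro closed_Collect_le continuous_intros)
    then have cK: "compact (K n)"
      using bounded_subset[OF \<open>bounded V\<close> K] by (simp add: compact_eq_bounded_closed)
    have lip: "(real n)-lipschitz_on UNIV (\<psi> n)"
    proof (rule lipschitz_onI)
      fix x y
      have "dist (\<psi> n x) (\<psi> n y) \<le> \<bar>real n * infdist x (- V) - real n * infdist y (- V)\<bar>"
        by (auto simp: \<psi>_def dist_real_def)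
      also have "\<dots> = real n * \<bar>infdist x (- V) - infdist y (- V)\<bar>"
        by (simp add: right_diff_distrib[symmetric] abs_mult)
      also have "\<dots> \<le> real n * dist x y" by (intro mult_left_mono infdist_triangle_abs) auto
      finally show "dist (\<psi> n x) (\<psi> n y) \<le> real n * dist x y" .
    qed simp
    have supp: "\<psi> n x = 0" if "x \<notin> K n" for x using that by (simp add: \<psi>_def K_def)
    show ?thesis
      by (rule test_function_approx[OF \<open>open V\<close> lip cK K supp, of "1 / real (Suc n)"]) auto
  qed
  then obtain \<phi> where \<phi>: "\<And>n. \<phi> n \<in> test_functions V" "\<And>n x. \<bar>\<phi> n x - \<psi> n x\<bar> \<le> 1 / real (Suc n)"
    by metis
  show ?thesis
  proof (rule that[OF \<phi>(1)])
    fix n x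
    have "1 / real (Suc n) \<le> 1" "0 \<le> \<psi> n x" "\<psi> n x \<le> 1" by (auto simp: \<psi>_def)
    then show "\<bar>\<phi> n x\<bar> \<le> 2" using \<phi>(2)[of n x] by linarith
  next
    fix x
    have "(\<lambda>n. \<phi> n x - \<psi> n x) \<longlonglongrightarrow> 0"
      by (rule Lim_null_comparison[OF _ LIMSEQ_Suc[OF lim_1_over_n]]) (use \<phi>(2) in simp)
    moreover have "(\<lambda>n. \<psi> n x) \<longlonglongrightarrow> indicator V x"
    proof (cases "x \<in> V")
      case True
      then have pos: "infdist x (- V) > 0" using infdist_pos_not_in_closed[OF closed nonempty] by simp
      have "\<forall>\<^sub>F n in sequentially. indicator V x = \<psi> n x"
      proof -
        obtain N where N: "real N > 2 / infdist x (- V)" using reals_Archimedean2 by blast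
        have "indicator V x = \<psi> n x" if "n \<ge> N" for n
        proof -
          have "real n > 2 / infdist x (- V)" using N that by linarith
          then have "real n * infdist x (- V) > 2" using pos by (simp add: field_simps)
          then show ?thesis using True by (simp add: \<psi>_def)
        qed
        then show ?thesis unfolding eventually_sequentially by blast
      qed
      then show ?thesis by (rule Lim_transform_eventually[OF tendsto_const])
    next
      case False
      then show ?thesis by (simp add: \<psi>_def)
    qed
    ultimately have "(\<lambda>n. (\<phi> n x - \<psi> n x) + \<psi> n x) \<longlonglongrightarrow> 0 + indicator V x" by (rule tendsto_add)
    then show "(\<lambda>n. \<phi> n x) \<longlonglongrightarrow> indicator V x" by simp
  qed
qed

lemma test_function_smooth: "\<phi> \<in> test_functions \<Omega> \<Longrightarrow> smooth \<phi>"
  by (simp add: test_functions_def)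

lemma smooth_measurable: "smooth \<phi> \<Longrightarrow> \<phi> \<in> borel_measurable (lebesgue_on S)"
  by (intro continuous_borel_measurable_lebesgue_on smooth_continuous_on)

lemma integral_open_eq_0:
  fixes w :: "real ^ 'd \<Rightarrow> real"
  assumes V: "open V" "bounded V" "V \<subseteq> U" and w: "integrable (lebesgue_on U) w"
    and orth: "\<And>\<phi>. \<phi> \<in> test_functions U \<Longrightarrow> L2_inner U w \<phi> = 0"
  shows "(LINT x|lebesgue_on U. w x * indicator V x) = 0"
proof -
  obtain \<phi> where \<phi>: "\<And>n. \<phi> n \<in> test_functions V" "\<And>n x. \<bar>\<phi> n x\<bar> \<le> 2"
    "\<And>x. (\<lambda>n. \<phi> n x) \<longlonglongrightarrow> indicator V x"
    using open_indicator_limit_of_test_functions[OF V(1,2)] by metis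
  have "(\<lambda>n. LINT x|lebesgue_on U. w x * \<phi> n x) \<longlonglongrightarrow> (LINT x|lebesgue_on U. w x * indicator V x)"
  proof (rule integral_dominated_convergence[where w="\<lambda>x. 2 * norm (w x)"])
    have wm: "w \<in> borel_measurable (lebesgue_on U)" using w by simp
    have "indicator V \<in> borel_measurable (lebesgue_on U)"
      using V by (intro measurable_restrict_space1 borel_measurable_indicator) auto
    then show "(\<lambda>x. w x * indicator V x) \<in> borel_measurable (lebesgue_on U)"
      using wm by (intro borel_measurable_times)
    show "(\<lambda>x. w x * \<phi> n x) \<in> borel_measurable (lebesgue_on U)" for n
      by (rule borel_measurable_times[OF wm smooth_measurable[OF test_function_smooth[OF \<phi>(1)]]])
    show "integrable (lebesgue_on U) (\<lambda>x. 2 * norm (w x))" using w by simp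
    show "AE x in lebesgue_on U. (\<lambda>n. w x * \<phi> n x) \<longlonglongrightarrow> w x * indicator V x"
      by (intro AE_I2 tendsto_mult \<phi> tendsto_const)
    show "AE x in lebesgue_on U. norm (w x * \<phi> n x) \<le> 2 * norm (w x)" for n
    proof (rule AE_I2)
      fix x
      have "\<bar>w x\<bar> * \<bar>\<phi> n x\<bar> \<le> \<bar>w x\<bar> * 2" by (rule mult_left_mono) (use \<phi>(2) in auto)
      then show "norm (w x * \<phi> n x) \<le> 2 * norm (w x)" by (simp add: abs_mult)
    qed
  qed
  moreover have "(LINT x|lebesgue_on U. w x * \<phi> n x) = 0" for n
    using orth[of "\<phi> n"] \<phi>(1) test_functions_mono[OF V(3)] by (auto simp: L2_inner_def)
  ultimately have "(\<lambda>n::nat. 0) \<longlonglongrightarrow> (LINT x|lebesgue_on U. w x * indicator V x)" by simp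
  then show ?thesis using LIMSEQ_unique[OF _ tendsto_const] by metis
qed

text \<open>By \<open>integral_open_eq_0\<close> the integral of \<open>w\<close> over every open set vanishes. The open sets are closed under
  intersection and generate the Borel sets, so Dynkin's argument gives the same for all Borel sets,
  and a density is determined by its integrals.\<close>

lemma fundamental_lemma:
  fixes w :: "real ^ 'd \<Rightarrow> real"
  assumes U: "open U" "bounded U" and w: "integrable (lebesgue_on U) w"
    and orth: "\<And>\<phi>. \<phi> \<in> test_functions U \<Longrightarrow> L2_inner U w \<phi> = 0"
  shows "AE x in lebesgue_on U. w x = 0"
proof -
  have Ul: "U \<inter> space lebesgue \<in> sets lebesgue" using U by simp
  have wl: "integrable lebesgue (\<lambda>x. indicator U x *\<^sub>R w x)"
    using w Ul by (simp add: integrable_restrict_space)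
  \<comment> \<open>Dynkin's argument reaches the Borel sets only, hence the passage to a Borel representative.\<close>
  then obtain f where f[measurable]: "f \<in> borel_measurable lborel" 
    and ae: "AE x in lborel. indicator U x *\<^sub>R w x = f x"
    using completion_ex_borel_measurable_real[OF borel_measurable_integrable[OF wl]] by blast
  have ael: "AE x in lebesgue. indicator U x *\<^sub>R w x = f x" using ae by (rule AE_completion)
  have fl: "f \<in> borel_measurable lebesgue" using f by (rule measurable_completion)
  have "integrable lebesgue f"
    using integrable_cong_AE_imp[OF wl fl] ael by (auto simp: eq_commute)
  then have intf: "integrable lborel f" using f by (simp add: integrable_completion)
  have open_0: "(LINT x:V|lborel. f x) = 0" if "open V" for V
  proof -
    have [measurable]: "V \<in> sets borel" using that by simp
    have "(LINT x:V|lborel. f x) = (LINT x|lebesgue. indicator V x *\<^sub>R f x)"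
      unfolding set_lebesgue_integral_def by (rule integral_completion[symmetric]) measurable
    also have "\<dots> = (LINT x|lebesgue. indicator U x *\<^sub>R (w x * indicator (V \<inter> U) x))"
    proof (rule integral_cong_AE)
      have Vl: "indicator V \<in> borel_measurable lebesgue" "indicator (V \<inter> U) \<in> borel_measurable lebesgue"
        using that U by (auto intro!: borel_measurable_indicator)
      then show "(\<lambda>x. indicator V x *\<^sub>R f x) \<in> borel_measurable lebesgue"
        using fl by (intro borel_measurable_scaleR)
      have "(\<lambda>x. (indicator U x *\<^sub>R w x) * indicator (V \<inter> U) x) \<in> borel_measurable lebesgue"
        using wl Vl(2) by (intro borel_measurable_times) auto
      then show "(\<lambda>x. indicator U x *\<^sub>R (w x * indicator (V \<inter> U) x)) \<in> borel_measurable lebesgue"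
        by (simp add: mult.assoc)
      show "AE x in lebesgue. indicator V x *\<^sub>R f x = indicator U x *\<^sub>R (w x * indicator (V \<inter> U) x)"
        using ael by eventually_elim (auto simp: indicator_def split: if_splits)
    qed
    also have "\<dots> = (LINT x|lebesgue_on U. w x * indicator (V \<inter> U) x)"
      using Ul by (simp add: integral_restrict_space)
    also have "\<dots> = 0"
      using integral_open_eq_0[OF _ _ _ w orth, of "V \<inter> U"] that U by (auto intro: bounded_subset)
    finally show ?thesis .
  qed
  have set_int: "set_integrable lborel A f" if "A \<in> sets borel" for A
    unfolding set_integrable_def using intf that by (intro integrable_mult_indicator) auto
  have borel_0: "(LINT x:A|lborel. f x) = 0" if "A \<in> sets borel" for A
  proof -
    have "Int_stable {S :: (real^'d) set. open S}" by (auto simp: Int_stable_def)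
    moreover have "{S :: (real^'d) set. open S} \<subseteq> Pow UNIV" by simp
    moreover have "A \<in> sigma_sets UNIV {S. open S}" using that by (simp add: sets_borel)
    ultimately show ?thesis
    proof (induction rule: sigma_sets_induct_disjoint)
      case (basic A) then show ?case using open_0 by simp
    next
      case empty show ?case by (simp add: set_lebesgue_integral_def)
    next
      case (compl A)
      then have "A \<in> sets borel" by (simp add: sets_borel)
      then have "(LINT x:(A \<union> (UNIV - A))|lborel. f x) = (LINT x:A|lborel. f x) + (LINT x:(UNIV - A)|lborel. f x)"
        by (intro set_integral_Un set_int) auto
      moreover have "A \<union> (UNIV - A) = UNIV" by auto
      ultimately show ?case using open_0[of UNIV] compl by simp
    next
      case (union A)
      then have m: "A i \<in> sets borel" for i by (auto simp: sets_borel)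
      then have "(\<Union>i. A i) \<in> sets borel" by auto
      then have "(LINT x:(\<Union>i. A i)|lborel. f x) = (\<Sum>i. LINT x:A i|lborel. f x)"
        using m union(1) by (intro lebesgue_integral_countable_add set_int) (auto simp: disjoint_family_on_def)
      then show ?case using union by simp
    qed
  qed
  have "AE x in lborel. f x = 0"
    by (rule density_unique_real[OF intf]) (use borel_0 in \<open>auto simp: set_lebesgue_integral_def\<close>)
  then have "AE x in lebesgue. f x = 0" by (rule AE_completion)
  with ael have "AE x in lebesgue. x \<in> U \<longrightarrow> w x = 0"
    by eventually_elim (auto simp: indicator_def)
  then show ?thesis using Ul by (simp add: AE_restrict_space_iff)
qed

section \<open>The Hilbert space structure of square integrable functions\<close>

lemma integrable_L2_inner:
  fixes u v :: "real ^ 'd \<Rightarrow> 'b::euclidean_space"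
  assumes "u \<in> L2 \<Omega>" "v \<in> L2 \<Omega>"
  shows "integrable (lebesgue_on \<Omega>) (\<lambda>x. u x \<bullet> v x)"
proof (rule Bochner_Integration.integrable_bound)
  show "integrable (lebesgue_on \<Omega>) (\<lambda>x. (norm (u x))\<^sup>2 + (norm (v x))\<^sup>2)"
    using assms by (simp add: L2_def)
  show "(\<lambda>x. u x \<bullet> v x) \<in> borel_measurable (lebesgue_on \<Omega>)"
    using assms by (auto simp: L2_def intro: borel_measurable_inner)
  show "AE x in lebesgue_on \<Omega>. norm (u x \<bullet> v x) \<le> norm ((norm (u x))\<^sup>2 + (norm (v x))\<^sup>2)"
  proof (rule AE_I2)
    fix x
    have "\<bar>u x \<bullet> v x\<bar> \<le> norm (u x) * norm (v x)" by (rule Cauchy_Schwarz_ineq2)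
    also have "\<dots> \<le> (norm (u x))\<^sup>2 + (norm (v x))\<^sup>2"
    proof -
      have "0 \<le> norm (u x) * norm (v x)" by simp
      then show ?thesis using sum_squares_bound[of "norm (u x)" "norm (v x)"] by linarith
    qed
    finally show "norm (u x \<bullet> v x) \<le> norm ((norm (u x))\<^sup>2 + (norm (v x))\<^sup>2)" by simp
  qed
qed

lemma L2_add:
  fixes u v :: "real ^ 'd \<Rightarrow> 'b::euclidean_space"
  assumes "u \<in> L2 \<Omega>" "v \<in> L2 \<Omega>" shows "(\<lambda>x. u x + v x) \<in> L2 \<Omega>"
proof -
  have "integrable (lebesgue_on \<Omega>) (\<lambda>x. (norm (u x))\<^sup>2 + 2 * (u x \<bullet> v x) + (norm (v x))\<^sup>2)"
    using assms integrable_L2_inner[OF assms] by (simp add: L2_def)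
  moreover have "(norm (a + b))\<^sup>2 = (norm a)\<^sup>2 + 2 * (a \<bullet> b) + (norm b)\<^sup>2" for a b :: 'b
    by (simp add: dot_norm field_simps)
  moreover have "(\<lambda>x. u x + v x) \<in> borel_measurable (lebesgue_on \<Omega>)"
    using assms by (intro borel_measurable_add) (auto simp: L2_def)
  ultimately show ?thesis by (simp add: L2_def)
qed

lemma L2_scaleR:
  fixes u :: "real ^ 'd \<Rightarrow> 'b::euclidean_space"
  shows "u \<in> L2 \<Omega> \<Longrightarrow> (\<lambda>x. c *\<^sub>R u x) \<in> L2 \<Omega>"
  using borel_measurable_scaleR[OF borel_measurable_const, of u "lebesgue_on \<Omega>" c]
  by (simp add: L2_def power_mult_distrib)

lemma L2_diff:
  fixes u v :: "real ^ 'd \<Rightarrow> 'b::euclidean_space"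
  shows "u \<in> L2 \<Omega> \<Longrightarrow> v \<in> L2 \<Omega> \<Longrightarrow> (\<lambda>x. u x - v x) \<in> L2 \<Omega>"
  using L2_add[of u \<Omega> "\<lambda>x. (-1) *\<^sub>R v x"] L2_scaleR[of v \<Omega> "-1"] by simp

lemma L2_sum:
  fixes u :: "'i \<Rightarrow> real ^ 'd \<Rightarrow> 'b::euclidean_space"
  assumes "\<And>i. i \<in> I \<Longrightarrow> u i \<in> L2 \<Omega>" shows "(\<lambda>x. \<Sum>i\<in>I. u i x) \<in> L2 \<Omega>"
  using assms
proof (induction I rule: infinite_finite_induct)
  case (insert i I)
  then show ?case using L2_add[of "u i" \<Omega> "\<lambda>x. \<Sum>i\<in>I. u i x"] by simp
qed (auto simp: L2_def)

lemma L2_inner_commute: "L2_inner \<Omega> u v = L2_inner \<Omega> v u"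
  by (simp add: L2_inner_def inner_commute)

lemma L2_inner_diff_left:
  fixes u v w :: "real ^ 'd \<Rightarrow> 'b::euclidean_space"
  shows "u \<in> L2 \<Omega> \<Longrightarrow> v \<in> L2 \<Omega> \<Longrightarrow> w \<in> L2 \<Omega> \<Longrightarrow>
    L2_inner \<Omega> (\<lambda>x. u x - v x) w = L2_inner \<Omega> u w - L2_inner \<Omega> v w"
  by (simp add: L2_inner_def inner_diff_left integrable_L2_inner)

lemma L2_inner_diff_right:
  fixes u v w :: "real ^ 'd \<Rightarrow> 'b::euclidean_space"
  shows "u \<in> L2 \<Omega> \<Longrightarrow> v \<in> L2 \<Omega> \<Longrightarrow> w \<in> L2 \<Omega> \<Longrightarrow>
    L2_inner \<Omega> w (\<lambda>x. u x - v x) = L2_inner \<Omega> w u - L2_inner \<Omega> w v"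
  by (simp add: L2_inner_def inner_diff_right integrable_L2_inner)

lemma L2_inner_self_nonneg: "L2_inner \<Omega> u u \<ge> 0"
  by (simp add: L2_inner_def)

lemma L2_norm_nonneg: "L2_norm \<Omega> u \<ge> 0"
  by (simp add: L2_norm_def L2_inner_self_nonneg)

lemma L2_norm_square: "(L2_norm \<Omega> u)\<^sup>2 = L2_inner \<Omega> u u"
  by (simp add: L2_norm_def L2_inner_self_nonneg)

text \<open>\<open>L2_inner\<close> is only semidefinite, so the case of \<open>v\<close> with norm zero is separate.\<close>

lemma L2_Cauchy_Schwarz:
  fixes u v :: "real ^ 'd \<Rightarrow> 'b::euclidean_space"
  assumes u: "u \<in> L2 \<Omega>" and v: "v \<in> L2 \<Omega>"
  shows "\<bar>L2_inner \<Omega> u v\<bar> \<le> L2_norm \<Omega> u * L2_norm \<Omega> v"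
proof -
  let ?A = "L2_inner \<Omega> u u" and ?B = "L2_inner \<Omega> u v" and ?C = "L2_inner \<Omega> v v"
  have quad: "0 \<le> ?A + 2 * t * ?B + t\<^sup>2 * ?C" for t
  proof -
    have "0 \<le> L2_inner \<Omega> (\<lambda>x. u x + t *\<^sub>R v x) (\<lambda>x. u x + t *\<^sub>R v x)" by (rule L2_inner_self_nonneg)
    also have "\<dots> = (LINT x|lebesgue_on \<Omega>. u x \<bullet> u x + 2 * t * (u x \<bullet> v x) + t\<^sup>2 * (v x \<bullet> v x))"
      unfolding L2_inner_def by (simp add: inner_add inner_commute power2_eq_square algebra_simps)
    also have "\<dots> = ?A + 2 * t * ?B + t\<^sup>2 * ?C"
      using integrable_L2_inner[OF u u] integrable_L2_inner[OF u v] integrable_L2_inner[OF v v]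
      by (simp add: L2_inner_def)
    finally show ?thesis .
  qed
  have "?B\<^sup>2 \<le> ?A * ?C"
  proof (cases "?C = 0")
    case True
    have "?B = 0"
    proof (rule ccontr)
      assume "?B \<noteq> 0"
      then have "2 * (- (?A + 1) / (2 * ?B)) * ?B = - (?A + 1)" by simp
      then show False using quad[of "- (?A + 1) / (2 * ?B)"] True by simp
    qed
    then show ?thesis using True by simp
  next
    case False
    then have C: "?C > 0" using L2_inner_self_nonneg[of \<Omega> v] by simp
    have "0 \<le> (?A + 2 * (- ?B / ?C) * ?B + (- ?B / ?C)\<^sup>2 * ?C) * ?C"
      by (rule mult_nonneg_nonneg[OF quad]) (use C in simp)
    also have "\<dots> = ?A * ?C - ?B\<^sup>2" using C by (simp add: field_simps power2_eq_square)
    finally show ?thesis by simp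
  qed
  then have "sqrt (?B\<^sup>2) \<le> sqrt (?A * ?C)" by (rule real_sqrt_le_mono)
  then show ?thesis by (simp add: L2_norm_def real_sqrt_mult)
qed

lemma L2_norm_add:
  fixes u v :: "real ^ 'd \<Rightarrow> 'b::euclidean_space"
  assumes u: "u \<in> L2 \<Omega>" and v: "v \<in> L2 \<Omega>"
  shows "L2_norm \<Omega> (\<lambda>x. u x + v x) \<le> L2_norm \<Omega> u + L2_norm \<Omega> v"
proof (rule power2_le_imp_le)
  have "(L2_norm \<Omega> (\<lambda>x. u x + v x))\<^sup>2 = (LINT x|lebesgue_on \<Omega>. u x \<bullet> u x + 2 * (u x \<bullet> v x) + v x \<bullet> v x)"
    unfolding L2_norm_square L2_inner_def by (simp add: inner_add inner_commute algebra_simps)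
  also have "\<dots> = (L2_norm \<Omega> u)\<^sup>2 + 2 * L2_inner \<Omega> u v + (L2_norm \<Omega> v)\<^sup>2"
    using integrable_L2_inner[OF u u] integrable_L2_inner[OF u v] integrable_L2_inner[OF v v]
    unfolding L2_norm_square by (simp add: L2_inner_def)
  also have "\<dots> \<le> (L2_norm \<Omega> u + L2_norm \<Omega> v)\<^sup>2"
    using L2_Cauchy_Schwarz[OF u v] by (simp add: power2_sum)
  finally show "(L2_norm \<Omega> (\<lambda>x. u x + v x))\<^sup>2 \<le> (L2_norm \<Omega> u + L2_norm \<Omega> v)\<^sup>2" .
qed (simp add: L2_norm_nonneg)

lemma L2_norm_minus: "L2_norm \<Omega> (\<lambda>x. - u x) = L2_norm \<Omega> u"
  by (simp add: L2_norm_def L2_inner_def)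

lemma L2_inner_cong_AE:
  fixes u v u' v' :: "real ^ 'd \<Rightarrow> 'b::euclidean_space"
  assumes "u \<in> borel_measurable (lebesgue_on \<Omega>)" "v \<in> borel_measurable (lebesgue_on \<Omega>)"
    "u' \<in> borel_measurable (lebesgue_on \<Omega>)" "v' \<in> borel_measurable (lebesgue_on \<Omega>)"
    "AE x in lebesgue_on \<Omega>. u x \<bullet> v x = u' x \<bullet> v' x"
  shows "L2_inner \<Omega> u v = L2_inner \<Omega> u' v'"
  unfolding L2_inner_def
  by (rule integral_cong_AE) (use assms in \<open>auto intro: borel_measurable_inner\<close>)

lemma L2_measurable: "u \<in> L2 \<Omega> \<Longrightarrow> u \<in> borel_measurable (lebesgue_on \<Omega>)"
  by (simp add: L2_def)

lemma L2_norm_cong_AE: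
  fixes u v :: "real ^ 'd \<Rightarrow> 'b::euclidean_space"
  assumes "u \<in> L2 \<Omega>" "v \<in> L2 \<Omega>" "AE x in lebesgue_on \<Omega>. u x = v x"
  shows "L2_norm \<Omega> u = L2_norm \<Omega> v"
  unfolding L2_norm_def
  using assms by (auto intro!: arg_cong[where f=sqrt] L2_inner_cong_AE simp: L2_measurable elim!: AE_mp)

lemma finite_measure_lebesgue_on_bounded_open:
  fixes \<Omega> :: "(real ^ 'd) set"
  shows "open \<Omega> \<Longrightarrow> bounded \<Omega> \<Longrightarrow> finite_measure (lebesgue_on \<Omega>)"
  by (intro finite_measure_lebesgue_on) (simp add: bounded_set_imp_lmeasurable)

lemma L2_bounded:
  fixes u :: "real ^ 'd \<Rightarrow> 'b::euclidean_space"
  assumes "open \<Omega>" "bounded \<Omega>" and u: "u \<in> borel_measurable (lebesgue_on \<Omega>)"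
    and B: "AE x in lebesgue_on \<Omega>. norm (u x) \<le> B"
  shows "u \<in> L2 \<Omega>"
proof -
  interpret finite_measure "lebesgue_on \<Omega>"
    using assms by (intro finite_measure_lebesgue_on_bounded_open)
  have "integrable (lebesgue_on \<Omega>) (\<lambda>x. (norm (u x))\<^sup>2)"
  proof (rule integrable_const_bound)
    show "AE x in lebesgue_on \<Omega>. norm ((norm (u x))\<^sup>2) \<le> B\<^sup>2"
      using B by eventually_elim (auto intro!: power_mono)
  qed (use u in simp)
  then show ?thesis using u by (simp add: L2_def)
qed

lemma L2_continuous:
  fixes u :: "real ^ 'd \<Rightarrow> 'b::euclidean_space"
  assumes "open \<Omega>" "bounded \<Omega>" and u: "continuous_on UNIV u"
  shows "u \<in> L2 \<Omega>"
proof -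
  have "compact (u ` closure \<Omega>)"
    using assms by (intro compact_continuous_image) (auto intro: continuous_on_subset)
  then obtain B where B: "\<And>y. y \<in> u ` closure \<Omega> \<Longrightarrow> norm y \<le> B"
    using compact_imp_bounded bounded_iff by metis
  show ?thesis
  proof (rule L2_bounded[OF assms(1,2)])
    show "u \<in> borel_measurable (lebesgue_on \<Omega>)" using u by (rule continuous_borel_measurable_lebesgue_on)
    have "norm (u x) \<le> B" if "x \<in> \<Omega>" for x using B closure_subset that by blast
    then show "AE x in lebesgue_on \<Omega>. norm (u x) \<le> B" by (intro AE_I2) simp
  qed
qed

lemma L2_component:
  fixes v :: "real ^ 'd \<Rightarrow> real ^ 'd"
  assumes "v \<in> L2 \<Omega>" shows "(\<lambda>x. v x $ i) \<in> L2 \<Omega>"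
proof -
  have m: "(\<lambda>x. v x $ i) \<in> borel_measurable (lebesgue_on \<Omega>)"
    using borel_measurable_inner[OF L2_measurable[OF assms] borel_measurable_const[of "axis i 1"]]
    by (simp add: inner_axis)
  have "integrable (lebesgue_on \<Omega>) (\<lambda>x. (norm (v x $ i))\<^sup>2)"
  proof (rule Bochner_Integration.integrable_bound)
    show "integrable (lebesgue_on \<Omega>) (\<lambda>x. (norm (v x))\<^sup>2)" using assms by (simp add: L2_def)
    show "AE x in lebesgue_on \<Omega>. norm ((norm (v x $ i))\<^sup>2) \<le> norm ((norm (v x))\<^sup>2)"
    proof (rule AE_I2)
      fix x
      have "\<bar>v x $ i\<bar>\<^sup>2 \<le> (norm (v x))\<^sup>2" by (rule power_mono[OF component_le_norm_cart]) simp
      then show "norm ((norm (v x $ i))\<^sup>2) \<le> norm ((norm (v x))\<^sup>2)" by simp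
    qed
    show "(\<lambda>x. (norm (v x $ i))\<^sup>2) \<in> borel_measurable (lebesgue_on \<Omega>)" using m by simp
  qed
  then show ?thesis using m by (simp add: L2_def)
qed

lemma borel_measurable_vec:
  fixes v :: "'a \<Rightarrow> real ^ 'd"
  assumes "\<And>i. (\<lambda>x. v x $ i) \<in> borel_measurable M" shows "v \<in> borel_measurable M"
proof -
  have "(\<lambda>x. v x \<bullet> b) \<in> borel_measurable M" if b: "b \<in> Basis" for b
  proof -
    obtain i where "b = axis i 1" using b unfolding Basis_vec_def by auto
    then show ?thesis using assms[of i] by (simp add: inner_axis)
  qed
  then show ?thesis by (subst borel_measurable_euclidean_space) auto
qed

lemma L2_vec:
  fixes v :: "real ^ 'd \<Rightarrow> real ^ 'd"
  assumes "\<And>i. (\<lambda>x. v x $ i) \<in> L2 \<Omega>" shows "v \<in> L2 \<Omega>"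
proof -
  have "integrable (lebesgue_on \<Omega>) (\<lambda>x. \<Sum>i\<in>UNIV. (norm (v x $ i))\<^sup>2)"
    using assms by (auto simp: L2_def)
  moreover have "(\<lambda>x. \<Sum>i\<in>UNIV. (norm (v x $ i))\<^sup>2) = (\<lambda>x. (norm (v x))\<^sup>2)"
    unfolding power2_norm_eq_inner inner_vec_def by simp
  ultimately show ?thesis
    using borel_measurable_vec[of v] assms by (simp add: L2_def)
qed

lemma L2_inner_components:
  fixes u v :: "real ^ 'd \<Rightarrow> real ^ 'd"
  assumes "\<And>i. (\<lambda>x. u x $ i) \<in> L2 \<Omega>" "\<And>i. (\<lambda>x. v x $ i) \<in> L2 \<Omega>"
  shows "L2_inner \<Omega> u v = (\<Sum>i\<in>UNIV. L2_inner \<Omega> (\<lambda>x. u x $ i) (\<lambda>x. v x $ i))"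
  unfolding L2_inner_def inner_vec_def
  by (rule Bochner_Integration.integral_sum) (use assms integrable_L2_inner in blast)

lemma L2_inner_sum_left:
  fixes u :: "'i \<Rightarrow> real ^ 'd \<Rightarrow> real"
  assumes "\<And>i. i \<in> I \<Longrightarrow> u i \<in> L2 \<Omega>" "v \<in> L2 \<Omega>"
  shows "L2_inner \<Omega> (\<lambda>x. \<Sum>i\<in>I. u i x) v = (\<Sum>i\<in>I. L2_inner \<Omega> (u i) v)"
  unfolding L2_inner_def inner_sum_left
  by (rule Bochner_Integration.integral_sum) (use assms integrable_L2_inner in blast)

section \<open>Weak derivatives\<close>

lemma partial_deriv_diff:
  assumes "smooth p" "smooth q"
  shows "partial_deriv j (\<lambda>x. p x - q x) x = partial_deriv j p x - partial_deriv j q x"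
proof -
  have "((\<lambda>x. p x - q x) has_derivative (\<lambda>v. grad p x \<bullet> v - grad q x \<bullet> v)) (at x)"
    by (intro has_derivative_diff has_derivative_grad smooth_differentiable assms)
  from partial_deriv_eqI[OF this, of j] show ?thesis by (simp add: grad_def inner_axis)
qed

lemma smooth_diff: "smooth p \<Longrightarrow> smooth q \<Longrightarrow> smooth (\<lambda>x. p x - q x)"
proof (coinduction arbitrary: p q)
  case smooth
  have "partial_deriv j (\<lambda>x. p x - q x) = (\<lambda>x. partial_deriv j p x - partial_deriv j q x)" for j
    by (rule ext) (rule partial_deriv_diff[OF smooth])
  moreover have "(\<lambda>x. p x - q x) differentiable (at x)" for x
    by (intro differentiable_diff smooth_differentiable smooth)
  moreover have "smooth (partial_deriv j p)" "smooth (partial_deriv j q)" for j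
    by (intro smooth_partial_deriv smooth)+
  ultimately show ?case by (intro exI conjI allI disjI1) auto
qed

lemma test_functions_diff:
  assumes "\<phi> \<in> test_functions \<Omega>" "\<psi> \<in> test_functions \<Omega>"
  shows "(\<lambda>x. \<phi> x - \<psi> x) \<in> test_functions \<Omega>"
proof -
  let ?K = "closure {x. \<phi> x \<noteq> 0} \<union> closure {x. \<psi> x \<noteq> 0}"
  have K: "compact ?K" "?K \<subseteq> \<Omega>" using assms by (auto simp: test_functions_def)
  have "{x. \<phi> x - \<psi> x \<noteq> 0} \<subseteq> {x. \<phi> x \<noteq> 0} \<union> {x. \<psi> x \<noteq> 0}" by auto
  then have sub: "closure {x. \<phi> x - \<psi> x \<noteq> 0} \<subseteq> ?K"
    using closure_mono[of "{x. \<phi> x - \<psi> x \<noteq> 0}" "{x. \<phi> x \<noteq> 0} \<union> {x. \<psi> x \<noteq> 0}"]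
    unfolding closure_Un by simp
  then have "closure {x. \<phi> x - \<psi> x \<noteq> 0} = ?K \<inter> closure {x. \<phi> x - \<psi> x \<noteq> 0}" by blast
  then have "compact (closure {x. \<phi> x - \<psi> x \<noteq> 0})"
    using compact_Int_closed[OF K(1) closed_closure[of "{x. \<phi> x - \<psi> x \<noteq> 0}"]] by simp
  moreover have "closure {x. \<phi> x - \<psi> x \<noteq> 0} \<subseteq> \<Omega>" using sub K(2) by (rule order_trans)
  moreover have "smooth (\<lambda>x. \<phi> x - \<psi> x)"
    using assms by (intro smooth_diff test_function_smooth)
  ultimately show ?thesis unfolding test_functions_def by blast
qed

lemma test_function_partial_deriv_zero:
  assumes "\<phi> \<in> test_functions \<Omega>" "x \<notin> \<Omega>"
  shows "partial_deriv j \<phi> x = 0"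
proof -
  let ?S = "- closure {x. \<phi> x \<noteq> 0}"
  have S: "open ?S" "x \<in> ?S" using assms by (auto simp: test_functions_def)
  have "0 = \<phi> y" if "y \<in> ?S" for y
    using that closure_subset[of "{x. \<phi> x \<noteq> 0}"] by auto
  then have "(\<phi> has_derivative (\<lambda>v. 0)) (at x)"
    by (rule has_derivative_transform_within_open[OF has_derivative_const S])
  then show ?thesis by (rule partial_deriv_eqI)
qed

context
  fixes \<Omega> :: "(real ^ 'd) set"
  assumes open_\<Omega>: "open \<Omega>" and bounded_\<Omega>: "bounded \<Omega>"
begin

lemma smooth_L2: "smooth \<phi> \<Longrightarrow> \<phi> \<in> L2 \<Omega>"
  by (rule L2_continuous[OF open_\<Omega> bounded_\<Omega> smooth_continuous_on])

lemma test_function_L2: "\<phi> \<in> test_functions U \<Longrightarrow> \<phi> \<in> L2 \<Omega>"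
  and test_function_partial_L2: "\<phi> \<in> test_functions U \<Longrightarrow> partial_deriv j \<phi> \<in> L2 \<Omega>"
  by (auto intro: smooth_L2 smooth_partial_deriv simp: test_functions_def)

lemma integrable_L2:
  assumes "u \<in> L2 \<Omega>" shows "integrable (lebesgue_on \<Omega>) (u :: _ \<Rightarrow> real)"
  using integrable_L2_inner[OF assms L2_continuous[OF open_\<Omega> bounded_\<Omega> continuous_on_const[of UNIV 1]]]
  by simp

text \<open>With \<open>U = \<Omega>\<close> this is the uniqueness of weak derivatives and weak divergences, with smaller \<open>U\<close> their
  locality.\<close>

lemma weak_eq_imp_AE_eq:
  fixes g h :: "real ^ 'd \<Rightarrow> real"
  assumes U: "open U" "U \<subseteq> \<Omega>" and g: "g \<in> L2 \<Omega>" and h: "h \<in> L2 \<Omega>"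
    and eq: "\<And>\<phi>. \<phi> \<in> test_functions U \<Longrightarrow> L2_inner \<Omega> g \<phi> = L2_inner \<Omega> h \<phi>"
  shows "AE x in lebesgue_on U. g x = h x"
proof -
  have Ul: "U \<inter> space lebesgue \<in> sets lebesgue" "\<Omega> \<inter> space lebesgue \<in> sets lebesgue"
    using U open_\<Omega> by auto
  have int: "integrable (lebesgue_on \<Omega>) (\<lambda>x. g x - h x)"
    using integrable_L2[OF g] integrable_L2[OF h] by simp
  have "AE x in lebesgue_on U. g x - h x = 0"
  proof (rule fundamental_lemma[OF U(1)])
    show "bounded U" using bounded_\<Omega> U(2) bounded_subset by blast
    show "integrable (lebesgue_on U) (\<lambda>x. g x - h x)"
    proof -
      have "integrable lebesgue (\<lambda>x. indicator U x *\<^sub>R (indicator \<Omega> x *\<^sub>R (g x - h x)))"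
        using integrable_mult_indicator[OF _ int[unfolded integrable_restrict_space[OF Ul(2)]], of U] U(1) by simp
      moreover have "(\<lambda>x. indicator U x *\<^sub>R (indicator \<Omega> x *\<^sub>R (g x - h x))) = (\<lambda>x. indicator U x *\<^sub>R (g x - h x))"
        using U(2) by (auto simp: indicator_def fun_eq_iff)
      ultimately show ?thesis using Ul by (simp add: integrable_restrict_space)
    qed
    fix \<phi> assume \<phi>: "\<phi> \<in> test_functions U"
    have "L2_inner U (\<lambda>x. g x - h x) \<phi> = L2_inner \<Omega> (\<lambda>x. g x - h x) \<phi>"
      unfolding L2_inner_def integral_restrict_space[OF Ul(1)] integral_restrict_space[OF Ul(2)]
      using U(2) test_function_zero[OF \<phi>]
      by (intro Bochner_Integration.integral_cong) (auto simp: indicator_def)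
    also have "\<dots> = 0"
      using eq[OF \<phi>] by (simp add: L2_inner_diff_left g h test_function_L2[OF \<phi>])
    finally show "L2_inner U (\<lambda>x. g x - h x) \<phi> = 0" .
  qed
  then show ?thesis by eventually_elim simp
qed

lemma H1_L2: "u \<in> H1 \<Omega> \<Longrightarrow> u \<in> L2 \<Omega>"
  by (simp add: H1_def)

text \<open>The representative picked by the choice operator agrees almost everywhere with any weak derivative that
  has been found by other means.\<close>

lemma weak_partial_spec:
  assumes "g \<in> L2 \<Omega>" "has_weak_partial \<Omega> j u g"
  shows "weak_partial \<Omega> j u \<in> L2 \<Omega>" "has_weak_partial \<Omega> j u (weak_partial \<Omega> j u)"
    "AE x in lebesgue_on \<Omega>. weak_partial \<Omega> j u x = g x"
proof -
  have "weak_partial \<Omega> j u \<in> L2 \<Omega> \<and> has_weak_partial \<Omega> j u (weak_partial \<Omega> j u)"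
    unfolding weak_partial_def by (rule someI[where x=g]) (use assms in simp)
  then show *: "weak_partial \<Omega> j u \<in> L2 \<Omega>" "has_weak_partial \<Omega> j u (weak_partial \<Omega> j u)" by auto
  show "AE x in lebesgue_on \<Omega>. weak_partial \<Omega> j u x = g x"
    by (rule weak_eq_imp_AE_eq[OF open_\<Omega> order_refl *(1) assms(1)])
       (use *(2) assms(2) in \<open>auto simp: has_weak_partial_def\<close>)
qed

lemma H1_weak_partial:
  assumes "u \<in> H1 \<Omega>"
  shows "weak_partial \<Omega> j u \<in> L2 \<Omega>" "has_weak_partial \<Omega> j u (weak_partial \<Omega> j u)"
proof -
  obtain g where "g \<in> L2 \<Omega>" "has_weak_partial \<Omega> j u g" using assms by (auto simp: H1_def)
  then show "weak_partial \<Omega> j u \<in> L2 \<Omega>" "has_weak_partial \<Omega> j u (weak_partial \<Omega> j u)"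
    by (rule weak_partial_spec)+
qed

lemma weak_partial_local_zero:
  assumes u: "u \<in> H1 \<Omega>" and U: "open U" "U \<subseteq> \<Omega>" and zero: "AE x in lebesgue_on U. u x = 0"
  shows "AE x in lebesgue_on U. weak_partial \<Omega> j u x = 0"
proof (rule weak_eq_imp_AE_eq[OF U])
  show "weak_partial \<Omega> j u \<in> L2 \<Omega>" using H1_weak_partial[OF u] by simp
  show "(\<lambda>x. 0) \<in> L2 \<Omega>" by (simp add: L2_def)
  fix \<phi> assume \<phi>: "\<phi> \<in> test_functions U"
  have Ul: "U \<inter> space lebesgue \<in> sets lebesgue" "\<Omega> \<inter> space lebesgue \<in> sets lebesgue"
    using U open_\<Omega> by auto
  have "AE x in lebesgue. x \<in> U \<longrightarrow> u x = 0" using zero Ul by (simp add: AE_restrict_space_iff)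
  then have "AE x in lebesgue_on \<Omega>. u x \<bullet> partial_deriv j \<phi> x = 0"
    unfolding AE_restrict_space_iff[OF Ul(2)]
    by eventually_elim (use test_function_partial_deriv_zero[OF \<phi>] in auto)
  then have "L2_inner \<Omega> u (partial_deriv j \<phi>) = 0"
    unfolding L2_inner_def by (rule integral_eq_zero_AE)
  then show "L2_inner \<Omega> (weak_partial \<Omega> j u) \<phi> = L2_inner \<Omega> (\<lambda>x. 0) \<phi>"
    using H1_weak_partial(2)[OF u, of j] \<phi> test_functions_mono[OF U(2)]
    by (auto simp: has_weak_partial_def L2_inner_def)
qed

lemma H1_diff:
  assumes u: "u \<in> H1 \<Omega>" and v: "v \<in> H1 \<Omega>"
  shows "(\<lambda>x. u x - v x) \<in> H1 \<Omega>"
    and "AE x in lebesgue_on \<Omega>. weak_partial \<Omega> j (\<lambda>x. u x - v x) x = weak_partial \<Omega> j u x - weak_partial \<Omega> j v x"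
proof -
  have L: "(\<lambda>x. weak_partial \<Omega> j u x - weak_partial \<Omega> j v x) \<in> L2 \<Omega>" for j
    using H1_weak_partial u v by (intro L2_diff) auto
  have W: "has_weak_partial \<Omega> j (\<lambda>x. u x - v x) (\<lambda>x. weak_partial \<Omega> j u x - weak_partial \<Omega> j v x)" for j
    unfolding has_weak_partial_def
  proof
    fix \<phi> assume \<phi>: "\<phi> \<in> test_functions \<Omega>"
    then show "L2_inner \<Omega> (\<lambda>x. u x - v x) (partial_deriv j \<phi>) =
        - L2_inner \<Omega> (\<lambda>x. weak_partial \<Omega> j u x - weak_partial \<Omega> j v x) \<phi>"
      using H1_weak_partial[OF u, of j] H1_weak_partial[OF v, of j]
      by (simp add: L2_inner_diff_left H1_L2 u v test_function_L2 test_function_partial_L2 has_weak_partial_def)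
  qed
  show "(\<lambda>x. u x - v x) \<in> H1 \<Omega>"
    using L W L2_diff[OF H1_L2[OF u] H1_L2[OF v]] by (auto simp: H1_def)
  show "AE x in lebesgue_on \<Omega>. weak_partial \<Omega> j (\<lambda>x. u x - v x) x = weak_partial \<Omega> j u x - weak_partial \<Omega> j v x"
    by (rule weak_partial_spec[OF L W])
qed

lemma H1_0_H1: "u \<in> H1_0 \<Omega> \<Longrightarrow> u \<in> H1 \<Omega>"
  by (simp add: H1_0_def)

text \<open>Differences are needed because the pairing \<open>ext_pairing\<close> is well defined only if the difference of two
  admissible extensions is again an element of \<open>X\<close>. The weak derivative of the difference is known up to
  null sets, which the \<open>L\<^sup>2\<close> norm does not see.\<close>

lemma H1_0_diff:
  assumes u: "u \<in> H1_0 \<Omega>" and v: "v \<in> H1_0 \<Omega>"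
  shows "(\<lambda>x. u x - v x) \<in> H1_0 \<Omega>"
proof -
  have u1: "u \<in> H1 \<Omega>" and v1: "v \<in> H1 \<Omega>" using u v by (auto simp: H1_0_def)
  have "\<exists>\<phi>\<in>test_functions \<Omega>. L2_norm \<Omega> (\<lambda>x. (u x - v x) - \<phi> x) < \<epsilon> \<and>
     (\<forall>j. L2_norm \<Omega> (\<lambda>x. weak_partial \<Omega> j (\<lambda>x. u x - v x) x - partial_deriv j \<phi> x) < \<epsilon>)"
    if "\<epsilon> > 0" for \<epsilon>
  proof -
    obtain \<phi> where \<phi>: "\<phi> \<in> test_functions \<Omega>" "L2_norm \<Omega> (\<lambda>x. u x - \<phi> x) < \<epsilon> / 2"
      "\<And>j. L2_norm \<Omega> (\<lambda>x. weak_partial \<Omega> j u x - partial_deriv j \<phi> x) < \<epsilon> / 2"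
      using u \<open>\<epsilon> > 0\<close> unfolding H1_0_def by (fastforce dest: spec[where x="\<epsilon>/2"])
    obtain \<psi> where \<psi>: "\<psi> \<in> test_functions \<Omega>" "L2_norm \<Omega> (\<lambda>x. v x - \<psi> x) < \<epsilon> / 2"
      "\<And>j. L2_norm \<Omega> (\<lambda>x. weak_partial \<Omega> j v x - partial_deriv j \<psi> x) < \<epsilon> / 2"
      using v \<open>\<epsilon> > 0\<close> unfolding H1_0_def by (fastforce dest: spec[where x="\<epsilon>/2"])
    have diff: "L2_norm \<Omega> (\<lambda>x. (a x - b x) - (c x - d x)) < \<epsilon>"
      if "a \<in> L2 \<Omega>" "b \<in> L2 \<Omega>" "c \<in> L2 \<Omega>" "d \<in> L2 \<Omega>"
        "L2_norm \<Omega> (\<lambda>x. a x - c x) < \<epsilon> / 2" "L2_norm \<Omega> (\<lambda>x. b x - d x) < \<epsilon> / 2"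
      for a b c d :: "real ^ 'd \<Rightarrow> real"
    proof -
      have "L2_norm \<Omega> (\<lambda>x. (a x - c x) + - (b x - d x)) \<le> L2_norm \<Omega> (\<lambda>x. a x - c x) + L2_norm \<Omega> (\<lambda>x. - (b x - d x))"
        using L2_scaleR[of "\<lambda>x. b x - d x" \<Omega> "-1"] that by (intro L2_norm_add) (auto intro: L2_diff)
      also have "(\<lambda>x. (a x - c x) + - (b x - d x)) = (\<lambda>x. (a x - b x) - (c x - d x))" by (auto simp: fun_eq_iff)
      finally show ?thesis using that(5,6) unfolding L2_norm_minus by linarith
    qed
    have "L2_norm \<Omega> (\<lambda>x. weak_partial \<Omega> j (\<lambda>x. u x - v x) x - partial_deriv j (\<lambda>x. \<phi> x - \<psi> x) x) < \<epsilon>" for j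
    proof -
      have L: "weak_partial \<Omega> j (\<lambda>x. u x - v x) \<in> L2 \<Omega>" "weak_partial \<Omega> j u \<in> L2 \<Omega>" "weak_partial \<Omega> j v \<in> L2 \<Omega>"
        "partial_deriv j \<phi> \<in> L2 \<Omega>" "partial_deriv j \<psi> \<in> L2 \<Omega>"
        using H1_weak_partial u1 v1 H1_diff test_function_partial_L2 \<phi> \<psi> by auto
      have "L2_norm \<Omega> (\<lambda>x. weak_partial \<Omega> j (\<lambda>x. u x - v x) x - partial_deriv j (\<lambda>x. \<phi> x - \<psi> x) x)
          = L2_norm \<Omega> (\<lambda>x. (weak_partial \<Omega> j u x - weak_partial \<Omega> j v x) - (partial_deriv j \<phi> x - partial_deriv j \<psi> x))"
      proof (rule L2_norm_cong_AE)
        show "AE x in lebesgue_on \<Omega>. weak_partial \<Omega> j (\<lambda>x. u x - v x) x - partial_deriv j (\<lambda>x. \<phi> x - \<psi> x) x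
            = (weak_partial \<Omega> j u x - weak_partial \<Omega> j v x) - (partial_deriv j \<phi> x - partial_deriv j \<psi> x)"
          using H1_diff(2)[OF u1 v1] by eventually_elim (use \<phi>(1) \<psi>(1) in \<open>simp add: partial_deriv_diff test_function_smooth\<close>)
      qed (use L \<phi>(1) \<psi>(1) in \<open>auto intro!: L2_diff simp: partial_deriv_diff test_function_smooth\<close>)
      also have "\<dots> < \<epsilon>" using L \<phi>(3) \<psi>(3) by (intro diff) auto
      finally show ?thesis .
    qed
    moreover have "L2_norm \<Omega> (\<lambda>x. (u x - v x) - (\<phi> x - \<psi> x)) < \<epsilon>"
      using \<phi> \<psi> u1 v1 by (intro diff) (auto intro: H1_L2 test_function_L2)
    ultimately show ?thesis using test_functions_diff[OF \<phi>(1) \<psi>(1)] by (intro bexI[of _ "\<lambda>x. \<phi> x - \<psi> x"]) auto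
  qed
  then show ?thesis using H1_diff(1)[OF u1 v1] by (simp add: H1_0_def)
qed

lemma X_space_diff: "u \<in> X_space \<Omega> \<Longrightarrow> v \<in> X_space \<Omega> \<Longrightarrow> (\<lambda>x. u x - v x) \<in> X_space \<Omega>"
  using H1_0_diff by (simp add: X_space_def)

text \<open>For a test function in place of \<open>v\<close> this is the definition of the weak derivative of \<open>u\<close>. Both sides are
  continuous in the \<open>H\<^sup>1\<close> norm of \<open>v\<close>, in which the test functions are dense in \<open>H1_0\<close>.\<close>

lemma weak_integration_by_parts:
  assumes u: "u \<in> H1 \<Omega>" and v: "v \<in> H1_0 \<Omega>"
  shows "L2_inner \<Omega> u (weak_partial \<Omega> j v) = - L2_inner \<Omega> (weak_partial \<Omega> j u) v"
proof -
  let ?Du = "weak_partial \<Omega> j u" and ?Dv = "weak_partial \<Omega> j v"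
  have v1: "v \<in> H1 \<Omega>" using v by (rule H1_0_H1)
  have L: "u \<in> L2 \<Omega>" "v \<in> L2 \<Omega>" "?Du \<in> L2 \<Omega>" "?Dv \<in> L2 \<Omega>"
    using u v1 H1_weak_partial H1_L2 by auto
  define C where "C = L2_norm \<Omega> u + L2_norm \<Omega> ?Du + 1"
  have C: "C > 0" unfolding C_def using L2_norm_nonneg[of \<Omega> u] L2_norm_nonneg[of \<Omega> ?Du] by simp
  have "\<bar>L2_inner \<Omega> u ?Dv + L2_inner \<Omega> ?Du v\<bar> \<le> 0 + e" if "e > 0" for e
  proof -
    obtain \<phi> where \<phi>: "\<phi> \<in> test_functions \<Omega>" "L2_norm \<Omega> (\<lambda>x. v x - \<phi> x) < e / C"
      "L2_norm \<Omega> (\<lambda>x. ?Dv x - partial_deriv j \<phi> x) < e / C"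
      using v divide_pos_pos[OF \<open>e > 0\<close> C] unfolding H1_0_def by blast
    have P: "\<phi> \<in> L2 \<Omega>" "partial_deriv j \<phi> \<in> L2 \<Omega>"
      using \<phi>(1) test_function_L2 test_function_partial_L2 by auto
    have "L2_inner \<Omega> u (partial_deriv j \<phi>) = - L2_inner \<Omega> ?Du \<phi>"
      using H1_weak_partial(2)[OF u] \<phi>(1) by (auto simp: has_weak_partial_def)
    then have "L2_inner \<Omega> u ?Dv + L2_inner \<Omega> ?Du v
        = L2_inner \<Omega> u (\<lambda>x. ?Dv x - partial_deriv j \<phi> x) + L2_inner \<Omega> ?Du (\<lambda>x. v x - \<phi> x)"
      by (simp add: L2_inner_diff_right L P)
    also have "\<bar>\<dots>\<bar> \<le> L2_norm \<Omega> u * L2_norm \<Omega> (\<lambda>x. ?Dv x - partial_deriv j \<phi> x)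
        + L2_norm \<Omega> ?Du * L2_norm \<Omega> (\<lambda>x. v x - \<phi> x)"
      using L P by (intro order_trans[OF abs_triangle_ineq] add_mono L2_Cauchy_Schwarz L2_diff)
    also have "\<dots> \<le> L2_norm \<Omega> u * (e / C) + L2_norm \<Omega> ?Du * (e / C)"
      using \<phi> by (intro add_mono mult_left_mono) (auto simp: L2_norm_nonneg)
    also have "\<dots> = (C - 1) * (e / C)" by (simp add: C_def algebra_simps add_divide_distrib)
    also have "\<dots> \<le> C * (e / C)" using C \<open>e > 0\<close> by (intro mult_right_mono) auto
    also have "\<dots> = e" using C by simp
    finally show ?thesis by simp
  qed
  then have "\<bar>L2_inner \<Omega> u ?Dv + L2_inner \<Omega> ?Du v\<bar> \<le> 0" by (rule field_le_epsilon)
  then show ?thesis by simp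
qed

lemma X_space_component: "v \<in> X_space \<Omega> \<Longrightarrow> (\<lambda>x. v x $ i) \<in> H1_0 \<Omega>"
  by (simp add: X_space_def)

lemma X_space_facts:
  assumes "v \<in> X_space \<Omega>"
  shows "(\<lambda>x. v x $ i) \<in> H1 \<Omega>" "(\<lambda>x. v x $ i) \<in> L2 \<Omega>" "v \<in> L2 \<Omega>"
    "weak_partial \<Omega> j (\<lambda>x. v x $ i) \<in> L2 \<Omega>"
proof -
  show 1: "(\<lambda>x. v x $ i) \<in> H1 \<Omega>" for i using assms X_space_component H1_0_H1 by blast
  show 2: "(\<lambda>x. v x $ i) \<in> L2 \<Omega>" for i using 1 by (rule H1_L2)
  show "v \<in> L2 \<Omega>" using 2 by (rule L2_vec)
  show "weak_partial \<Omega> j (\<lambda>x. v x $ i) \<in> L2 \<Omega>" using H1_weak_partial[OF 1] by blast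
qed

lemma X_space_weak_div:
  assumes v: "v \<in> X_space \<Omega>"
  shows "weak_div \<Omega> v \<in> L2 \<Omega>" "has_weak_div \<Omega> v (weak_div \<Omega> v)"
    "AE x in lebesgue_on \<Omega>. weak_div \<Omega> v x = (\<Sum>j\<in>UNIV. weak_partial \<Omega> j (\<lambda>y. v y $ j) x)"
proof -
  let ?g = "\<lambda>x. \<Sum>j\<in>UNIV. weak_partial \<Omega> j (\<lambda>y. v y $ j) x"
  note X = X_space_facts[OF v]
  have g: "?g \<in> L2 \<Omega>" using X by (intro L2_sum) auto
  have W: "has_weak_div \<Omega> v ?g"
    unfolding has_weak_div_def
  proof
    fix \<phi> assume \<phi>: "\<phi> \<in> test_functions \<Omega>"
    have "L2_inner \<Omega> v (\<lambda>x. \<chi> j. partial_deriv j \<phi> x)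
        = (\<Sum>j\<in>UNIV. L2_inner \<Omega> (\<lambda>x. v x $ j) (partial_deriv j \<phi>))"
      using X test_function_partial_L2[OF \<phi>] by (subst L2_inner_components) auto
    also have "\<dots> = (\<Sum>j\<in>UNIV. - L2_inner \<Omega> (weak_partial \<Omega> j (\<lambda>x. v x $ j)) \<phi>)"
      using H1_weak_partial(2)[OF X(1)] \<phi> by (intro sum.cong) (auto simp: has_weak_partial_def)
    also have "\<dots> = - L2_inner \<Omega> ?g \<phi>"
      using X test_function_L2[OF \<phi>] by (subst L2_inner_sum_left) (auto simp: sum_negf)
    finally show "L2_inner \<Omega> v (\<lambda>x. \<chi> j. partial_deriv j \<phi> x) = - L2_inner \<Omega> ?g \<phi>" .
  qed
  have "weak_div \<Omega> v \<in> L2 \<Omega> \<and> has_weak_div \<Omega> v (weak_div \<Omega> v)"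
    unfolding weak_div_def by (rule someI[where x="?g"]) (use g W in simp)
  then show *: "weak_div \<Omega> v \<in> L2 \<Omega>" "has_weak_div \<Omega> v (weak_div \<Omega> v)" by auto
  show "AE x in lebesgue_on \<Omega>. weak_div \<Omega> v x = ?g x"
    by (rule weak_eq_imp_AE_eq[OF open_\<Omega> order_refl *(1) g])
       (use *(2) W in \<open>auto simp: has_weak_div_def\<close>)
qed

text \<open>Fields in \<open>X\<close> have zero normal trace by integration by parts. This is why the test field of the first
  step of the scheme may be used in the second step too.\<close>

lemma X_space_subset_Y_space:
  assumes v: "v \<in> X_space \<Omega>" shows "v \<in> Y_space \<Omega>"
proof -
  note X = X_space_facts[OF v]
  have "L2_inner \<Omega> v (weak_grad \<Omega> \<phi>) + L2_inner \<Omega> (weak_div \<Omega> v) \<phi> = 0" if \<phi>: "\<phi> \<in> H1 \<Omega>" for \<phi>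
  proof -
    have "L2_inner \<Omega> v (weak_grad \<Omega> \<phi>) = (\<Sum>j\<in>UNIV. L2_inner \<Omega> (\<lambda>x. v x $ j) (weak_partial \<Omega> j \<phi>))"
      using X H1_weak_partial[OF \<phi>] by (subst L2_inner_components) (auto simp: weak_grad_def)
    also have "\<dots> = (\<Sum>j\<in>UNIV. - L2_inner \<Omega> (weak_partial \<Omega> j (\<lambda>x. v x $ j)) \<phi>)"
      using weak_integration_by_parts[OF \<phi> X_space_component[OF v]]
      by (intro sum.cong) (auto simp: L2_inner_commute)
    also have "\<dots> = - L2_inner \<Omega> (\<lambda>x. \<Sum>j\<in>UNIV. weak_partial \<Omega> j (\<lambda>y. v y $ j) x) \<phi>"
      using X H1_L2[OF \<phi>] by (subst L2_inner_sum_left) (auto simp: sum_negf)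
    also have "L2_inner \<Omega> (\<lambda>x. \<Sum>j\<in>UNIV. weak_partial \<Omega> j (\<lambda>y. v y $ j) x) \<phi> = L2_inner \<Omega> (weak_div \<Omega> v) \<phi>"
    proof (rule L2_inner_cong_AE)
      show "AE x in lebesgue_on \<Omega>. (\<Sum>j\<in>UNIV. weak_partial \<Omega> j (\<lambda>y. v y $ j) x) \<bullet> \<phi> x = weak_div \<Omega> v x \<bullet> \<phi> x"
        using X_space_weak_div(3)[OF v] by eventually_elim simp
    qed (use X X_space_weak_div(1)[OF v] H1_L2[OF \<phi>] in \<open>auto intro!: L2_measurable[OF L2_sum] intro: L2_measurable\<close>)
    finally show ?thesis by simp
  qed
  then show ?thesis using X(3) X_space_weak_div[OF v] by (auto simp: Y_space_def)
qed

end

section \<open>Lipschitz functions with zero boundary values\<close>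

text \<open>A partial derivative that is measurable by construction. Where the quotients have no limit its value is
  arbitrary; below this concerns a null set.\<close>

definition quotient_deriv :: "'d \<Rightarrow> (real ^ 'd \<Rightarrow> real) \<Rightarrow> real ^ 'd \<Rightarrow> real" where
  "quotient_deriv j \<phi> x = lim (\<lambda>n. real (Suc n) * (\<phi> (x + (1 / real (Suc n)) *\<^sub>R axis j 1) - \<phi> x))"

lemma quotient_deriv_measurable:
  fixes \<phi> :: "real ^ 'd \<Rightarrow> real"
  assumes "continuous_on UNIV \<phi>"
  shows "quotient_deriv j \<phi> \<in> borel_measurable (lebesgue_on S)"
proof -
  have "(\<lambda>x. lim (\<lambda>n. real (Suc n) * (\<phi> (x + (1 / real (Suc n)) *\<^sub>R axis j 1) - \<phi> x))) \<in> borel_measurable borel"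
    by (intro borel_measurable_lim_metric borel_measurable_continuous_onI continuous_intros
        continuous_on_compose2[OF assms]) auto
  then have "quotient_deriv j \<phi> \<in> borel_measurable lborel" by (simp add: quotient_deriv_def[abs_def])
  then show ?thesis by (intro measurable_restrict_space1 measurable_completion)
qed

lemma difference_quotient_LIMSEQ:
  fixes \<phi> :: "real ^ 'd \<Rightarrow> real"
  assumes "(\<phi> has_derivative D) (at x)"
  shows "(\<lambda>n. real (Suc n) * (\<phi> (x + (1 / real (Suc n)) *\<^sub>R v) - \<phi> x)) \<longlonglongrightarrow> D v"
proof -
  have "filterlim (\<lambda>n. 1 / real (Suc n)) (at 0) sequentially"
    unfolding filterlim_at using LIMSEQ_Suc[OF lim_1_over_n[where 'a=real]] by auto
  from filterlim_compose[OF difference_quotient_tendsto[OF assms] this]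
  show ?thesis by (simp add: mult.commute)
qed

lemma quotient_deriv_eq:
  fixes \<phi> :: "real ^ 'd \<Rightarrow> real"
  assumes "(\<phi> has_derivative D) (at x)"
  shows "quotient_deriv j \<phi> x = D (axis j 1)"
  unfolding quotient_deriv_def by (rule limI[OF difference_quotient_LIMSEQ[OF assms]])

lemma integrable_continuous_compact_support:
  fixes f :: "real ^ 'd \<Rightarrow> real"
  assumes "continuous_on UNIV f" "compact K" "\<And>x. x \<notin> K \<Longrightarrow> f x = 0"
  shows "integrable lborel f"
proof -
  have "integrable lborel (\<lambda>x. indicator K x *\<^sub>R f x)"
    using assms by (intro borel_integrable_compact) (auto intro: continuous_on_subset)
  moreover have "(\<lambda>x. indicator K x *\<^sub>R f x) = f" using assms(3) by (auto simp: indicator_def fun_eq_iff)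
  ultimately show ?thesis by simp
qed

lemma integral_difference_quotient_LIMSEQ:
  fixes h k :: "real ^ 'd \<Rightarrow> real"
  assumes h: "L-lipschitz_on UNIV h" and k: "continuous_on UNIV k" "compact K" "\<And>x. x \<notin> K \<Longrightarrow> k x = 0"
    and d: "d \<in> borel_measurable lebesgue" and "norm v \<le> 1"
    and lim: "AE x in lebesgue. k x \<noteq> 0 \<longrightarrow> (\<lambda>n. real (Suc n) * (h (x + (1 / real (Suc n)) *\<^sub>R v) - h x)) \<longlonglongrightarrow> d x"
  shows "(\<lambda>n. LINT x|lebesgue. real (Suc n) * (h (x + (1 / real (Suc n)) *\<^sub>R v) - h x) * k x) \<longlonglongrightarrow> (LINT x|lebesgue. d x * k x)"
proof (rule integral_dominated_convergence[where w="\<lambda>x. L * \<bar>k x\<bar>"])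
  have hc: "continuous_on UNIV h" using h by (rule lipschitz_on_continuous_on)
  have L: "L \<ge> 0" using h by (rule lipschitz_on_nonneg)
  have meas: "f \<in> borel_measurable lebesgue" if "continuous_on UNIV f" for f :: "real ^ 'd \<Rightarrow> real"
    using continuous_borel_measurable_lebesgue_on[OF that, of UNIV] by (simp add: lebesgue_on_UNIV_eq)
  show "(\<lambda>x. d x * k x) \<in> borel_measurable lebesgue" using d meas[OF k(1)] by (rule borel_measurable_times)
  show "(\<lambda>x. real (Suc n) * (h (x + (1 / real (Suc n)) *\<^sub>R v) - h x) * k x) \<in> borel_measurable lebesgue" for n
    by (intro meas continuous_intros k continuous_on_compose2[OF hc]) auto
  have "integrable lborel (\<lambda>x. L * \<bar>k x\<bar>)"
    using integrable_continuous_compact_support[OF k] by (intro integrable_mult_right integrable_abs)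
  then show "integrable lebesgue (\<lambda>x. L * \<bar>k x\<bar>)" by (subst integrable_completion) auto
  show "AE x in lebesgue. (\<lambda>n. real (Suc n) * (h (x + (1 / real (Suc n)) *\<^sub>R v) - h x) * k x) \<longlonglongrightarrow> d x * k x"
    using lim
  proof eventually_elim
    case (elim x)
    then show ?case by (cases "k x = 0") (auto intro: tendsto_mult)
  qed
  show "AE x in lebesgue. norm (real (Suc n) * (h (x + (1 / real (Suc n)) *\<^sub>R v) - h x) * k x) \<le> L * \<bar>k x\<bar>" for n
  proof (rule AE_I2)
    fix x
    have "\<bar>h (x + (1 / real (Suc n)) *\<^sub>R v) - h x\<bar> \<le> L * (1 / real (Suc n) * norm v)"
      using lipschitz_onD[OF h, of "x + (1 / real (Suc n)) *\<^sub>R v" x] by (simp add: dist_norm)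
    also have "\<dots> \<le> L * (1 / real (Suc n) * 1)"
      using L \<open>norm v \<le> 1\<close> by (intro mult_left_mono) auto
    finally have "real (Suc n) * \<bar>h (x + (1 / real (Suc n)) *\<^sub>R v) - h x\<bar> \<le> L"
      by (simp add: field_simps)
    from mult_right_mono[OF this, of "\<bar>k x\<bar>"]
    show "norm (real (Suc n) * (h (x + (1 / real (Suc n)) *\<^sub>R v) - h x) * k x) \<le> L * \<bar>k x\<bar>"
      by (simp add: abs_mult)
  qed
qed

lemma test_function_lipschitz:
  fixes \<zeta> :: "real ^ 'd \<Rightarrow> real"
  assumes "\<zeta> \<in> test_functions \<Omega>"
  obtains L where "L-lipschitz_on UNIV \<zeta>"
proof -
  let ?K = "closure {x. \<zeta> x \<noteq> 0}"
  have sm: "smooth \<zeta>" using assms by (rule test_function_smooth)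
  have "compact (grad \<zeta> ` ?K)"
    using assms by (intro compact_continuous_image continuous_on_grad) (auto simp: test_functions_def)
  then obtain B where B: "\<And>y. y \<in> grad \<zeta> ` ?K \<Longrightarrow> norm y \<le> B"
    using compact_imp_bounded bounded_iff by metis
  have "\<zeta> \<in> test_functions ?K" using assms by (simp add: test_functions_def)
  then have zero: "grad \<zeta> x = 0" if "x \<notin> ?K" for x
    using test_function_partial_deriv_zero[OF _ that] by (simp add: grad_def vec_eq_iff)
  have bound: "norm (grad \<zeta> x) \<le> max 0 B" for x
    using B zero by (cases "x \<in> ?K") (auto intro: max.coboundedI2)
  have "(max 0 B)-lipschitz_on UNIV \<zeta>"
  proof (rule bounded_derivative_imp_lipschitz)
    show "(\<zeta> has_derivative (\<lambda>v. grad \<zeta> x \<bullet> v)) (at x within UNIV)" for x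
      by (rule has_derivative_grad[OF smooth_differentiable[OF sm]])
    show "onorm (\<lambda>v. grad \<zeta> x \<bullet> v) \<le> max 0 B" for x
    proof (rule onorm_bound)
      show "norm (grad \<zeta> x \<bullet> v) \<le> max 0 B * norm v" for v
        using Cauchy_Schwarz_ineq2[of "grad \<zeta> x" v] mult_right_mono[OF bound[of x] norm_ge_zero[of v]] by simp
    qed simp
  qed auto
  then show ?thesis by (rule that)
qed

context
  fixes \<Omega> :: "(real ^ 'd) set"
  assumes open_\<Omega>: "open \<Omega>" and bounded_\<Omega>: "bounded \<Omega>"
begin

lemma integral_supported:
  fixes f :: "real ^ 'd \<Rightarrow> real"
  assumes "\<And>x. x \<notin> \<Omega> \<Longrightarrow> f x = 0"
  shows "(LINT x|lebesgue_on \<Omega>. f x) = (LINT x|lebesgue. f x)"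
proof -
  have "\<Omega> \<inter> space lebesgue \<in> sets lebesgue" using open_\<Omega> by simp
  from integral_restrict_space[OF this, of f]
  have "(LINT x|lebesgue_on \<Omega>. f x) = (LINT x|lebesgue. indicator \<Omega> x *\<^sub>R f x)" .
  also have "(\<lambda>x. indicator \<Omega> x *\<^sub>R f x) = f" using assms by (auto simp: indicator_def fun_eq_iff)
  finally show ?thesis .
qed

text \<open>Discrete integration by parts: translation invariance of the Lebesgue measure moves the difference
  quotient from \<open>\<zeta>\<close> to \<open>\<phi>\<close>, reversing the direction of the step. As both functions are Lipschitz and have
  bounded support, dominated convergence applies on both sides.\<close>

lemma lipschitz_has_weak_partial:
  fixes \<phi> :: "real ^ 'd \<Rightarrow> real"
  assumes lip: "L-lipschitz_on UNIV \<phi>" and zero: "\<And>x. x \<notin> \<Omega> \<Longrightarrow> \<phi> x = 0"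
    and diff: "AE x in lebesgue_on \<Omega>. \<phi> differentiable (at x)"
  shows "has_weak_partial \<Omega> j \<phi> (quotient_deriv j \<phi>)"
  unfolding has_weak_partial_def
proof
  fix \<zeta> assume \<zeta>: "\<zeta> \<in> test_functions \<Omega>"
  let ?e = "axis j 1 :: real ^ 'd"
  let ?t = "\<lambda>n. 1 / real (Suc n)"
  obtain L' where lip': "L'-lipschitz_on UNIV \<zeta>" using test_function_lipschitz[OF \<zeta>] .
  have c: "continuous_on UNIV \<phi>" "continuous_on UNIV \<zeta>" 
    using lip lip' by (auto intro: lipschitz_on_continuous_on)
  have K: "compact (closure \<Omega>)" using bounded_\<Omega> by simp
  have zero': "\<phi> x = 0" "\<zeta> x = 0" if "x \<notin> closure \<Omega>" for x
    using that zero[of x] test_function_zero[OF \<zeta>, of x] closure_subset[of \<Omega>] by auto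
  have sm: "smooth \<zeta>" using \<zeta> by (rule test_function_smooth)
  have 1: "(\<lambda>n. LINT x|lebesgue. real (Suc n) * (\<zeta> (x + ?t n *\<^sub>R ?e) - \<zeta> x) * \<phi> x) \<longlonglongrightarrow> (LINT x|lebesgue. partial_deriv j \<zeta> x * \<phi> x)"
  proof (rule integral_difference_quotient_LIMSEQ[OF lip' c(1) K zero'(1)])
    show "partial_deriv j \<zeta> \<in> borel_measurable lebesgue"
      using smooth_measurable[OF smooth_partial_deriv[OF sm], of j UNIV] by (simp add: lebesgue_on_UNIV_eq)
    have "(\<lambda>n. real (Suc n) * (\<zeta> (x + ?t n *\<^sub>R ?e) - \<zeta> x)) \<longlonglongrightarrow> partial_deriv j \<zeta> x" for x
      using difference_quotient_LIMSEQ[OF has_derivative_grad[OF smooth_differentiable[OF sm, of x]], of ?e]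
      by (simp add: grad_def inner_axis)
    then show "AE x in lebesgue. \<phi> x \<noteq> 0 \<longrightarrow> (\<lambda>n. real (Suc n) * (\<zeta> (x + ?t n *\<^sub>R ?e) - \<zeta> x)) \<longlonglongrightarrow> partial_deriv j \<zeta> x"
      by simp
  qed (auto simp: norm_axis_1)
  have 2: "(\<lambda>n. LINT x|lebesgue. real (Suc n) * (\<phi> (x + ?t n *\<^sub>R (- ?e)) - \<phi> x) * \<zeta> x) \<longlonglongrightarrow> (LINT x|lebesgue. (- quotient_deriv j \<phi> x) * \<zeta> x)"
  proof (rule integral_difference_quotient_LIMSEQ[OF lip c(2) K zero'(2)])
    show "(\<lambda>x. - quotient_deriv j \<phi> x) \<in> borel_measurable lebesgue"
      using quotient_deriv_measurable[OF c(1), of j UNIV] by (simp add: lebesgue_on_UNIV_eq)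
    have "AE x in lebesgue. x \<in> \<Omega> \<longrightarrow> \<phi> differentiable (at x)"
      using diff open_\<Omega> by (simp add: AE_restrict_space_iff)
    then show "AE x in lebesgue. \<zeta> x \<noteq> 0 \<longrightarrow> (\<lambda>n. real (Suc n) * (\<phi> (x + ?t n *\<^sub>R (- ?e)) - \<phi> x)) \<longlonglongrightarrow> - quotient_deriv j \<phi> x"
    proof eventually_elim
      case (elim x)
      show ?case
      proof
        assume "\<zeta> x \<noteq> 0"
        then have "\<phi> differentiable (at x)" using elim test_function_zero[OF \<zeta>] by blast
        note D = has_derivative_grad[OF this]
        show "(\<lambda>n. real (Suc n) * (\<phi> (x + ?t n *\<^sub>R (- ?e)) - \<phi> x)) \<longlonglongrightarrow> - quotient_deriv j \<phi> x"
          using difference_quotient_LIMSEQ[OF D, of "- ?e"] quotient_deriv_eq[OF D, of j] by simp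
      qed
    qed
  qed (auto simp: norm_axis_1)
  have eq: "(LINT x|lebesgue. real (Suc n) * (\<zeta> (x + ?t n *\<^sub>R ?e) - \<zeta> x) * \<phi> x)
      = (LINT x|lebesgue. real (Suc n) * (\<phi> (x + ?t n *\<^sub>R (- ?e)) - \<phi> x) * \<zeta> x)" for n
  proof -
    define a where "a = ?t n *\<^sub>R ?e"
    have c3: "continuous_on UNIV (\<lambda>x. \<zeta> (x + a) * \<phi> x)" "continuous_on UNIV (\<lambda>x. \<phi> (x - a) * \<zeta> x)" "continuous_on UNIV (\<lambda>x. \<phi> x * \<zeta> x)"
      by (intro continuous_intros c continuous_on_compose2[OF c(1)] continuous_on_compose2[OF c(2)]; simp)+
    have int: "integrable lborel (\<lambda>x. \<zeta> (x + a) * \<phi> x)" "integrable lborel (\<lambda>x. \<phi> (x - a) * \<zeta> x)" "integrable lborel (\<lambda>x. \<phi> x * \<zeta> x)"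
      by (rule integrable_continuous_compact_support[OF _ K]; use c3 zero' in simp)+
    have "(\<integral>x. \<zeta> (x + a) * \<phi> x \<partial>lborel) = (\<integral>x. \<phi> (x - a) * \<zeta> x \<partial>distr lborel borel ((+) a))"
      using borel_measurable_continuous_onI[OF c3(2)] by (subst integral_distr) (auto simp: add.commute mult.commute)
    also have "\<dots> = (\<integral>x. \<phi> (x - a) * \<zeta> x \<partial>lborel)" by (simp add: lborel_distr_plus)
    finally have tr: "(\<integral>x. \<zeta> (x + a) * \<phi> x \<partial>lborel) = (\<integral>x. \<phi> (x - a) * \<zeta> x \<partial>lborel)" .
    have "(LINT x|lebesgue. real (Suc n) * (\<zeta> (x + a) - \<zeta> x) * \<phi> x)
       = (\<integral>x. real (Suc n) * (\<zeta> (x + a) * \<phi> x - \<phi> x * \<zeta> x) \<partial>lborel)"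
      using borel_measurable_continuous_onI[OF c3(1)] borel_measurable_continuous_onI[OF c3(3)]
      by (subst integral_completion[symmetric]) (auto simp: algebra_simps)
    also have "\<dots> = (\<integral>x. real (Suc n) * (\<phi> (x - a) * \<zeta> x - \<phi> x * \<zeta> x) \<partial>lborel)"
      using int tr by simp
    also have "\<dots> = (LINT x|lebesgue. real (Suc n) * (\<phi> (x - a) - \<phi> x) * \<zeta> x)"
      using borel_measurable_continuous_onI[OF c3(2)] borel_measurable_continuous_onI[OF c3(3)]
      by (subst integral_completion[symmetric]) (auto simp: algebra_simps)
    finally show ?thesis by (simp add: a_def)
  qed
  have "(LINT x|lebesgue. partial_deriv j \<zeta> x * \<phi> x) = (LINT x|lebesgue. (- quotient_deriv j \<phi> x) * \<zeta> x)"
    using 1 2 unfolding eq by (rule LIMSEQ_unique)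
  moreover have "L2_inner \<Omega> \<phi> (partial_deriv j \<zeta>) = (LINT x|lebesgue. partial_deriv j \<zeta> x * \<phi> x)"
    unfolding L2_inner_def using zero by (subst integral_supported) (auto simp: mult.commute)
  moreover have "L2_inner \<Omega> (quotient_deriv j \<phi>) \<zeta> = (LINT x|lebesgue. quotient_deriv j \<phi> x * \<zeta> x)"
    unfolding L2_inner_def using test_function_zero[OF \<zeta>] by (subst integral_supported) auto
  ultimately show "L2_inner \<Omega> \<phi> (partial_deriv j \<zeta>) = - L2_inner \<Omega> (quotient_deriv j \<phi>) \<zeta>" by simp
qed

lemma lipschitz_H1:
  fixes \<phi> :: "real ^ 'd \<Rightarrow> real"
  assumes lip: "L-lipschitz_on UNIV \<phi>" and zero: "\<And>x. x \<notin> \<Omega> \<Longrightarrow> \<phi> x = 0"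
    and diff: "AE x in lebesgue_on \<Omega>. \<phi> differentiable (at x)"
  shows "\<phi> \<in> H1 \<Omega>" "quotient_deriv j \<phi> \<in> L2 \<Omega>" "AE x in lebesgue_on \<Omega>. weak_partial \<Omega> j \<phi> x = quotient_deriv j \<phi> x"
proof -
  have c: "continuous_on UNIV \<phi>" using lip by (rule lipschitz_on_continuous_on)
  show L2: "quotient_deriv j \<phi> \<in> L2 \<Omega>" for j
  proof (rule L2_bounded[OF open_\<Omega> bounded_\<Omega> quotient_deriv_measurable[OF c]])
    show "AE x in lebesgue_on \<Omega>. norm (quotient_deriv j \<phi> x) \<le> L"
      using diff
    proof eventually_elim
      case (elim x)
      then show ?case
        using partial_deriv_bound[OF lip elim, of j] quotient_deriv_eq[OF has_derivative_grad[OF elim], of j]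
        by (simp add: grad_def inner_axis)
    qed
  qed
  have W: "has_weak_partial \<Omega> j \<phi> (quotient_deriv j \<phi>)" for j
    by (rule lipschitz_has_weak_partial[OF lip zero diff])
  show "\<phi> \<in> H1 \<Omega>"
    using L2 W L2_continuous[OF open_\<Omega> bounded_\<Omega> c] by (auto simp: H1_def)
  show "AE x in lebesgue_on \<Omega>. weak_partial \<Omega> j \<phi> x = quotient_deriv j \<phi> x"
    by (rule weak_partial_spec[OF open_\<Omega> bounded_\<Omega> L2 W])
qed

lemma L2_norm_LIMSEQ_0:
  fixes w :: "nat \<Rightarrow> real ^ 'd \<Rightarrow> real"
  assumes meas: "\<And>n. w n \<in> borel_measurable (lebesgue_on \<Omega>)"
    and lim: "AE x in lebesgue_on \<Omega>. (\<lambda>n. w n x) \<longlonglongrightarrow> 0"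
    and bound: "\<And>n. AE x in lebesgue_on \<Omega>. \<bar>w n x\<bar> \<le> B"
  shows "(\<lambda>n. L2_norm \<Omega> (w n)) \<longlonglongrightarrow> 0"
proof -
  interpret finite_measure "lebesgue_on \<Omega>"
    using open_\<Omega> bounded_\<Omega> by (rule finite_measure_lebesgue_on_bounded_open)
  have "(\<lambda>n. LINT x|lebesgue_on \<Omega>. w n x * w n x) \<longlonglongrightarrow> (LINT x|lebesgue_on \<Omega>. 0)"
  proof (rule integral_dominated_convergence[where w="\<lambda>x. B * B"])
    show "AE x in lebesgue_on \<Omega>. (\<lambda>n. w n x * w n x) \<longlonglongrightarrow> 0"
      using lim by eventually_elim (use tendsto_mult in fastforce)
    show "AE x in lebesgue_on \<Omega>. norm (w n x * w n x) \<le> B * B" for n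
      using bound[of n]
    proof eventually_elim
      case (elim x)
      then have "\<bar>w n x\<bar> * \<bar>w n x\<bar> \<le> B * B" by (intro mult_mono) auto
      then show ?case by (simp add: abs_mult)
    qed
  qed (use meas in auto)
  from tendsto_real_sqrt[OF this] show ?thesis by (simp add: L2_norm_def L2_inner_def)
qed

text \<open>The approximating test functions are mollifications \<open>\<eta> n\<close> of the truncations
  \<open>\<psi> n = max 0 (\<phi> - 1 / (n + 1))\<close>, whose supports are compact subsets of \<open>\<Omega>\<close>. Let \<open>\<phi>\<close> be affine around
  \<open>x\<close>. If \<open>\<phi> x > 0\<close>, then from some \<open>n\<close> on \<open>\<psi> n\<close> differs from \<open>\<phi>\<close> by a constant on a fixed ball around
  \<open>x\<close>. If \<open>\<phi> x = 0\<close>, then \<open>x\<close> is a minimum of \<open>\<phi>\<close>, so \<open>\<phi>\<close> and all \<open>\<psi> n\<close> vanish on a ball around \<open>x\<close>.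
  In both cases \<open>\<eta> n\<close> eventually has the gradient of \<open>\<phi>\<close> at \<open>x\<close>; dominated convergence, with the
  Lipschitz constant as bound, turns this into \<open>L\<^sup>2\<close> convergence.\<close>

lemma lipschitz_H1_0:
  fixes \<phi> :: "real ^ 'd \<Rightarrow> real"
  assumes lip: "L-lipschitz_on UNIV \<phi>" and zero: "\<And>x. x \<notin> \<Omega> \<Longrightarrow> \<phi> x = 0"
    and nonneg: "\<And>x. \<phi> x \<ge> 0"
    and aff: "AE x in lebesgue_on \<Omega>. \<exists>g r. r > 0 \<and> (\<forall>y\<in>ball x r. \<phi> y = \<phi> x + g \<bullet> (y - x))"
  shows "\<phi> \<in> H1_0 \<Omega>" "AE x in lebesgue_on \<Omega>. weak_partial \<Omega> j \<phi> x = quotient_deriv j \<phi> x"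
proof -
  have affD: "(\<phi> has_derivative (\<lambda>v. g \<bullet> v)) (at x)" 
    if "r > 0" "\<forall>y\<in>ball x r. \<phi> y = \<phi> x + g \<bullet> (y - x)" for x g r
  proof (rule has_derivative_transform_within_open)
    show "((\<lambda>y. \<phi> x + g \<bullet> (y - x)) has_derivative (\<lambda>v. g \<bullet> v)) (at x)" by (auto intro!: derivative_eq_intros)
    show "x \<in> ball x r" "open (ball x r)" using that by auto
    show "\<phi> x + g \<bullet> (y - x) = \<phi> y" if "y \<in> ball x r" for y
      using \<open>\<forall>y\<in>ball x r. \<phi> y = \<phi> x + g \<bullet> (y - x)\<close> that by simp
  qed
  have diff: "AE x in lebesgue_on \<Omega>. \<phi> differentiable (at x)"
    using aff by eventually_elim (use affD in \<open>unfold differentiable_def, blast\<close>)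
  have H1: "\<phi> \<in> H1 \<Omega>" "quotient_deriv j \<phi> \<in> L2 \<Omega>" "AE x in lebesgue_on \<Omega>. weak_partial \<Omega> j \<phi> x = quotient_deriv j \<phi> x" for j
    by (rule lipschitz_H1[OF lip _ diff]; simp add: zero)+
  show "AE x in lebesgue_on \<Omega>. weak_partial \<Omega> j \<phi> x = quotient_deriv j \<phi> x" by (rule H1)
  have L: "L \<ge> 0" using lip by (rule lipschitz_on_nonneg)
  have c: "continuous_on UNIV \<phi>" using lip by (rule lipschitz_on_continuous_on)
  have lip': "\<bar>\<phi> x - \<phi> y\<bar> \<le> L * dist x y" for x y
    using lipschitz_onD[OF lip, of x y] by (simp add: dist_real_def)
  define \<psi> where "\<psi> = (\<lambda>n x. max 0 (\<phi> x - 1 / real (Suc n)))"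
  define K where "K = (\<lambda>n. {x. \<phi> x \<ge> 1 / real (Suc n)})"
  have "\<exists>\<eta>. \<eta> \<in> test_functions \<Omega> \<and> (\<forall>x. \<bar>\<eta> x - \<psi> n x\<bar> \<le> 1 / real (Suc n)) \<and>
    (\<forall>x j. \<bar>partial_deriv j \<eta> x\<bar> \<le> L) \<and>
    (\<forall>x c g r j. r > 1 / real (Suc n) \<longrightarrow> (\<forall>y\<in>ball x r. \<psi> n y = c + g \<bullet> (y - x)) \<longrightarrow> partial_deriv j \<eta> x = g $ j)" for n
  proof -
    have K\<Omega>: "K n \<subseteq> \<Omega>"
    proof
      fix x assume "x \<in> K n"
      moreover have "1 / real (Suc n) > 0" by simp
      ultimately have "\<phi> x \<noteq> 0" unfolding K_def by auto
      then show "x \<in> \<Omega>" using zero by blast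
    qed
    have "closed (K n)" unfolding K_def by (intro closed_Collect_le continuous_intros c)
    then have cK: "compact (K n)"
      using bounded_subset[OF bounded_\<Omega> K\<Omega>] by (simp add: compact_eq_bounded_closed)
    have lip\<psi>: "L-lipschitz_on UNIV (\<psi> n)"
      by (rule lipschitz_onI[OF _ L]) (use lip' in \<open>fastforce simp: \<psi>_def dist_real_def max_def\<close>)
    have supp: "\<psi> n x = 0" if "x \<notin> K n" for x using that by (simp add: \<psi>_def K_def)
    obtain \<eta> where "\<eta> \<in> test_functions \<Omega>" "\<And>x. \<bar>\<eta> x - \<psi> n x\<bar> \<le> 1 / real (Suc n)"
      "\<And>x j. \<bar>partial_deriv j \<eta> x\<bar> \<le> L"
      "\<And>x c g r j. r > 1 / real (Suc n) \<Longrightarrow> (\<And>y. y \<in> ball x r \<Longrightarrow> \<psi> n y = c + g \<bullet> (y - x)) \<Longrightarrow> partial_deriv j \<eta> x = g $ j"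
      by (rule test_function_approx[OF open_\<Omega> lip\<psi> cK K\<Omega> supp, of "1 / real (Suc n)"]) auto
    then show ?thesis by (intro exI[of _ \<eta>] conjI allI impI) blast+
  qed
  then obtain \<eta> where \<eta>: "\<And>n. \<eta> n \<in> test_functions \<Omega>" "\<And>n x. \<bar>\<eta> n x - \<psi> n x\<bar> \<le> 1 / real (Suc n)"
      "\<And>n x j. \<bar>partial_deriv j (\<eta> n) x\<bar> \<le> L"
      "\<And>n x c g r j. r > 1 / real (Suc n) \<Longrightarrow> (\<forall>y\<in>ball x r. \<psi> n y = c + g \<bullet> (y - x)) \<Longrightarrow> partial_deriv j (\<eta> n) x = g $ j"
    by metis
  have close: "\<bar>\<phi> x - \<eta> n x\<bar> \<le> 2 * (1 / real (Suc n))" for n x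
  proof -
    have "\<bar>\<phi> x - \<psi> n x\<bar> \<le> 1 / real (Suc n)" using nonneg[of x] by (auto simp: \<psi>_def max_def)
    then show ?thesis using \<eta>(2)[of n x] by linarith
  qed
  have inv0: "(\<lambda>n. 1 / real (Suc n)) \<longlonglongrightarrow> 0" by (rule LIMSEQ_Suc[OF lim_1_over_n])
  have m\<phi>: "\<phi> \<in> borel_measurable (lebesgue_on \<Omega>)" using c by (rule continuous_borel_measurable_lebesgue_on)
  have lim0: "(\<lambda>n. L2_norm \<Omega> (\<lambda>x. \<phi> x - \<eta> n x)) \<longlonglongrightarrow> 0"
  proof (rule L2_norm_LIMSEQ_0)
    show "(\<lambda>x. \<phi> x - \<eta> n x) \<in> borel_measurable (lebesgue_on \<Omega>)" for n
      by (rule borel_measurable_diff[OF m\<phi> smooth_measurable[OF test_function_smooth[OF \<eta>(1)]]])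
    show "AE x in lebesgue_on \<Omega>. (\<lambda>n. \<phi> x - \<eta> n x) \<longlonglongrightarrow> 0"
    proof (rule AE_I2)
      fix x show "(\<lambda>n. \<phi> x - \<eta> n x) \<longlonglongrightarrow> 0"
        by (rule Lim_null_comparison[OF _ tendsto_mult_right_zero[OF inv0, of 2]]) (use close in simp)
    qed
    show "AE x in lebesgue_on \<Omega>. \<bar>\<phi> x - \<eta> n x\<bar> \<le> 2" for n
    proof (rule AE_I2)
      fix x
      have "2 * (1 / real (Suc n)) \<le> 2" by (simp add: divide_le_eq)
      then show "\<bar>\<phi> x - \<eta> n x\<bar> \<le> 2" using close[of x n] by linarith
    qed
  qed
  have wp: "weak_partial \<Omega> j \<phi> \<in> borel_measurable (lebesgue_on \<Omega>)" for j
    using H1_weak_partial(1)[OF open_\<Omega> bounded_\<Omega> H1(1)] by (rule L2_measurable)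
  have lim1: "(\<lambda>n. L2_norm \<Omega> (\<lambda>x. weak_partial \<Omega> j \<phi> x - partial_deriv j (\<eta> n) x)) \<longlonglongrightarrow> 0" for j
  proof (rule L2_norm_LIMSEQ_0)
    show "(\<lambda>x. weak_partial \<Omega> j \<phi> x - partial_deriv j (\<eta> n) x) \<in> borel_measurable (lebesgue_on \<Omega>)" for n
      by (rule borel_measurable_diff[OF wp smooth_measurable[OF smooth_partial_deriv[OF test_function_smooth[OF \<eta>(1)]]]])
    have ae: "AE x in lebesgue_on \<Omega>. \<exists>g r. r > 0 \<and> (\<forall>y\<in>ball x r. \<phi> y = \<phi> x + g \<bullet> (y - x)) \<and> weak_partial \<Omega> j \<phi> x = g $ j"
      using aff H1(3)[of j]
    proof eventually_elim
      case (elim x)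
      then obtain g r where gr: "r > 0" "\<forall>y\<in>ball x r. \<phi> y = \<phi> x + g \<bullet> (y - x)" by blast
      then have "weak_partial \<Omega> j \<phi> x = g $ j" using elim(2) quotient_deriv_eq[OF affD[OF gr], of j] by (simp add: inner_axis)
      then show ?case using gr by blast
    qed
    then show "AE x in lebesgue_on \<Omega>. (\<lambda>n. weak_partial \<Omega> j \<phi> x - partial_deriv j (\<eta> n) x) \<longlonglongrightarrow> 0"
    proof eventually_elim
      case (elim x)
      then obtain g r where gr: "r > 0" "\<And>y. y \<in> ball x r \<Longrightarrow> \<phi> y = \<phi> x + g \<bullet> (y - x)" "weak_partial \<Omega> j \<phi> x = g $ j"
        by blast
      have "\<forall>\<^sub>F n in sequentially. partial_deriv j (\<eta> n) x = g $ j"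
      proof (cases "\<phi> x = 0")
        case True
        have "g = 0"
        proof (rule ccontr)
          assume "g \<noteq> 0"
          let ?y = "x - (r / 2 / norm g) *\<^sub>R g"
          have "?y \<in> ball x r" using \<open>g \<noteq> 0\<close> gr(1) by (simp add: dist_norm)
          then have "\<phi> ?y = - (r / 2 / norm g) * (g \<bullet> g)" using gr(2) True by simp
          also have "\<dots> < 0" using \<open>g \<noteq> 0\<close> gr(1) by (simp add: zero_less_mult_iff)
          finally show False using nonneg[of ?y] by simp
        qed
        have "\<psi> n y = 0 + g \<bullet> (y - x)" if "y \<in> ball x r" for n y
          using gr(2)[OF that] True \<open>g = 0\<close> by (simp add: \<psi>_def)
        then have "partial_deriv j (\<eta> n) x = g $ j" if "1 / real (Suc n) < r" for n
          using \<eta>(4)[OF that] by blast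
        moreover have "\<forall>\<^sub>F n in sequentially. 1 / real (Suc n) < r" using order_tendstoD(2)[OF inv0 gr(1)] .
        ultimately show ?thesis by (rule eventually_mono[rotated])
      next
        case False
        then have pos: "\<phi> x > 0" using nonneg[of x] by simp
        define s where "s = min r (\<phi> x / (2 * (L + 1)))"
        have s: "s > 0" "s \<le> r" "L * s \<le> \<phi> x / 2"
        proof -
          show "s > 0" "s \<le> r" using gr(1) pos L by (auto simp: s_def)
          have "s \<le> \<phi> x / (2 * (L + 1))" by (simp add: s_def)
          then have "(L + 1) * s \<le> \<phi> x / 2" using L by (simp add: field_simps)
          then show "L * s \<le> \<phi> x / 2" using \<open>s > 0\<close> by (simp add: algebra_simps)
        qed
        have "partial_deriv j (\<eta> n) x = g $ j" if n: "1 / real (Suc n) < min s (\<phi> x / 2)" for n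
        proof (rule \<eta>(4))
          show "1 / real (Suc n) < s" using n by simp
          show "\<forall>y\<in>ball x s. \<psi> n y = (\<phi> x - 1 / real (Suc n)) + g \<bullet> (y - x)"
          proof
            fix y assume y: "y \<in> ball x s"
            have "\<bar>\<phi> x - \<phi> y\<bar> \<le> L * dist x y" by (rule lip')
            also have "\<dots> \<le> L * s" using y L by (intro mult_left_mono) auto
            finally have "\<phi> y \<ge> \<phi> x / 2" using s(3) by linarith
            then have "\<psi> n y = \<phi> y - 1 / real (Suc n)" using n by (simp add: \<psi>_def)
            moreover have "\<phi> y = \<phi> x + g \<bullet> (y - x)" using gr(2) y s(2) by simp
            ultimately show "\<psi> n y = (\<phi> x - 1 / real (Suc n)) + g \<bullet> (y - x)" by simp
          qed
        qed
        moreover have "\<forall>\<^sub>F n in sequentially. 1 / real (Suc n) < min s (\<phi> x / 2)"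
          using order_tendstoD(2)[OF inv0, of "min s (\<phi> x / 2)"] s(1) pos by simp
        ultimately show ?thesis by (rule eventually_mono[rotated])
      qed
      then have "\<forall>\<^sub>F n in sequentially. 0 = weak_partial \<Omega> j \<phi> x - partial_deriv j (\<eta> n) x"
        by eventually_elim (simp add: gr(3))
      then show ?case by (rule Lim_transform_eventually[OF tendsto_const])
    qed
    show "AE x in lebesgue_on \<Omega>. \<bar>weak_partial \<Omega> j \<phi> x - partial_deriv j (\<eta> n) x\<bar> \<le> 2 * L" for n
      using H1(3)[of j] diff
    proof eventually_elim
      case (elim x)
      have "\<bar>weak_partial \<Omega> j \<phi> x\<bar> \<le> L"
        using elim(1) partial_deriv_bound[OF lip elim(2), of j] quotient_deriv_eq[OF has_derivative_grad[OF elim(2)], of j]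
        by (simp add: grad_def inner_axis)
      then show ?case using \<eta>(3)[of j n x] by linarith
    qed
  qed
  have "\<exists>\<zeta>\<in>test_functions \<Omega>. L2_norm \<Omega> (\<lambda>x. \<phi> x - \<zeta> x) < \<epsilon> \<and>
     (\<forall>j. L2_norm \<Omega> (\<lambda>x. weak_partial \<Omega> j \<phi> x - partial_deriv j \<zeta> x) < \<epsilon>)" if "\<epsilon> > 0" for \<epsilon>
  proof -
    have "\<forall>\<^sub>F n in sequentially. \<forall>j\<in>UNIV. L2_norm \<Omega> (\<lambda>x. weak_partial \<Omega> j \<phi> x - partial_deriv j (\<eta> n) x) < \<epsilon>"
      by (intro eventually_ball_finite) (use order_tendstoD(2)[OF lim1 that] in auto)
    moreover have "\<forall>\<^sub>F n in sequentially. L2_norm \<Omega> (\<lambda>x. \<phi> x - \<eta> n x) < \<epsilon>"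
      using order_tendstoD(2)[OF lim0 that] .
    ultimately have "\<forall>\<^sub>F n in sequentially. (\<forall>j\<in>UNIV. L2_norm \<Omega> (\<lambda>x. weak_partial \<Omega> j \<phi> x - partial_deriv j (\<eta> n) x) < \<epsilon>) \<and>
        L2_norm \<Omega> (\<lambda>x. \<phi> x - \<eta> n x) < \<epsilon>"
      by (rule eventually_conj)
    from eventually_happens'[OF sequentially_bot this]
    obtain n where "\<forall>j\<in>UNIV. L2_norm \<Omega> (\<lambda>x. weak_partial \<Omega> j \<phi> x - partial_deriv j (\<eta> n) x) < \<epsilon>"
        "L2_norm \<Omega> (\<lambda>x. \<phi> x - \<eta> n x) < \<epsilon>" by blast
    then show ?thesis using \<eta>(1)[of n] by blast
  qed
  then show "\<phi> \<in> H1_0 \<Omega>" using H1(1) by (simp add: H1_0_def)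
qed

end

section \<open>The nodal function of the interior vertices\<close>

text \<open>After moving one point of \<open>C\<close> to the origin, the others become linearly independent.\<close>

lemma affine_interpolation:
  fixes C :: "(real ^ 'd) set" and v :: "real ^ 'd \<Rightarrow> real"
  assumes "\<not> affine_dependent C"
  obtains a b where "\<And>c. c \<in> C \<Longrightarrow> a \<bullet> c + b = v c"
proof (cases "C = {}")
  case True
  then show ?thesis using that by blast
next
  case False
  then obtain c0 where c0: "c0 \<in> C" by blast
  define C' where "C' = C - {c0}"
  have C: "C = insert c0 C'" "c0 \<notin> C'" using c0 by (auto simp: C'_def)
  have "independent ((\<lambda>x. - c0 + x) ` C')"
    using assms C affine_dependent_iff_dependent by metis
  then obtain g where g: "linear g" "\<And>x. x \<in> (\<lambda>x. - c0 + x) ` C' \<Longrightarrow> g x = v (c0 + x) - v c0"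
    using linear_independent_extend[of "(\<lambda>x. - c0 + x) ` C'" "\<lambda>x. v (c0 + x) - v c0"] by blast
  define a where "a = (\<chi> j. g (axis j 1))"
  have ga: "g x = a \<bullet> x" for x unfolding a_def by (rule linear_eq_inner[OF g(1)])
  show ?thesis
  proof (rule that[of a "v c0 - a \<bullet> c0"])
    fix c assume "c \<in> C"
    show "a \<bullet> c + (v c0 - a \<bullet> c0) = v c"
    proof (cases "c = c0")
      case False
      then have "c \<in> C'" using \<open>c \<in> C\<close> C by blast
      then have "g (- c0 + c) = v (c0 + (- c0 + c)) - v c0" by (intro g(2)) blast
      then show ?thesis by (simp add: ga inner_diff_right)
    qed simp
  qed
qed

lemma affine_polynomial_of_degree_le:
  fixes a :: "real ^ 'd"
  assumes "k \<ge> 1"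
  shows "polynomial_of_degree_le k (\<lambda>x. a \<bullet> x + b)"
proof -
  let ?A = "{\<alpha> :: 'd \<Rightarrow> nat. (\<Sum>j\<in>UNIV. \<alpha> j) \<le> k}"
  \<comment> \<open>The exponent of the monomial \<open>x $ j\<close>.\<close>
  let ?e = "\<lambda>j i. if i = j then 1 else 0 :: nat"
  have "?A \<subseteq> PiE UNIV (\<lambda>_. {..k})"
  proof
    fix \<alpha> assume "\<alpha> \<in> ?A"
    moreover have "\<alpha> i \<le> (\<Sum>j\<in>UNIV. \<alpha> j)" for i by (rule member_le_sum) auto
    ultimately show "\<alpha> \<in> PiE UNIV (\<lambda>_. {..k})" by (auto intro: order_trans)
  qed
  then have fin: "finite ?A" by (rule finite_subset) (intro finite_PiE, auto)
  have e: "?e j \<in> ?A" for j using assms by simp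
  have z: "(\<lambda>_. 0) \<in> ?A" by simp
  define c where "c = (\<lambda>\<alpha>. (if \<alpha> = (\<lambda>_. 0) then b else 0) + (\<Sum>j\<in>UNIV. if \<alpha> = ?e j then a $ j else 0))"
  have "(\<Sum>\<alpha>\<in>?A. c \<alpha> * (\<Prod>j\<in>UNIV. x $ j ^ \<alpha> j)) = a \<bullet> x + b" for x
  proof -
    let ?m = "\<lambda>\<alpha>. \<Prod>j\<in>UNIV. x $ j ^ \<alpha> j"
    have me: "?m (?e j) = x $ j" for j
    proof -
      have "?m (?e j) = (\<Prod>i\<in>UNIV. if i = j then x $ i else 1)" by (intro prod.cong) auto
      then show ?thesis by simp
    qed
    have "(\<Sum>\<alpha>\<in>?A. c \<alpha> * ?m \<alpha>) = (\<Sum>\<alpha>\<in>?A. (if \<alpha> = (\<lambda>_. 0) then b * ?m \<alpha> else 0))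
        + (\<Sum>\<alpha>\<in>?A. \<Sum>j\<in>UNIV. if \<alpha> = ?e j then a $ j * ?m \<alpha> else 0)"
      unfolding sum.distrib[symmetric] c_def
      by (intro sum.cong refl) (auto simp: distrib_right sum_distrib_right intro!: sum.cong)
    also have "(\<Sum>\<alpha>\<in>?A. (if \<alpha> = (\<lambda>_. 0) then b * ?m \<alpha> else 0)) = b * ?m (\<lambda>_. 0)"
      using fin z by (subst sum.delta) auto
    also have "\<dots> = b" by simp
    also have "(\<Sum>\<alpha>\<in>?A. \<Sum>j\<in>UNIV. if \<alpha> = ?e j then a $ j * ?m \<alpha> else 0)
        = (\<Sum>j\<in>UNIV. \<Sum>\<alpha>\<in>?A. if \<alpha> = ?e j then a $ j * ?m \<alpha> else 0)" by (rule sum.swap)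
    also have "\<dots> = (\<Sum>j\<in>UNIV. a $ j * ?m (?e j))"
    proof (rule sum.cong[OF refl])
      fix j
      show "(\<Sum>\<alpha>\<in>?A. if \<alpha> = ?e j then a $ j * ?m \<alpha> else 0) = a $ j * ?m (?e j)"
        by (subst sum.delta[OF fin]) (use e[of j] in simp)
    qed
    also have "\<dots> = a \<bullet> x" unfolding me by (simp add: inner_vec_def)
    finally show ?thesis by simp
  qed
  then show ?thesis unfolding polynomial_of_degree_le_def by (intro exI[of _ c]) simp
qed

text \<open>Along a segment this is the one-dimensional statement for a finite closed cover of an interval.\<close>

lemma lipschitz_on_closed_cover:
  fixes f :: "'a::euclidean_space \<Rightarrow> real"
  assumes "finite \<C>" "\<Union>\<C> = UNIV" "\<And>C. C \<in> \<C> \<Longrightarrow> closed C" "\<And>C. C \<in> \<C> \<Longrightarrow> L-lipschitz_on C f" and L: "L \<ge> 0"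
  shows "L-lipschitz_on UNIV f"
proof (rule lipschitz_onI[OF _ L])
  fix x y :: 'a
  let ?s = "\<lambda>t :: real. x + t *\<^sub>R (y - x)"
  have "(L * dist x y)-lipschitz_on {0..1} (\<lambda>t. f (?s t))"
  proof (rule lipschitz_on_closed_Union[where I=\<C> and U="\<lambda>C. ?s -` C"])
    show "(L * dist x y)-lipschitz_on (?s -` C) (\<lambda>t. f (?s t))" if "C \<in> \<C>" for C
    proof (rule lipschitz_onI)
      fix s t assume "s \<in> ?s -` C" "t \<in> ?s -` C"
      then have "dist (f (?s s)) (f (?s t)) \<le> L * dist (?s s) (?s t)"
        by (intro lipschitz_onD[OF assms(4)[OF that]]) auto
      also have "dist (?s s) (?s t) = dist x y * dist s t"
        by (simp add: dist_norm scaleR_left_diff_distrib[symmetric] norm_minus_commute mult.commute)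
      finally show "dist (f (?s s)) (f (?s t)) \<le> L * dist x y * dist s t" by (simp add: mult.assoc)
    qed (use L in simp)
    show "closed (?s -` C)" if "C \<in> \<C>" for C
      by (intro closed_vimage assms(3) that continuous_intros)
    show "{0..1} \<subseteq> (\<Union>C\<in>\<C>. ?s -` C)" using assms(2) by auto
  qed (use assms(1) L in auto)
  from lipschitz_onD[OF this, of 0 1] show "dist (f x) (f y) \<le> L * dist x y" by simp
qed

context
  fixes \<sigma> :: real and \<tau> :: "(real ^ 'd) set set" and \<Omega> :: "(real ^ 'd) set"
  assumes reg: "regular_triangulation_of \<sigma> \<tau> \<Omega>"
begin

lemma mesh_facts:
  shows "finite \<tau>" "\<Omega> = interior (\<Union>\<tau>)" "closure \<Omega> = \<Union>\<tau>" "open \<Omega>" "bounded \<Omega>" "\<Omega> \<subseteq> \<Union>\<tau>"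
    "T \<in> \<tau> \<Longrightarrow> convex T" "T \<in> \<tau> \<Longrightarrow> compact T" "T \<in> \<tau> \<Longrightarrow> closed T"
    "T \<in> \<tau> \<Longrightarrow> T' \<in> \<tau> \<Longrightarrow> (T \<inter> T') face_of T"
proof -
  have tri: "triangulation \<tau>" and simp: "\<And>T. T \<in> \<tau> \<Longrightarrow> int CARD('d) simplex T"
    and \<Omega>: "\<Omega> = interior (\<Union>\<tau>)" "closure \<Omega> = \<Union>\<tau>"
    using reg by (auto simp: regular_triangulation_of_def)
  show fin: "finite \<tau>" using tri by (simp add: triangulation_def)
  show \<Omega>1: "\<Omega> = interior (\<Union>\<tau>)" and \<Omega>2: "closure \<Omega> = \<Union>\<tau>" by fact+
  show "open \<Omega>" using \<Omega>1 by (metis open_interior)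
  have comp: "compact T" if "T \<in> \<tau>" for T using simp[OF that] by (rule compact_simplex)
  then have "compact (\<Union>\<tau>)" using fin by (rule_tac compact_Union) auto
  moreover show sub: "\<Omega> \<subseteq> \<Union>\<tau>" using \<Omega>1 interior_subset by metis
  ultimately show "bounded \<Omega>" using bounded_subset compact_imp_bounded by metis
  show "T \<in> \<tau> \<Longrightarrow> convex T" using simp convex_simplex by blast
  show "T \<in> \<tau> \<Longrightarrow> compact T" "T \<in> \<tau> \<Longrightarrow> closed T" using comp compact_imp_closed by auto
  show "T \<in> \<tau> \<Longrightarrow> T' \<in> \<tau> \<Longrightarrow> (T \<inter> T') face_of T" using tri by (simp add: triangulation_def)
qed

lemma AE_not_element_frontier: "AE x in lebesgue. x \<notin> (\<Union>T\<in>\<tau>. frontier T)"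
proof -
  have "negligible (\<Union>T\<in>\<tau>. frontier T)"
    using mesh_facts(1,7) by (intro negligible_Union) (auto intro: negligible_convex_frontier)
  then show ?thesis by (simp only: negligible_iff_null_sets AE_not_in)
qed

text \<open>The reason why the nodal function below vanishes on the boundary. Take \<open>y\<close> in \<open>\<Omega>\<close> on the segment,
  close to \<open>a\<close>. Since the mesh is conforming, every element that contains \<open>y\<close> contains the end \<open>w\<close> of the
  segment. These elements cover a neighbourhood of \<open>y\<close>, and being convex they are mapped into themselves by the
  contraction with centre \<open>w\<close> that moves \<open>y\<close> to \<open>x\<close>. So they cover a neighbourhood of \<open>x\<close>.\<close>

lemma open_segment_from_interior:
  assumes T: "T \<in> \<tau>" and a: "a \<in> T" "a \<in> \<Omega>" and w: "w \<in> T" and x: "x \<in> open_segment a w"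
  shows "x \<in> \<Omega>"
proof -
  obtain s where "a \<noteq> w" and s: "0 < s" "s < 1" "x = (1 - s) *\<^sub>R a + s *\<^sub>R w"
    using x by (auto simp: in_segment)
  have "((\<lambda>t. (1 - t) *\<^sub>R a + t *\<^sub>R w) \<longlongrightarrow> (1 - 0) *\<^sub>R a + 0 *\<^sub>R w) (at_right 0)"
    by (intro tendsto_intros)
  then have "\<forall>\<^sub>F t in at_right 0. (1 - t) *\<^sub>R a + t *\<^sub>R w \<in> \<Omega>"
    using mesh_facts(4) a(2) by (auto simp: tendsto_def)
  moreover have "\<forall>\<^sub>F t in at_right 0. t \<in> {0<..<s}"
    using s(1) by (rule eventually_at_right_real)
  ultimately have "\<forall>\<^sub>F t in at_right 0. (1 - t) *\<^sub>R a + t *\<^sub>R w \<in> \<Omega> \<and> t \<in> {0<..<s}"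
    by (rule eventually_conj)
  from eventually_happens'[OF trivial_limit_at_right_real this]
  obtain t where t: "0 < t" "t < s" "(1 - t) *\<^sub>R a + t *\<^sub>R w \<in> \<Omega>" by auto
  define y where "y = (1 - t) *\<^sub>R a + t *\<^sub>R w"
  have y: "y \<in> open_segment a w" using t s \<open>a \<noteq> w\<close> by (auto simp: in_segment y_def)
  define \<theta> where "\<theta> = (s - t) / (1 - t)"
  have \<theta>: "0 \<le> \<theta>" "\<theta> < 1" using t s by (auto simp: \<theta>_def field_simps)
  have xy: "x = (1 - \<theta>) *\<^sub>R y + \<theta> *\<^sub>R w"
  proof -
    have "\<theta> * (1 - t) = s - t" using t s by (simp add: \<theta>_def)
    then have "(1 - \<theta>) * (1 - t) = 1 - s" "(1 - \<theta>) * t + \<theta> = s" by (auto simp: algebra_simps)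
    then show ?thesis
      by (simp add: y_def s(3) scaleR_add_right scaleR_add_left[symmetric] add.assoc)
  qed
  \<comment> \<open>A neighbourhood of \<open>y\<close> that meets only elements containing \<open>y\<close>.\<close>
  let ?V = "\<Omega> - \<Union>{T' \<in> \<tau>. y \<notin> T'}"
  have "open ?V" using mesh_facts by (intro open_Diff closed_Union) auto
  moreover have "y \<in> ?V" using t(3) by (auto simp: y_def)
  ultimately obtain \<delta> where \<delta>: "\<delta> > 0" "ball y \<delta> \<subseteq> ?V" by (rule openE)
  have "ball x ((1 - \<theta>) * \<delta>) \<subseteq> \<Union>\<tau>"
  proof
    fix z assume z: "z \<in> ball x ((1 - \<theta>) * \<delta>)"
    define z' where "z' = y + (1 / (1 - \<theta>)) *\<^sub>R (z - x)"
    have "dist y z' = dist x z / (1 - \<theta>)" using \<theta> by (simp add: z'_def dist_norm norm_minus_commute)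
    also have "\<dots> < \<delta>" using z \<theta> by (simp add: field_simps)
    finally have z'V: "z' \<in> ?V" using \<delta>(2) by auto
    then obtain T' where T': "T' \<in> \<tau>" "z' \<in> T'" using mesh_facts(6) by blast
    have "y \<in> T'" using z'V T' by blast
    moreover have "y \<in> T" using y closed_segment_subset[OF a(1) w mesh_facts(7)[OF T]] open_closed_segment by blast
    ultimately have "w \<in> T'"
      using mesh_facts(10)[OF T T'(1)] a(1) w y unfolding face_of_def by blast
    have "z = (1 - \<theta>) *\<^sub>R z' + \<theta> *\<^sub>R w" using \<theta> by (simp add: z'_def xy scaleR_add_right)
    also have "\<dots> \<in> T'" using mesh_facts(7)[OF T'(1)] T'(2) \<open>w \<in> T'\<close> \<theta> by (intro convexD) auto
    finally show "z \<in> \<Union>\<tau>" using T'(1) by blast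
  qed
  moreover have "(1 - \<theta>) * \<delta> > 0" using \<theta> \<delta> by simp
  ultimately have "x \<in> interior (\<Union>\<tau>)" by (meson mem_interior)
  then show ?thesis using mesh_facts(2) by simp
qed

text \<open>The continuous piecewise affine function with value \<open>1\<close> at the vertices inside \<open>\<Omega>\<close> and \<open>0\<close> at the
  vertices on the boundary. Adjacent elements meet in a common face, whose vertices determine the values on
  it, so the affine pieces fit together. A positive value at a point of an element requires a vertex of that
  element inside \<open>\<Omega>\<close> with positive weight, and then \<open>open_segment_from_interior\<close> puts the point into \<open>\<Omega>\<close>;
  so the function vanishes off \<open>\<Omega>\<close>. An element away from the boundary has all its vertices in \<open>\<Omega>\<close>; hence the
  value \<open>1\<close> off the strip.\<close>

lemma exists_nodal_function:
  assumes "k \<ge> 1"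
  shows "\<exists>\<phi> L. L-lipschitz_on UNIV \<phi> \<and> (\<forall>x. x \<notin> \<Omega> \<longrightarrow> \<phi> x = 0) \<and> (\<forall>x. \<phi> x \<ge> 0) \<and>
    (AE x in lebesgue_on \<Omega>. \<exists>g r. r > 0 \<and> (\<forall>y\<in>ball x r. \<phi> y = \<phi> x + g \<bullet> (y - x))) \<and>
    (\<forall>x \<in> \<Omega> - boundary_strip \<tau> \<Omega>. \<phi> x = 1) \<and> \<phi> \<in> piecewise_poly k \<tau>"
proof -
  define E where "E = (\<lambda>T :: (real^'d) set. {c. c extreme_point_of T})"
  have E: "T = convex hull E T" "finite (E T)" "E T \<subseteq> T" "\<exists>a b. \<forall>c\<in>E T. a \<bullet> c + b = indicator \<Omega> c"
    if "T \<in> \<tau>" for T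
  proof -
    show "T = convex hull E T"
      unfolding E_def using Krein_Milman_Minkowski mesh_facts(7,8) that by blast
    have "int CARD('d) simplex T" using reg that by (simp add: regular_triangulation_of_def)
    then obtain C where C: "\<not> affine_dependent C" "T = convex hull C" by (auto simp: simplex_def)
    then have EC: "E T \<subseteq> C" using extreme_point_of_convex_hull by (auto simp: E_def)
    then show "finite (E T)" using aff_independent_finite[OF C(1)] finite_subset by blast
    obtain a b where "\<And>c. c \<in> C \<Longrightarrow> a \<bullet> c + b = indicator \<Omega> c"
      using affine_interpolation[OF C(1), of "indicator \<Omega>"] by blast
    then show "\<exists>a b. \<forall>c\<in>E T. a \<bullet> c + b = indicator \<Omega> c" using EC by blast
    show "E T \<subseteq> T" by (auto simp: E_def extreme_point_of_def)
  qed
  then obtain a b where ab: "\<And>T c. T \<in> \<tau> \<Longrightarrow> c \<in> E T \<Longrightarrow> a T \<bullet> c + b T = indicator \<Omega> c"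
    by metis
  define p where "p = (\<lambda>T x. a T \<bullet> x + b T)"
  have consistent: "p T x = p T' x" if T: "T \<in> \<tau>" "T' \<in> \<tau>" and x: "x \<in> T" "x \<in> T'" for T T' x
  proof -
    let ?F = "T \<inter> T'" and ?H = "{x. (a T - a T') \<bullet> x = b T' - b T}"
    have F: "?F face_of T" "?F face_of T'"
      using mesh_facts(10)[OF T] mesh_facts(10)[OF T(2,1)] by (simp_all add: Int_commute)
    have "E ?F \<subseteq> E T \<inter> E T'" using extreme_point_of_face F unfolding E_def by blast
    have "E ?F \<subseteq> ?H"
    proof
      fix c assume "c \<in> E ?F"
      then have "a T \<bullet> c + b T = indicator \<Omega> c" "a T' \<bullet> c + b T' = indicator \<Omega> c"
        using ab T \<open>E ?F \<subseteq> E T \<inter> E T'\<close> by blast+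
      then show "c \<in> ?H" by (simp add: inner_diff_left)
    qed
    then have "convex hull E ?F \<subseteq> ?H" by (rule hull_minimal) (rule convex_hyperplane)
    moreover have "?F = convex hull E ?F"
      unfolding E_def using mesh_facts(7,8) T by (intro Krein_Milman_Minkowski convex_Int compact_Int)
    ultimately have "x \<in> ?H" using x by blast
    then show ?thesis by (simp add: p_def inner_diff_left)
  qed
  have p_nonneg: "p T x \<ge> 0" if T: "T \<in> \<tau>" and x: "x \<in> T" for T x
  proof -
    have "E T \<subseteq> {x. a T \<bullet> x \<ge> - b T}"
    proof
      fix c assume "c \<in> E T"
      then have "a T \<bullet> c + b T \<ge> 0" using ab[OF T] by (simp only: indicator_pos_le)
      then show "c \<in> {x. a T \<bullet> x \<ge> - b T}" by simp
    qed
    then have "convex hull E T \<subseteq> {x. a T \<bullet> x \<ge> - b T}" by (rule hull_minimal) (rule convex_halfspace_ge)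
    then have "x \<in> {x. a T \<bullet> x \<ge> - b T}" using E(1)[OF T] x by blast
    then show ?thesis by (simp add: p_def)
  qed
  have p_pos: "x \<in> \<Omega>" if T: "T \<in> \<tau>" and x: "x \<in> T" "p T x > 0" for T x
  proof -
    \<comment> \<open>Adding vertices one at a time, \<open>x\<close> lies on a segment from the new vertex \<open>c\<close> to a point \<open>y\<close> of the
      previous hull; one of the two ends is in \<open>\<Omega>\<close>.\<close>
    have "x \<in> \<Omega>" if "finite S" "S \<subseteq> E T" "x \<in> convex hull S" "p T x > 0" for S x
      using that
    proof (induction S arbitrary: x rule: finite_induct)
      case empty then show ?case by simp
    next
      case (insert c S)
      have hullT: "convex hull S \<subseteq> T" using E(3)[OF T] insert.prems(1) mesh_facts(7)[OF T]
        by (intro hull_minimal) auto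
      have cT: "c \<in> T" using E(3)[OF T] insert.prems(1) by blast
      show ?case
      proof (cases "S = {}")
        case True
        then have "x = c" using insert.prems(2) by simp
        moreover have "a T \<bullet> c + b T = indicator \<Omega> c" using ab[OF T] insert.prems(1) by blast
        ultimately show ?thesis using insert.prems(3) by (simp add: p_def indicator_def split: if_splits)
      next
        case False
        obtain u v y where uv: "0 \<le> u" "0 \<le> v" "u + v = 1" "y \<in> convex hull S" "x = u *\<^sub>R c + v *\<^sub>R y"
          using insert.prems(2) unfolding convex_hull_insert[OF False] by blast
        have px: "p T x = u * p T c + v * p T y"
          using uv(3) by (simp add: p_def uv(5) inner_add_right distrib_left)
            (metis distrib_right mult_1)
        have pc: "p T c = indicator \<Omega> c" using ab[OF T] insert.prems(1) by (simp add: p_def)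
        have yT: "y \<in> T" using uv(4) hullT by blast
        have "u = 1 - v" using uv(3) by simp
        then have seg: "x \<in> closed_segment c y"
          unfolding in_segment using uv by (intro exI[of _ v]) auto
        show ?thesis
        proof (cases "c \<in> \<Omega>")
          case True
          show ?thesis
          proof (cases "x = y")
            case True
            then show ?thesis using insert.IH[OF _ _ insert.prems(3)] insert.prems(1) uv(4) by simp
          next
            case False
            then show ?thesis using \<open>c \<in> \<Omega>\<close> seg open_segment_from_interior[OF T cT \<open>c \<in> \<Omega>\<close> yT]
              by (cases "x = c") (auto simp: open_segment_def)
          qed
        next
          case False
          then have "v * p T y > 0" using px pc insert.prems(3) by simp
          then have "v > 0" "p T y > 0" using uv(2) by (auto simp: zero_less_mult_iff)
          then have "y \<in> \<Omega>" using insert.IH[OF _ uv(4)] insert.prems(1) by simp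
          show ?thesis
          proof (cases "x = c")
            case True
            then show ?thesis using pc False insert.prems(3) by simp
          next
            case False
            then show ?thesis using \<open>y \<in> \<Omega>\<close> seg open_segment_from_interior[OF T yT \<open>y \<in> \<Omega>\<close> cT]
              by (cases "x = y") (auto simp: open_segment_def closed_segment_commute)
          qed
        qed
      qed
    qed
    then show ?thesis using E[OF T] x by blast
  qed
  define \<phi> where "\<phi> = (\<lambda>x. if x \<in> \<Union>\<tau> then p (SOME T. T \<in> \<tau> \<and> x \<in> T) x else 0)"
  have \<phi>p: "\<phi> x = p T x" if "T \<in> \<tau>" "x \<in> T" for T x
  proof -
    have "\<exists>T. T \<in> \<tau> \<and> x \<in> T" using that by blast
    then have "(SOME T. T \<in> \<tau> \<and> x \<in> T) \<in> \<tau> \<and> x \<in> (SOME T. T \<in> \<tau> \<and> x \<in> T)" by (rule someI_ex)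
    then have "p (SOME T. T \<in> \<tau> \<and> x \<in> T) x = p T x" using consistent that by blast
    moreover have "x \<in> \<Union>\<tau>" using that by blast
    ultimately show ?thesis by (simp only: \<phi>_def if_True)
  qed
  have outside: "\<phi> x = 0" if "x \<notin> \<Union>\<tau>" for x using that by (simp only: \<phi>_def if_False)
  have nonneg: "\<phi> x \<ge> 0" for x
  proof (cases "x \<in> \<Union>\<tau>")
    case True
    then obtain T where T: "T \<in> \<tau>" "x \<in> T" by blast
    show ?thesis using p_nonneg[OF T] \<phi>p[OF T] by simp
  qed (simp add: outside)
  have zero: "\<phi> x = 0" if "x \<notin> \<Omega>" for x
  proof (cases "x \<in> \<Union>\<tau>")
    case True
    then obtain T where "T \<in> \<tau>" "x \<in> T" by blast
    then show ?thesis using p_pos[of T x] that nonneg[of x] \<phi>p[of T x] by force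
  qed (simp add: outside)
  have one: "\<phi> x = 1" if x: "x \<in> \<Omega> - boundary_strip \<tau> \<Omega>" for x
  proof -
    obtain T where T: "T \<in> \<tau>" "x \<in> T" using x mesh_facts(6) by blast
    then have "T \<inter> frontier \<Omega> = {}" using x by (auto simp: boundary_strip_def)
    moreover have "T \<subseteq> closure \<Omega>" using T mesh_facts(3) by blast
    ultimately have "T \<subseteq> \<Omega>" using mesh_facts(4) by (auto simp: frontier_def interior_open)
    have "E T \<subseteq> {x. a T \<bullet> x = 1 - b T}"
    proof
      fix c assume "c \<in> E T"
      then have "c \<in> \<Omega>" "a T \<bullet> c + b T = indicator \<Omega> c"
        using ab[OF T(1)] E(3)[OF T(1)] \<open>T \<subseteq> \<Omega>\<close> by auto
      then show "c \<in> {x. a T \<bullet> x = 1 - b T}" by simp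
    qed
    then have "convex hull E T \<subseteq> {x. a T \<bullet> x = 1 - b T}" by (rule hull_minimal) (rule convex_hyperplane)
    then have "x \<in> {x. a T \<bullet> x = 1 - b T}" using E(1)[OF T(1)] T(2) by blast
    then show ?thesis using \<phi>p[OF T] by (simp add: p_def)
  qed
  define L where "L = (\<Sum>T\<in>\<tau>. norm (a T))"
  have "L-lipschitz_on UNIV \<phi>"
  proof (rule lipschitz_on_closed_cover[where \<C>="insert (- \<Omega>) \<tau>"])
    show L: "L \<ge> 0" unfolding L_def by (intro sum_nonneg) simp
    show "finite (insert (- \<Omega>) \<tau>)" using mesh_facts(1) by simp
    show "\<Union>(insert (- \<Omega>) \<tau>) = UNIV" using mesh_facts(6) by blast
    show "closed C" if "C \<in> insert (- \<Omega>) \<tau>" for C using that mesh_facts(4,9) by (auto simp: closed_def)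
    show "L-lipschitz_on C \<phi>" if "C \<in> insert (- \<Omega>) \<tau>" for C
    proof (cases "C = - \<Omega>")
      case True
      then show ?thesis using zero L by (intro lipschitz_onI) auto
    next
      case False
      then have C: "C \<in> \<tau>" using that by simp
      show ?thesis
      proof (rule lipschitz_onI[OF _ L])
        fix x y assume xy: "x \<in> C" "y \<in> C"
        have "dist (\<phi> x) (\<phi> y) = \<bar>a C \<bullet> (x - y)\<bar>"
          using \<phi>p[OF C] xy by (simp add: p_def dist_real_def inner_diff_right)
        also have "\<dots> \<le> norm (a C) * dist x y" unfolding dist_norm by (rule Cauchy_Schwarz_ineq2)
        also have "\<dots> \<le> L * dist x y"
          unfolding L_def by (intro mult_right_mono member_le_sum C mesh_facts(1)) auto
        finally show "dist (\<phi> x) (\<phi> y) \<le> L * dist x y" .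
      qed
    qed
  qed
  moreover have "AE x in lebesgue_on \<Omega>. \<exists>g r. r > 0 \<and> (\<forall>y\<in>ball x r. \<phi> y = \<phi> x + g \<bullet> (y - x))"
  proof -
    from AE_not_element_frontier have "AE x in lebesgue. x \<in> \<Omega> \<longrightarrow> (\<exists>g r. r > 0 \<and> (\<forall>y\<in>ball x r. \<phi> y = \<phi> x + g \<bullet> (y - x)))"
    proof eventually_elim
      case (elim x)
      show ?case
      proof
        assume "x \<in> \<Omega>"
        then obtain T where T: "T \<in> \<tau>" "x \<in> T" using mesh_facts(6) by blast
        then have "x \<in> interior T" using elim closure_subset[of T] by (auto simp: frontier_def)
        then obtain r where r: "r > 0" "ball x r \<subseteq> T" by (meson mem_interior)
        have "\<phi> y = \<phi> x + a T \<bullet> (y - x)" if "y \<in> ball x r" for y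
          using \<phi>p[OF T] \<phi>p[OF T(1), of y] r(2) that by (auto simp: p_def inner_diff_right)
        then show "\<exists>g r. r > 0 \<and> (\<forall>y\<in>ball x r. \<phi> y = \<phi> x + g \<bullet> (y - x))" using r(1) by blast
      qed
    qed
    then show ?thesis using mesh_facts(4) by (simp add: AE_restrict_space_iff)
  qed
  moreover have "\<phi> \<in> piecewise_poly k \<tau>"
    unfolding piecewise_poly_def
  proof clarify
    fix T assume T: "T \<in> \<tau>"
    show "\<exists>q. polynomial_of_degree_le k q \<and> (AE x in lebesgue_on T. \<phi> x = q x)"
      by (rule exI[of _ "p T"]) (use affine_polynomial_of_degree_le[OF assms, of "a T" "b T"] \<phi>p[OF T] in \<open>auto simp: p_def[abs_def] intro!: AE_I2\<close>)
  qed
  ultimately show ?thesis using zero nonneg one by (intro exI[of _ \<phi>] exI[of _ L] conjI allI impI ballI)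
qed

end

section \<open>The momentum balance\<close>

text \<open>Measurability of \<open>v\<close> is inherited from \<open>u\<close>, as the Lebesgue measure is complete.\<close>

lemma momentum_cong_AE:
  fixes u v :: "real ^ 'd \<Rightarrow> real ^ 'd"
  assumes \<Omega>: "open \<Omega>" and u: "u \<in> L2 \<Omega>" and ae: "AE x in lebesgue_on \<Omega>. v x = u x"
  shows "momentum \<Omega> i v = momentum \<Omega> i u"
proof -
  have \<Omega>l: "\<Omega> \<inter> space lebesgue \<in> sets lebesgue" using \<Omega> by simp
  have "(\<lambda>x. u x $ i) \<in> borel_measurable (lebesgue_on \<Omega>)" by (rule L2_measurable[OF L2_component[OF u]])
  then have 1: "(\<lambda>x. indicator \<Omega> x *\<^sub>R (u x $ i)) \<in> borel_measurable lebesgue"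
    by (simp only: borel_measurable_restrict_space_iff[OF \<Omega>l])
  have 2: "AE x in lebesgue. indicator \<Omega> x *\<^sub>R (u x $ i) = indicator \<Omega> x *\<^sub>R (v x $ i)"
    using ae unfolding AE_restrict_space_iff[OF \<Omega>l] by eventually_elim (auto simp: indicator_def)
  have 3: "(\<lambda>x. indicator \<Omega> x *\<^sub>R (v x $ i)) \<in> borel_measurable lebesgue"
    using 1 2 by (rule borel_measurable_AE)
  show ?thesis
    unfolding momentum_def L2_inner_def integral_restrict_space[OF \<Omega>l] inner_axis
    using integral_cong_AE[OF 1 3 2] by simp
qed

context
  fixes \<sigma> :: real and \<tau> :: "(real ^ 'd) set set" and \<Omega> :: "(real ^ 'd) set"
  assumes reg: "regular_triangulation_of \<sigma> \<tau> \<Omega>"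
begin

text \<open>The heart of the matter: \<open>2 D(v) v + (div v) v\<close> has the \<open>i\<close>-th component
  \<open>\<Sum>\<^sub>j \<partial>\<^sub>j (v\<^sub>i v\<^sub>j) + \<partial>\<^sub>i (v \<bullet> v) / 2\<close>, and the integral of each of these derivatives is zero.\<close>

lemma emac_terms_cancel:
  fixes v :: "real ^ 'd \<Rightarrow> real ^ 'd"
  assumes v: "v \<in> X_space \<Omega>"
  shows "(\<Sum>j\<in>UNIV. L2_inner \<Omega> (weak_partial \<Omega> j (\<lambda>y. v y $ i)) (\<lambda>x. v x $ j)
            + L2_inner \<Omega> (weak_partial \<Omega> i (\<lambda>y. v y $ j)) (\<lambda>x. v x $ j)
            + L2_inner \<Omega> (weak_partial \<Omega> j (\<lambda>y. v y $ j)) (\<lambda>x. v x $ i)) = 0"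
proof (rule sum.neutral, rule ballI)
  fix j
  note ob = mesh_facts(4,5)[OF reg]
  have parts: "L2_inner \<Omega> (\<lambda>x. v x $ a) (weak_partial \<Omega> k (\<lambda>y. v y $ b))
      = - L2_inner \<Omega> (weak_partial \<Omega> k (\<lambda>y. v y $ a)) (\<lambda>x. v x $ b)" for a b k
    by (rule weak_integration_by_parts[OF ob X_space_facts(1)[OF ob v] X_space_component[OF ob v]])
  show "L2_inner \<Omega> (weak_partial \<Omega> j (\<lambda>y. v y $ i)) (\<lambda>x. v x $ j)
            + L2_inner \<Omega> (weak_partial \<Omega> i (\<lambda>y. v y $ j)) (\<lambda>x. v x $ j)
            + L2_inner \<Omega> (weak_partial \<Omega> j (\<lambda>y. v y $ j)) (\<lambda>x. v x $ i) = 0"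
    using parts[of i j j] parts[of j i j] L2_inner_commute[of \<Omega> "\<lambda>x. v x $ i"] L2_inner_commute[of \<Omega> "\<lambda>x. v x $ j"]
    by simp
qed



text \<open>The strip is closed in \<open>\<Omega>\<close> and hence not open in general, whereas locality of weak derivatives is
  available on open sets. The interiors of its elements miss only a null set of it.\<close>

lemma strip_facts:
  shows "boundary_strip \<tau> \<Omega> \<subseteq> \<Omega>" "boundary_strip \<tau> \<Omega> \<in> sets lebesgue" "open (\<Omega> - boundary_strip \<tau> \<Omega>)"
    "\<exists>U. open U \<and> U \<subseteq> boundary_strip \<tau> \<Omega> \<and> (AE x in lebesgue. x \<in> boundary_strip \<tau> \<Omega> \<longrightarrow> x \<in> U)"
proof -
  let ?B = "{T \<in> \<tau>. T \<inter> frontier \<Omega> \<noteq> {}}"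
  note m = mesh_facts[OF reg]
  show "boundary_strip \<tau> \<Omega> \<subseteq> \<Omega>" by (auto simp: boundary_strip_def)
  have cl: "closed (\<Union>?B)" using m(1,9) by (intro closed_Union) auto
  then show "boundary_strip \<tau> \<Omega> \<in> sets lebesgue"
    unfolding boundary_strip_def using m(4) by (intro sets.Int) auto
  have "\<Omega> - boundary_strip \<tau> \<Omega> = \<Omega> - \<Union>?B" by (auto simp: boundary_strip_def)
  then show "open (\<Omega> - boundary_strip \<tau> \<Omega>)" using open_Diff[OF m(4) cl] by simp
  show "\<exists>U. open U \<and> U \<subseteq> boundary_strip \<tau> \<Omega> \<and> (AE x in lebesgue. x \<in> boundary_strip \<tau> \<Omega> \<longrightarrow> x \<in> U)"
  proof (intro exI[of _ "\<Union>T\<in>?B. interior T"] conjI)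
    show "open (\<Union>T\<in>?B. interior T)" by auto
    have "interior T \<subseteq> \<Omega>" if "T \<in> \<tau>" for T unfolding m(2) using that by (intro interior_mono) blast
    then show "(\<Union>T\<in>?B. interior T) \<subseteq> boundary_strip \<tau> \<Omega>"
      using interior_subset unfolding boundary_strip_def by blast
    from AE_not_element_frontier[OF reg] show "AE x in lebesgue. x \<in> boundary_strip \<tau> \<Omega> \<longrightarrow> x \<in> (\<Union>T\<in>?B. interior T)"
    proof eventually_elim
      case (elim x)
      have "x \<in> interior T" if "T \<in> \<tau>" "x \<in> T" for T
        using elim that closure_subset[of T] by (auto simp: frontier_def)
      then show ?case by (auto simp: boundary_strip_def)
    qed
  qed
qed

lemma AE_strip: "(AE x in lebesgue_on (boundary_strip \<tau> \<Omega>). P x) \<longleftrightarrow> (AE x in lebesgue_on \<Omega>. x \<in> boundary_strip \<tau> \<Omega> \<longrightarrow> P x)"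
proof -
  have "boundary_strip \<tau> \<Omega> \<inter> space lebesgue \<in> sets lebesgue" "\<Omega> \<inter> space lebesgue \<in> sets lebesgue"
    using strip_facts(2) mesh_facts(4)[OF reg] by auto
  then show ?thesis
    using strip_facts(1) by (simp add: AE_restrict_space_iff) (rule AE_cong, auto)
qed

lemma weak_partial_zero_on_strip:
  assumes u: "u \<in> H1 \<Omega>" and zero: "AE x in lebesgue_on (boundary_strip \<tau> \<Omega>). u x = 0"
  shows "AE x in lebesgue_on \<Omega>. x \<in> boundary_strip \<tau> \<Omega> \<longrightarrow> weak_partial \<Omega> j u x = 0"
proof -
  note ob = mesh_facts(4,5)[OF reg]
  obtain U where U: "open U" "U \<subseteq> boundary_strip \<tau> \<Omega>" "AE x in lebesgue. x \<in> boundary_strip \<tau> \<Omega> \<longrightarrow> x \<in> U" using strip_facts(4) by blast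
  have sets: "boundary_strip \<tau> \<Omega> \<inter> space lebesgue \<in> sets lebesgue" "\<Omega> \<inter> space lebesgue \<in> sets lebesgue" "U \<inter> space lebesgue \<in> sets lebesgue"
    using strip_facts(2) ob U by auto
  have "AE x in lebesgue. x \<in> boundary_strip \<tau> \<Omega> \<longrightarrow> u x = 0" using zero unfolding AE_restrict_space_iff[OF sets(1)] .
  then have "AE x in lebesgue_on U. u x = 0"
    unfolding AE_restrict_space_iff[OF sets(3)] by eventually_elim (use U(2) in blast)
  then have "AE x in lebesgue_on U. weak_partial \<Omega> j u x = 0"
    using U(1,2) strip_facts(1) by (intro weak_partial_local_zero[OF ob u]) auto
  then have "AE x in lebesgue. x \<in> U \<longrightarrow> weak_partial \<Omega> j u x = 0"
    unfolding AE_restrict_space_iff[OF sets(3)] .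
  with U(3) show ?thesis
    unfolding AE_restrict_space_iff[OF sets(2)] by eventually_elim blast
qed

text \<open>The discrete replacement of the constant field: \<open>\<phi>\<close> is the nodal function of the interior vertices.\<close>

lemma exists_strip_test_field:
  fixes i :: 'd
  assumes "k \<ge> 1"
  shows "\<exists>\<psi> \<phi>. \<psi> = (\<lambda>x. \<phi> x *\<^sub>R axis i 1) \<and> \<psi> \<in> Xh \<Omega> \<tau> k \<and> \<psi> \<in> Yh \<Omega> \<tau> k \<and> \<phi> \<in> L2 \<Omega> \<and>
    (\<forall>x \<in> \<Omega> - boundary_strip \<tau> \<Omega>. \<phi> x = 1) \<and>
    (\<forall>m j. AE x in lebesgue_on \<Omega>. x \<notin> boundary_strip \<tau> \<Omega> \<longrightarrow> weak_partial \<Omega> j (\<lambda>y. \<psi> y $ m) x = 0)"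
proof -
  note ob = mesh_facts(4,5)[OF reg]
  obtain \<phi> L where \<phi>: "L-lipschitz_on UNIV \<phi>" "\<forall>x. x \<notin> \<Omega> \<longrightarrow> \<phi> x = 0" "\<forall>x. \<phi> x \<ge> 0"
    "AE x in lebesgue_on \<Omega>. \<exists>g r. r > 0 \<and> (\<forall>y\<in>ball x r. \<phi> y = \<phi> x + g \<bullet> (y - x))"
    "\<forall>x\<in>\<Omega> - boundary_strip \<tau> \<Omega>. \<phi> x = 1" "\<phi> \<in> piecewise_poly k \<tau>"
    using exists_nodal_function[OF reg assms] by (elim exE conjE)
  have H: "\<phi> \<in> H1_0 \<Omega>" "AE x in lebesgue_on \<Omega>. weak_partial \<Omega> j \<phi> x = quotient_deriv j \<phi> x" for j
    by (rule lipschitz_H1_0[OF ob \<phi>(1) _ _ \<phi>(4)]; simp add: \<phi>(2,3))+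
  have H0: "(\<lambda>x. 0) \<in> H1_0 \<Omega>" using H1_0_diff[OF ob H(1) H(1)] by simp
  define \<psi> where "\<psi> = (\<lambda>x. \<phi> x *\<^sub>R (axis i 1 :: real ^ 'd))"
  have comp: "(\<lambda>x. \<psi> x $ m) = (if m = i then \<phi> else (\<lambda>x. 0))" for m
    by (auto simp: \<psi>_def axis_def fun_eq_iff)
  have X: "\<psi> \<in> X_space \<Omega>" unfolding X_space_def by (simp add: comp H H0)
  have "(\<lambda>x. 0) \<in> piecewise_poly k \<tau>"
    unfolding piecewise_poly_def
    using affine_polynomial_of_degree_le[OF assms, of 0 0] by (auto intro!: exI[of _ "\<lambda>x. 0"])
  then have P: "\<psi> \<in> piecewise_poly_field k \<tau>" unfolding piecewise_poly_field_def by (simp add: comp \<phi>(6))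
  have deriv_zero: "quotient_deriv j \<phi> x = 0" if "x \<in> \<Omega> - boundary_strip \<tau> \<Omega>" for j x
  proof -
    have "(\<phi> has_derivative (\<lambda>v. 0)) (at x)"
      by (rule has_derivative_transform_within_open[OF has_derivative_const[of 1] strip_facts(3) that])
         (simp add: \<phi>(5))
    then show ?thesis by (rule quotient_deriv_eq)
  qed
  have D: "AE x in lebesgue_on \<Omega>. x \<notin> boundary_strip \<tau> \<Omega> \<longrightarrow> weak_partial \<Omega> j (\<lambda>y. \<psi> y $ m) x = 0" for m j
  proof (cases "m = i")
    case True
    have "AE x in lebesgue_on \<Omega>. x \<in> \<Omega>" by (rule AE_I2) simp
    with H(2)[of j] show ?thesis unfolding comp if_P[OF True]
      by eventually_elim (simp add: deriv_zero)
  next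
    case False
    have "AE x in lebesgue_on \<Omega>. weak_partial \<Omega> j (\<lambda>x. 0) x = 0"
      by (rule weak_partial_local_zero[OF ob H1_0_H1[OF ob H0] ob(1) order_refl]) simp
    then show ?thesis unfolding comp if_not_P[OF False] by eventually_elim simp
  qed
  show ?thesis
    using \<psi>_def X P X_space_subset_Y_space[OF ob X] H1_L2[OF ob H1_0_H1[OF ob H(1)]] \<phi>(5) D
    by (intro exI[of _ \<psi>] exI[of _ \<phi>] conjI allI) (simp_all only: Xh_def Yh_def Int_iff)
qed


lemma L2_inner_test_field:
  fixes w :: "real ^ 'd \<Rightarrow> real ^ 'd"
  assumes \<psi>: "\<psi> = (\<lambda>x. \<phi> x *\<^sub>R axis i 1)" "\<phi> \<in> L2 \<Omega>" "\<forall>x\<in>\<Omega> - boundary_strip \<tau> \<Omega>. \<phi> x = 1"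
    and w: "w \<in> L2 \<Omega>" "AE x in lebesgue_on \<Omega>. x \<in> boundary_strip \<tau> \<Omega> \<longrightarrow> w x = 0"
  shows "L2_inner \<Omega> w \<psi> = momentum \<Omega> i w"
proof -
  have wi: "(\<lambda>x. w x $ i) \<in> L2 \<Omega>" using w(1) by (rule L2_component)
  have "AE x in lebesgue_on \<Omega>. x \<in> \<Omega>" by (rule AE_I2) simp
  with w(2) have "AE x in lebesgue_on \<Omega>. \<phi> x * w x $ i = w x $ i"
    by eventually_elim (use \<psi>(3) in auto)
  then have "(LINT x|lebesgue_on \<Omega>. \<phi> x * w x $ i) = (LINT x|lebesgue_on \<Omega>. w x $ i)"
    by (intro integral_cong_AE borel_measurable_times L2_measurable wi \<psi>(2))
  then show ?thesis by (simp add: momentum_def L2_inner_def \<psi>(1) inner_axis)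
qed

text \<open>Off the strip the test field is the basis vector, and on the strip the factor \<open>v\<close> is zero; so the test
  field may be replaced by the basis vector, which reduces the claim to \<open>emac_terms_cancel\<close>.\<close>

lemma emac_form_test_field:
  fixes v :: "real ^ 'd \<Rightarrow> real ^ 'd"
  assumes \<psi>: "\<psi> = (\<lambda>x. \<phi> x *\<^sub>R axis i 1)" "\<phi> \<in> L2 \<Omega>" "\<forall>x\<in>\<Omega> - boundary_strip \<tau> \<Omega>. \<phi> x = 1"
    and v: "v \<in> X_space \<Omega>" "AE x in lebesgue_on \<Omega>. x \<in> boundary_strip \<tau> \<Omega> \<longrightarrow> v x = 0"
  shows "emac_form \<Omega> v v \<psi> = 0"
proof -
  note ob = mesh_facts(4,5)[OF reg]
  note X = X_space_facts[OF ob v(1)]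
  let ?d = "\<lambda>j m x. weak_partial \<Omega> j (\<lambda>y. v y $ m) x"
  let ?A = "\<lambda>x. \<Sum>j\<in>UNIV. ?d j i x * v x $ j + ?d i j x * v x $ j"
  let ?B = "\<lambda>x. \<Sum>j\<in>UNIV. ?d j j x * v x $ i"
  have prod: "integrable (lebesgue_on \<Omega>) (\<lambda>x. ?d j m x * v x $ l)" for j m l
    using integrable_L2_inner[OF X(4)[where j=j and i=m] X(2)[where i=l]] by simp
  have space: "AE x in lebesgue_on \<Omega>. x \<in> \<Omega>" by (rule AE_I2) simp
  have "((2 *\<^sub>R sym_grad \<Omega> v x) *v v x) \<bullet> \<psi> x = \<phi> x * ?A x" for x
  proof -
    have "((2 *\<^sub>R sym_grad \<Omega> v x) *v v x) $ i = ?A x"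
      by (simp add: sym_grad_def weak_jacobian_def transpose_def matrix_vector_mult_def distrib_right sum.distrib)
    then show ?thesis by (simp add: \<psi>(1) inner_axis)
  qed
  then have "L2_inner \<Omega> (\<lambda>x. (2 *\<^sub>R sym_grad \<Omega> v x) *v v x) \<psi> = (LINT x|lebesgue_on \<Omega>. \<phi> x * ?A x)"
    by (simp add: L2_inner_def)
  also have "\<dots> = (LINT x|lebesgue_on \<Omega>. ?A x)"
  proof (rule integral_cong_AE)
    show A: "?A \<in> borel_measurable (lebesgue_on \<Omega>)"
      by (intro borel_measurable_sum borel_measurable_add borel_measurable_integrable prod)
    show "(\<lambda>x. \<phi> x * ?A x) \<in> borel_measurable (lebesgue_on \<Omega>)"
      using L2_measurable[OF \<psi>(2)] A by (rule borel_measurable_times)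
    show "AE x in lebesgue_on \<Omega>. \<phi> x * ?A x = ?A x"
      using v(2) space by eventually_elim (use \<psi>(3) in auto)
  qed
  also have "\<dots> = (\<Sum>j\<in>UNIV. L2_inner \<Omega> (?d j i) (\<lambda>x. v x $ j) + L2_inner \<Omega> (?d i j) (\<lambda>x. v x $ j))"
    using prod by (simp add: L2_inner_def)
  finally have 1: "L2_inner \<Omega> (\<lambda>x. (2 *\<^sub>R sym_grad \<Omega> v x) *v v x) \<psi>
    = (\<Sum>j\<in>UNIV. L2_inner \<Omega> (?d j i) (\<lambda>x. v x $ j) + L2_inner \<Omega> (?d i j) (\<lambda>x. v x $ j))" .
  have "L2_inner \<Omega> (\<lambda>x. weak_div \<Omega> v x *\<^sub>R v x) \<psi> = (LINT x|lebesgue_on \<Omega>. \<phi> x * (weak_div \<Omega> v x * v x $ i))"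
    by (simp add: L2_inner_def \<psi>(1) inner_axis)
  also have "\<dots> = (LINT x|lebesgue_on \<Omega>. ?B x)"
  proof (rule integral_cong_AE)
    show "(\<lambda>x. \<phi> x * (weak_div \<Omega> v x * v x $ i)) \<in> borel_measurable (lebesgue_on \<Omega>)"
      by (intro borel_measurable_times L2_measurable \<psi>(2) X(2) X_space_weak_div(1)[OF ob v(1)])
    show "?B \<in> borel_measurable (lebesgue_on \<Omega>)"
      by (intro borel_measurable_sum borel_measurable_integrable prod)
    show "AE x in lebesgue_on \<Omega>. \<phi> x * (weak_div \<Omega> v x * v x $ i) = ?B x"
      using v(2) space X_space_weak_div(3)[OF ob v(1)]
    proof eventually_elim
      case (elim x)
      then show ?case using \<psi>(3) by (cases "x \<in> boundary_strip \<tau> \<Omega>") (simp_all add: sum_distrib_right)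
    qed
  qed
  also have "\<dots> = (\<Sum>j\<in>UNIV. L2_inner \<Omega> (?d j j) (\<lambda>x. v x $ i))"
    using prod by (simp add: L2_inner_def)
  finally show ?thesis
    using emac_terms_cancel[OF v(1)] 1 by (simp add: emac_form_def sum.distrib)
qed

text \<open>The supports are complementary: the gradient of \<open>v\<close> is zero on the strip by locality, that of the test
  field off the strip.\<close>

lemma viscous_term_zero:
  assumes v: "v \<in> X_space \<Omega>" "AE x in lebesgue_on (boundary_strip \<tau> \<Omega>). v x = 0"
    and \<psi>: "\<forall>m j. AE x in lebesgue_on \<Omega>. x \<notin> boundary_strip \<tau> \<Omega> \<longrightarrow> weak_partial \<Omega> j (\<lambda>y. \<psi> y $ m) x = 0"
  shows "L2_inner \<Omega> (weak_jacobian \<Omega> v) (weak_jacobian \<Omega> \<psi>) = 0"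
  unfolding L2_inner_def
proof (rule integral_eq_zero_AE)
  note ob = mesh_facts(4,5)[OF reg]
  have "AE x in lebesgue_on \<Omega>. weak_partial \<Omega> j (\<lambda>y. v y $ m) x * weak_partial \<Omega> j (\<lambda>y. \<psi> y $ m) x = 0" for m j
  proof -
    have "AE x in lebesgue_on (boundary_strip \<tau> \<Omega>). v x $ m = 0" using v(2) by eventually_elim simp
    from weak_partial_zero_on_strip[OF X_space_facts(1)[OF ob v(1)] this, of j] \<psi>[rule_format, of j m]
    show ?thesis by eventually_elim auto
  qed
  then have "AE x in lebesgue_on \<Omega>. \<forall>m\<in>UNIV. \<forall>j\<in>UNIV. weak_partial \<Omega> j (\<lambda>y. v y $ m) x * weak_partial \<Omega> j (\<lambda>y. \<psi> y $ m) x = 0"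
    by (intro AE_finite_allI) auto
  then show "AE x in lebesgue_on \<Omega>. weak_jacobian \<Omega> v x \<bullet> weak_jacobian \<Omega> \<psi> x = 0"
    unfolding inner_vec_def weak_jacobian_def
    by eventually_elim (auto intro!: sum.neutral)
qed

lemma ext_pairing_eq:
  assumes F: "F \<in> Hm1 \<Omega>" "functional_vanishes_on \<Omega> (boundary_strip \<tau> \<Omega>) F"
    and \<psi>: "\<psi> \<in> X_space \<Omega>" "\<And>x. x \<in> \<Omega> - boundary_strip \<tau> \<Omega> \<Longrightarrow> \<psi> x = w x"
  shows "ext_pairing \<Omega> (boundary_strip \<tau> \<Omega>) F w = F \<psi>"
  unfolding ext_pairing_def
proof (rule the_equality)
  note ob = mesh_facts(4,5)[OF reg]
  have ae: "AE x in lebesgue_on (\<Omega> - boundary_strip \<tau> \<Omega>). \<psi> x = w x" by (rule AE_I2) (use \<psi>(2) in simp)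
  then show "\<exists>v\<in>X_space \<Omega>. (AE x in lebesgue_on (\<Omega> - boundary_strip \<tau> \<Omega>). v x = w x) \<and> F \<psi> = F v" using \<psi>(1) by blast
  fix r assume "\<exists>v\<in>X_space \<Omega>. (AE x in lebesgue_on (\<Omega> - boundary_strip \<tau> \<Omega>). v x = w x) \<and> r = F v"
  then obtain v where v: "v \<in> X_space \<Omega>" "AE x in lebesgue_on (\<Omega> - boundary_strip \<tau> \<Omega>). v x = w x" "r = F v" by blast
  have "AE x in lebesgue_on (\<Omega> - boundary_strip \<tau> \<Omega>). v x - \<psi> x = 0" using v(2) ae by eventually_elim simp
  then have "F (\<lambda>x. v x - \<psi> x) = 0"
    by (rule F(2)[unfolded functional_vanishes_on_def, rule_format, OF X_space_diff[OF ob v(1) \<psi>(1)]])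
  moreover have "\<forall>u\<in>X_space \<Omega>. \<forall>v\<in>X_space \<Omega>. \<forall>a b. F (\<lambda>x. a *\<^sub>R u x + b *\<^sub>R v x) = a * F u + b * F v"
    using F(1) by (simp add: Hm1_def)
  from this[rule_format, OF v(1) \<psi>(1), of 1 "-1"]
  have "F (\<lambda>x. 1 *\<^sub>R v x + (- 1) *\<^sub>R \<psi> x) = 1 * F v + (- 1) * F \<psi>" .
  ultimately show "r = F \<psi>" using v(3) by simp
qed

lemma pressure_term_zero:
  assumes \<psi>: "\<psi> \<in> X_space \<Omega>" "\<forall>m j. AE x in lebesgue_on \<Omega>. x \<notin> boundary_strip \<tau> \<Omega> \<longrightarrow> weak_partial \<Omega> j (\<lambda>y. \<psi> y $ m) x = 0"
    and q: "AE x in lebesgue_on (boundary_strip \<tau> \<Omega>). q x = 0"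
  shows "L2_inner \<Omega> q (weak_div \<Omega> \<psi>) = 0"
  unfolding L2_inner_def
proof (rule integral_eq_zero_AE)
  have "AE x in lebesgue_on \<Omega>. \<forall>j\<in>UNIV. x \<notin> boundary_strip \<tau> \<Omega> \<longrightarrow> weak_partial \<Omega> j (\<lambda>y. \<psi> y $ j) x = 0"
    using \<psi>(2) by (intro AE_finite_allI) auto
  then show "AE x in lebesgue_on \<Omega>. q x \<bullet> weak_div \<Omega> \<psi> x = 0"
    using q[unfolded AE_strip] X_space_weak_div(3)[OF mesh_facts(4,5)[OF reg] \<psi>(1)]
    by eventually_elim auto
qed

end

theorem mainTheorem3:
  fixes \<Omega> :: "(real ^ 'd) set" and \<tau> :: "(real ^ 'd) set set"
    and \<sigma> \<beta> \<nu> T :: real and k M :: nat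
    and f :: "real \<Rightarrow> (real ^ 'd \<Rightarrow> real ^ 'd) \<Rightarrow> real"
    and u0 :: "real ^ 'd \<Rightarrow> real ^ 'd"
    and ut u :: "nat \<Rightarrow> real ^ 'd \<Rightarrow> real ^ 'd"
    and P :: "nat \<Rightarrow> real ^ 'd \<Rightarrow> real"
  assumes "CARD('d) = 2 \<or> CARD('d) = 3"
    and "\<sigma> > 0" and "regular_triangulation_of \<sigma> \<tau> \<Omega>" and "admissible_domain \<tau> \<Omega>"
    and "k \<ge> 1"
    and "\<beta> > 0" and "inf_sup \<beta> \<Omega> \<tau> k"
    and "\<nu> > 0" and "T > 0" and "M \<ge> 1"
    and "f \<in> Linf_Hm1 \<Omega> T"
    and "admissible_initial \<Omega> u0"
    and "emac_be_proj_solution \<Omega> \<tau> k \<nu> f u0 T M ut u P"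
    and "\<forall>t\<in>{0<..T}. functional_vanishes_on \<Omega> (boundary_strip \<tau> \<Omega>) (f t)"
    and "\<forall>n\<le>M. AE x in lebesgue_on (boundary_strip \<tau> \<Omega>). ut n x = 0"
    and "\<forall>n\<le>M. AE x in lebesgue_on (boundary_strip \<tau> \<Omega>). u n x = 0"
    and "\<forall>n\<in>{1..M}. AE x in lebesgue_on (boundary_strip \<tau> \<Omega>). P n x = 0"
  shows "\<forall>i::'d. \<forall>n<M.
      momentum \<Omega> i (ut (Suc n)) - momentum \<Omega> i (ut n)
        = T / real M * ext_pairing \<Omega> (boundary_strip \<tau> \<Omega>) (f (real (Suc n) * (T / real M))) (\<lambda>x. axis i 1)
    \<and> momentum \<Omega> i (u (Suc n)) - momentum \<Omega> i (u n)
        = T / real M * ext_pairing \<Omega> (boundary_strip \<tau> \<Omega>) (f (real (Suc n) * (T / real M))) (\<lambda>x. axis i 1)"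
proof
  fix i :: 'd
  note reg = assms(3)
  note ob = mesh_facts(4,5)[OF reg]
  let ?S = "boundary_strip \<tau> \<Omega>"
  define dt where "dt = T / real M"
  have dt: "dt > 0" using \<open>T > 0\<close> \<open>M \<ge> 1\<close> by (simp add: dt_def)
  obtain \<psi> \<phi> where \<psi>: "\<psi> = (\<lambda>x. \<phi> x *\<^sub>R axis i 1)" "\<psi> \<in> Xh \<Omega> \<tau> k" "\<psi> \<in> Yh \<Omega> \<tau> k" "\<phi> \<in> L2 \<Omega>"
    "\<forall>x\<in>\<Omega> - ?S. \<phi> x = 1"
    "\<forall>m j. AE x in lebesgue_on \<Omega>. x \<notin> ?S \<longrightarrow> weak_partial \<Omega> j (\<lambda>y. \<psi> y $ m) x = 0"
    using exists_strip_test_field[OF reg assms(5), of i] by (elim exE conjE)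
  have \<psi>X: "\<psi> \<in> X_space \<Omega>" using \<psi>(2) by (simp add: Xh_def)
  note scheme = assms(13)[unfolded emac_be_proj_solution_def Let_def dt_def[symmetric]]
  have u0: "u 0 \<in> Vh \<Omega> \<tau> k" "AE x in lebesgue_on \<Omega>. ut 0 x = u 0 x"
    using scheme by (auto simp: is_L2_projection_def)
  have step: "ut (Suc n) \<in> Xh \<Omega> \<tau> k" "u (Suc n) \<in> Yh \<Omega> \<tau> k"
     "1 / dt * L2_inner \<Omega> (\<lambda>x. ut (Suc n) x - u n x) \<psi> + emac_form \<Omega> (ut (Suc n)) (ut (Suc n)) \<psi>
        + \<nu> * L2_inner \<Omega> (weak_jacobian \<Omega> (ut (Suc n))) (weak_jacobian \<Omega> \<psi>) = f (real (Suc n) * dt) \<psi>"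
     "1 / dt * L2_inner \<Omega> (u (Suc n)) \<psi> - L2_inner \<Omega> (P (Suc n)) (weak_div \<Omega> \<psi>) = 1 / dt * L2_inner \<Omega> (ut (Suc n)) \<psi>"
    if "n < M" for n
    using scheme that \<psi>(2,3) by blast+
  have uL2: "u n \<in> L2 \<Omega>" if "n \<le> M" for n
  proof (cases n)
    case 0
    then show ?thesis using u0(1) X_space_facts(3)[OF ob] by (simp add: Vh_def Xh_def)
  next
    case (Suc m)
    then show ?thesis using step(2)[of m] that by (simp add: Yh_def Y_space_def)
  qed
  have utX: "ut (Suc n) \<in> X_space \<Omega>" if "n < M" for n using step(1)[OF that] by (simp add: Xh_def)
  have utL2: "ut (Suc n) \<in> L2 \<Omega>" if "n < M" for n using X_space_facts(3)[OF ob utX[OF that]] .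
  have ut0: "AE x in lebesgue_on \<Omega>. x \<in> ?S \<longrightarrow> ut n x = 0" and uS: "AE x in lebesgue_on \<Omega>. x \<in> ?S \<longrightarrow> u n x = 0"
    if "n \<le> M" for n
    using assms(15,16) that unfolding AE_strip[OF reg] by blast+
  note test = L2_inner_test_field[OF reg \<psi>(1,4,5)]
  have same: "momentum \<Omega> i (u n) = momentum \<Omega> i (ut n)" if "n \<le> M" for n
  proof (cases n)
    case 0
    have "momentum \<Omega> i (ut 0) = momentum \<Omega> i (u 0)"
      by (rule momentum_cong_AE[OF ob(1) uL2[OF le0] u0(2)])
    then show ?thesis using 0 by simp
  next
    case (Suc m)
    then have m: "m < M" using that by simp
    have "AE x in lebesgue_on ?S. P (Suc m) x = 0" using assms(17) m by simp
    then have "L2_inner \<Omega> (P (Suc m)) (weak_div \<Omega> \<psi>) = 0" by (rule pressure_term_zero[OF reg \<psi>X \<psi>(6)])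
    then have "L2_inner \<Omega> (u (Suc m)) \<psi> = L2_inner \<Omega> (ut (Suc m)) \<psi>" using step(4)[OF m] dt by simp
    then show ?thesis
      using test[OF uL2 uS, of "Suc m"] test[OF utL2[OF m] ut0] m Suc by simp
  qed
  \<comment> \<open>The first step starts from \<open>u n\<close>, not from \<open>ut n\<close>; \<open>same\<close> identifies their momenta.\<close>
  have main: "momentum \<Omega> i (ut (Suc n)) - momentum \<Omega> i (u n)
        = dt * ext_pairing \<Omega> ?S (f (real (Suc n) * dt)) (\<lambda>x. axis i 1)" if n: "n < M" for n
  proof -
    let ?t = "real (Suc n) * dt"
    have "real (Suc n) * dt \<le> real M * dt" using n dt by (intro mult_right_mono) auto
    also have "real M * dt = T" using \<open>M \<ge> 1\<close> by (simp add: dt_def)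
    finally have t: "?t \<in> {0<..T}" using dt by simp
    have F: "f ?t \<in> Hm1 \<Omega>" "functional_vanishes_on \<Omega> ?S (f ?t)"
      using assms(11,14) t by (auto simp: Linf_Hm1_def)
    have ext: "ext_pairing \<Omega> ?S (f ?t) (\<lambda>x. axis i 1) = f ?t \<psi>"
      by (rule ext_pairing_eq[OF reg F \<psi>X]) (simp add: \<psi>(1,5))
    have L: "ut (Suc n) \<in> L2 \<Omega>" "u n \<in> L2 \<Omega>" using utL2 uL2 n by auto
    have "AE x in lebesgue_on \<Omega>. x \<in> ?S \<longrightarrow> ut (Suc n) x - u n x = 0"
      using ut0[of "Suc n"] uS[of n] n by (auto elim!: AE_mp)
    from test[OF L2_diff[OF L] this]
    have "L2_inner \<Omega> (\<lambda>x. ut (Suc n) x - u n x) \<psi> = momentum \<Omega> i (\<lambda>x. ut (Suc n) x - u n x)" by simp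
    also have "\<dots> = momentum \<Omega> i (ut (Suc n)) - momentum \<Omega> i (u n)"
      unfolding momentum_def by (rule L2_inner_diff_left[OF L L2_continuous[OF ob]]) simp
    finally have 1: "L2_inner \<Omega> (\<lambda>x. ut (Suc n) x - u n x) \<psi> = momentum \<Omega> i (ut (Suc n)) - momentum \<Omega> i (u n)" .
    have 2: "emac_form \<Omega> (ut (Suc n)) (ut (Suc n)) \<psi> = 0"
      by (rule emac_form_test_field[OF reg \<psi>(1,4,5) utX[OF n] ut0]) (use n in auto)
    have 3: "L2_inner \<Omega> (weak_jacobian \<Omega> (ut (Suc n))) (weak_jacobian \<Omega> \<psi>) = 0"
      by (rule viscous_term_zero[OF reg utX[OF n] _ \<psi>(6)]) (use assms(15) n in auto)
    have "1 / dt * (momentum \<Omega> i (ut (Suc n)) - momentum \<Omega> i (u n)) = f ?t \<psi>"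
      using step(3)[OF n] unfolding 1 2 3 by simp
    then show ?thesis using dt unfolding ext by (simp add: field_simps)
  qed
  show "\<forall>n<M.
      momentum \<Omega> i (ut (Suc n)) - momentum \<Omega> i (ut n)
        = T / real M * ext_pairing \<Omega> ?S (f (real (Suc n) * (T / real M))) (\<lambda>x. axis i 1)
    \<and> momentum \<Omega> i (u (Suc n)) - momentum \<Omega> i (u n)
        = T / real M * ext_pairing \<Omega> ?S (f (real (Suc n) * (T / real M))) (\<lambda>x. axis i 1)"
    unfolding dt_def[symmetric] using main same by (auto simp: less_imp_le)
qed

end
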